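(* Consider the plant $$\dot x=Ax+B_1w+B_2u,\qquad z=C_1(C_2x-r)+D_{12}u,\qquad y=C_2x+D_{21}w,$$ in closed loop with the tracking controller $\mathbf{K}_{CQ}^{T}$ (defined in the context) built from any stabilizing controllers $$\mathbf C:\ \dot x_c=A_cx_c+B_c(y-r),\ u_c=C_cx_c+D_c(y-r),\qquad \mathbf K:\ \dot x_k=A_kx_k+B_ky,\ u_k=C_kx_k+D_ky .$$ Let $w,r\in\mathcal P$ be dependent as in $w=\mathbf W(r)+w_1$, where $\mathbf W(r)$ is a linear time-invariant mapping with Laplace transform $\mathbf W_r(s)=\mathbf W(s)\mathbf r(s)$, $\mathbf W(s)\in\mathcal{RL}_\infty$, and $w_1\in\mathcal P$ is orthogonal to both $r$ and $\mathbf W(r)$ in the sense that $\mathbf S_{w_1r}=0$ and $\mathbf S_{w_1\mathbf W(r)}=0$. Then the following equations hold: $$\|z\|_{\mathcal P}^2=\|z_1\|_{\mathcal P}^2+\|\tilde z_2\|_{\mathcal P}^2,$$ $$\|z\|_{\mathcal P}^2-\gamma^2\|w\|_{\mathcal P}^2=\|z_1\|_{\mathcal P}^2-\gamma^2\|w_1\|_{\mathcal P}^2+\|\tilde z_2\|_{\mathcal P}^2-\gamma^2\|\mathbf W(r)\|_{\mathcal P}^2,$$ where $\gamma$ is a scalar level constant, $$\|z_1\|_{\mathcal P}^2=\frac1{2\pi}\int_{-\infty}^\infty\mathrm{Trace}[\mathbf T_{z_1w}(j\omega)\mathbf S_{w_1w_1}(j\omega)\mathbf T_{z_1w}^*(j\omega)]\,d\omega,$$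 $$\tilde{\mathbf z}_2(s)=\mathbf T_{z_1w}(s)\mathbf W_r(s)+\mathbf T_{z_2r}(s)\mathbf r(s)=\mathbf T_{z_1w}(s)\mathbf W_r(s)+\mathbf z_2(s),$$ $$\|z_2\|_{\mathcal P}^2=\frac1{2\pi}\int_{-\infty}^\infty\mathrm{Trace}[\mathbf T_{z_2r}(j\omega)\mathbf S_{rr}(j\omega)\mathbf T_{z_2r}^*(j\omega)]\,d\omega,$$ and $$\mathbf T_{z_1w}(s)=\left[\begin{array}{cc|c} A+B_2D_kC_2 & B_2C_k & B_1+B_2D_kD_{21} \\ B_kC_2 & A_k & B_kD_{21} \\ \hline (C_1+D_{12}D_k)C_2 & D_{12}C_k & 0 \end{array}\right],$$ $$\mathbf T_{z_2r}(s)=\left[\begin{array}{cc|c} A+B_2D_cC_2 & B_2C_c & -B_2D_c \\ B_cC_2 & A_c & -B_c \\ \hline (C_1+D_{12}D_c)C_2 & D_{12}C_c & -(C_1+D_{12}D_c) \end{array}\right].$$ Moreover, if $\mathbf K$ is designed to be an $\mathcal H_\infty$ control for a given $\gamma>0$ such that $\|\mathbf T_{z_1w}\|_\infty<\gamma$, then, regardless of $\mathbf C$, $$\sup_{\mathbf W(s)\in\mathcal{RL}_\infty}\Big\{\|\tilde z_2\|_{\mathcal P}^2-\gamma^2\|\mathbf W(s)\mathbf r(s)\|_{\mathcal P}^2\Big\}=\Big(\|\tilde z_2\|_{\mathcal P}^2-\gamma^2\|\widetilde{\mathbf W}(s)\mathbf r(s)\|_{\mathcal P}^2\Big)\Big|_{\mathbf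 W=\widetilde{\mathbf W}}$$ $$=\frac1{2\pi}\int_{-\infty}^\infty\mathrm{Trace}\big[\mathbf S_{rr}\mathbf T_{z_2r}^*(I-\gamma^{-2}\mathbf T_{z_1w}\mathbf T_{z_1w}^* )^{-1}\mathbf T_{z_2r}\big]\,d\omega,$$ with the worst dependent weighting $$\widetilde{\mathbf W}=(\gamma^2I-\mathbf T_{z_1w}^*\mathbf T_{z_1w})^{-1}\mathbf T_{z_1w}^*\mathbf T_{z_2r},$$ and $$\sup_{w\in\mathcal P}\big\{\|z\|_{\mathcal P}^2-\gamma^2\|w\|_{\mathcal P}^2\big\}=\sup_{w_1\in\mathcal P}\big\{\|z_1\|_{\mathcal P}^2-\gamma^2\|w_1\|_{\mathcal P}^2\big\}+\sup_{\mathbf W(s)\in\mathcal{RL}_\infty}\big\{\|\tilde z_2\|_{\mathcal P}^2-\gamma^2\|\mathbf W(s)\mathbf r(s)\|_{\mathcal P}^2\big\}$$ $$\le\frac1{2\pi}\int_{-\infty}^\infty\mathrm{Trace}\big[\mathbf S_{rr}\mathbf T_{z_2r}^*(I-\gamma^{-2}\mathbf T_{z_1w}\mathbf T_{z_1w}^* )^{-1}\mathbf T_{z_2r}\big]\,d\omega.$$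
   Context: All matrices are real, constant, of compatible dimensions; a square matrix is stable if all its eigenvalues have negative real part. Notation: $\left[\begin{array}{c|c} A & B \\ \hline C & D \end{array}\right]:=C(sI-A)^{-1}B+D$; a prime denotes transpose; $\mathbf T^*$ denotes $\mathbf T'(-s)$, i.e. the conjugate transpose of $\mathbf T(j\omega)$ on the imaginary axis. $\mathcal{RL}_\infty$ is the space of rational transfer matrices with norm $\|\mathbf T\|_\infty=\sup_\omega\bar\sigma\{\mathbf T(j\omega)\}$ ($\bar\sigma$ the largest singular value). Standing assumptions: $(A,B_2)$ is stabilizable and $(C_2,A)$ is detectable; $\mathbf C$ and $\mathbf K$ are stabilizing, i.e. $\begin{bmatrix} A+B_2D_cC_2 & B_2C_c \\ B_cC_2 & A_c \end{bmatrix}$ and $\begin{bmatrix} A+B_2D_kC_2 & B_2C_k \\ B_kC_2 & A_k \end{bmatrix}$ are stable; $L$, $L_c$ are matrices such that $A+LC_2$ and $A_c+L_cC_c$ are stable. The mapping $\mathbf W(\cdot)$ satisfies $\|\mathbf W(r)\|_{\mathcal P}<\infty$ for all $r\in\mathcal P$ and $\mathbf W(0)=0$. The tracking controller $\mathbf{K}_{CQ}^{T}$ (inputs $y,r$, output $u$) is $$\begin{aligned} \dot x_c&=(A_c+L_cC_c)x_c-L_cu+(B_c+L_cD_c)(y-r),\quad u_c=C_cx_c+D_c(y-r),\\ \dot{\hat x}&=A\hat x+B_2u+Lf,\quad f=C_2\hat x-y,\\ \dot x_q&=A_qx_q+B_qf,\quad u_q=C_qx_q+D_qf,\quad u=u_c+u_q,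 \end{aligned}$$ with $$A_q=\begin{bmatrix} A_c+L_cC_c & (B_c+L_cD_q)C_2 & -L_cC_k \\ 0 & A+B_2D_kC_2 & B_2C_k \\ 0 & B_kC_2 & A_k \end{bmatrix},\ B_q=\begin{bmatrix} -B_c-L_cD_q \\ L-B_2D_k \\ -B_k \end{bmatrix},\ C_q=\begin{bmatrix} -C_c & -D_qC_2 & C_k \end{bmatrix},\ D_q=D_c-D_k.$$ The closed-loop transfer matrix from $\begin{bmatrix} w\\ r\end{bmatrix}$ to $z$ is $\begin{bmatrix}\mathbf T_{z_1w}(s) & \mathbf T_{z_2r}(s)\end{bmatrix}$. Bold lower-case letters with argument $s$ are Laplace transforms of the corresponding signals; $\mathbf z_1(s)=\mathbf T_{z_1w}(s)\mathbf w_1(s)$ and $\mathbf z_2(s)=\mathbf T_{z_2r}(s)\mathbf r(s)$, so that $z=z_1+\tilde z_2$. Bounded power signals: all signals are deterministic, real vector valued, and zero for $t<0$. For signals $u,v$, $R_{uv}(\tau)=\lim_{T\to\infty}\frac1T\int_0^Tu(t+\tau)v(t)'\,dt$ is the (cross-)correlation, and its Fourier transform $\mathbf S_{uv}(j\omega)=\int_{-\infty}^\infty R_{uv}(\tau)e^{-j\omega\tau}d\tau$ is the (cross) spectral density. A signal $u$ has bounded power ($u\in\mathcal P$) if (1) $\|u(t)\|$ is bounded for all $t\ge0$; (2) $R_{uu}(\tau)$ exists for all $\tau$ and $\mathbf S_{uu}(j\omega)$ exists; (3) $\lim_{T\to\infty}\frac1T\int_0^T\|u(t)\|^2dt<\infty$.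 On $\mathcal P$ the seminorm is $\|u\|_{\mathcal P}=\big(\lim_{T\to\infty}\frac1T\int_0^T\|u(t)\|^2dt\big)^{1/2}=\sqrt{\mathrm{Trace}[R_{uu}(0)]}=\Big(\frac1{2\pi}\int_{-\infty}^\infty\mathrm{Trace}[\mathbf S_{uu}(j\omega)]d\omega\Big)^{1/2}$, also written $\|\mathbf u(s)\|_{\mathcal P}$ with $\mathbf u(s)$ the Laplace transform of $u$; in particular $\|\mathbf W(r)\|_{\mathcal P}=\|\mathbf W_r(s)\|_{\mathcal P}$.
   Formalization: The direct term of T_{z1w} is D12 Dk D21, not 0 (printed form holds iff this is 0); signals in P must have power equal to the integral of their spectral density; W(r) is two-sided convolution cut to t≥0; the sup over w in P is over w=W(r)+w1 as in the hypothesis. *)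

theory Defs
  imports "HOL-Analysis.Analysis" "HOL-Computational_Algebra.Polynomial"
begin

section \<open>Matrices\<close>

definition cmat :: "real^'m^'n \<Rightarrow> complex^'m^'n" where
  "cmat M = (\<chi> i j. complex_of_real (M $ i $ j))"

definition block_row :: "'a^'p^'n \<Rightarrow> 'a^'q^'n \<Rightarrow> 'a^('p + 'q)^'n" where
  "block_row M N = (\<chi> i j. case j of Inl a \<Rightarrow> M $ i $ a | Inr b \<Rightarrow> N $ i $ b)"

definition block_col :: "'a^'n^'p \<Rightarrow> 'a^'n^'q \<Rightarrow> 'a^'n^('p + 'q)" where
  "block_col M N = (\<chi> i. case i of Inl a \<Rightarrow> M $ a | Inr b \<Rightarrow> N $ b)"

definition block_mat ::
  "'a^'m^'p \<Rightarrow> 'a^'n^'p \<Rightarrow> 'a^'m^'q \<Rightarrow> 'a^'n^'q \<Rightarrow> 'a^('m + 'n)^('p + 'q)" where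
  "block_mat M11 M12 M21 M22 = block_col (block_row M11 M12) (block_row M21 M22)"

definition is_eigenvalue :: "complex^'n^'n \<Rightarrow> complex \<Rightarrow> bool" where
  "is_eigenvalue M l \<longleftrightarrow> (\<exists>v. v \<noteq> 0 \<and> M *v v = l *s v)"

definition stable_matrix :: "real^'n^'n \<Rightarrow> bool" where
  "stable_matrix M \<longleftrightarrow> (\<forall>l. is_eigenvalue (cmat M) l \<longrightarrow> Re l < 0)"

definition stabilizable :: "real^'n^'n \<Rightarrow> real^'u^'n \<Rightarrow> bool" where
  "stabilizable A B \<longleftrightarrow> (\<exists>F. stable_matrix (A + B ** F))"

definition detectable :: "real^'n^'y \<Rightarrow> real^'n^'n \<Rightarrow> bool" where
  "detectable C A \<longleftrightarrow> (\<exists>H. stable_matrix (A + H ** C))"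

definition conj_transpose :: "complex^'m^'n \<Rightarrow> complex^'n^'m" where
  "conj_transpose M = (\<chi> i j. cnj (M $ j $ i))"

definition max_singular_value :: "complex^'m^'n \<Rightarrow> real" where
  "max_singular_value M =
     Sup {\<sigma>. \<sigma> \<ge> 0 \<and> is_eigenvalue (conj_transpose M ** M) (complex_of_real (\<sigma>\<^sup>2))}"


section \<open>Transfer matrices\<close>

definition transfer_matrix ::
  "real^'n^'n \<Rightarrow> real^'m^'n \<Rightarrow> real^'n^'p \<Rightarrow> real^'m^'p \<Rightarrow> complex \<Rightarrow> complex^'m^'p" where
  "transfer_matrix A B C D s = cmat C ** matrix_inv (mat s - cmat A) ** cmat B + cmat D"

text \<open>The adjoint \<open>T'(-s)\<close>; for a real rational \<open>T\<close> it is the conjugate transpose of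
  \<open>T(j\<omega>)\<close> at \<open>s = j\<omega>\<close>.\<close>

definition para_adj :: "(complex \<Rightarrow> complex^'m^'n) \<Rightarrow> complex \<Rightarrow> complex^'n^'m" where
  "para_adj T s = transpose (T (- s))"

definition Linf_norm :: "(complex \<Rightarrow> complex^'m^'n) \<Rightarrow> real" where
  "Linf_norm T = (SUP \<omega>::real. max_singular_value (T (\<i> * complex_of_real \<omega>)))"

text \<open>Transfer matrices with real rational entries and finite norm.  A transfer matrix is a
  total function here; its values at zeros of the (not necessarily reduced) denominators are
  irrelevant, and none of these zeros lies on the imaginary axis.\<close>

definition RL_inf :: "(complex \<Rightarrow> complex^'m^'n) set" where
  "RL_inf = {T.
     (\<forall>i j. \<exists>p q :: real poly.
        (\<forall>\<omega>::real. poly (map_poly complex_of_real q) (\<i> * complex_of_real \<omega>) \<noteq> 0) \<and>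
        (\<forall>s. poly (map_poly complex_of_real q) s \<noteq> 0 \<longrightarrow>
           T s $ i $ j = poly (map_poly complex_of_real p) s / poly (map_poly complex_of_real q) s)) \<and>
     bdd_above (range (\<lambda>\<omega>::real. max_singular_value (T (\<i> * complex_of_real \<omega>))))}"


section \<open>Signals\<close>

definition bounded_signal :: "(real \<Rightarrow> real^'n) \<Rightarrow> bool" where
  "bounded_signal u \<longleftrightarrow> u \<in> borel_measurable borel \<and> (\<forall>t<0. u t = 0) \<and> bounded (range u)"

definition laplace :: "(real \<Rightarrow> real^'n) \<Rightarrow> complex \<Rightarrow> complex^'n" where
  "laplace u s = (\<chi> i. LINT t:{0..}|lborel. exp (- s * complex_of_real t) * complex_of_real (u t $ i))"

definition fourier :: "(real \<Rightarrow> real^'m^'n) \<Rightarrow> real \<Rightarrow> complex^'m^'n" where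
  "fourier H \<omega> =
     (\<chi> i j. LINT t|lborel. exp (- \<i> * complex_of_real (\<omega> * t)) * complex_of_real (H t $ i $ j))"

definition time_avg :: "(real \<Rightarrow> 'a::{banach, second_countable_topology}) \<Rightarrow> real \<Rightarrow> 'a" where
  "time_avg f T = (1 / T) *\<^sub>R (LINT t:{0..T}|lborel. f t)"

definition outer :: "real^'n \<Rightarrow> real^'m \<Rightarrow> real^'m^'n" where
  "outer a b = (\<chi> i j. a $ i * b $ j)"

definition corr_exists :: "(real \<Rightarrow> real^'n) \<Rightarrow> (real \<Rightarrow> real^'m) \<Rightarrow> bool" where
  "corr_exists u v \<longleftrightarrow>
     (\<forall>\<tau>. \<exists>R. (time_avg (\<lambda>t. outer (u (t + \<tau>)) (v t)) \<longlongrightarrow> R) at_top)"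

definition corr :: "(real \<Rightarrow> real^'n) \<Rightarrow> (real \<Rightarrow> real^'m) \<Rightarrow> real \<Rightarrow> real^'m^'n" where
  "corr u v \<tau> = Lim at_top (time_avg (\<lambda>t. outer (u (t + \<tau>)) (v t)))"

definition spec_exists :: "(real \<Rightarrow> real^'n) \<Rightarrow> (real \<Rightarrow> real^'m) \<Rightarrow> bool" where
  "spec_exists u v \<longleftrightarrow> corr_exists u v \<and> integrable lborel (corr u v)"

definition spec :: "(real \<Rightarrow> real^'n) \<Rightarrow> (real \<Rightarrow> real^'m) \<Rightarrow> real \<Rightarrow> complex^'m^'n" where
  "spec u v = fourier (corr u v)"

definition orthogonal_signals :: "(real \<Rightarrow> real^'n) \<Rightarrow> (real \<Rightarrow> real^'m) \<Rightarrow> bool" where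
  "orthogonal_signals u v \<longleftrightarrow> spec_exists u v \<and> (\<forall>\<omega>. spec u v \<omega> = 0)"

definition pow_norm :: "(real \<Rightarrow> real^'n) \<Rightarrow> real" where
  "pow_norm u = sqrt (Lim at_top (time_avg (\<lambda>t. (norm (u t))\<^sup>2)))"

text \<open>The last two conjuncts say that the spectral density carries the whole power of the
  signal, i.e. that the seminorm equals its frequency-domain expression.  This has to be required:
  for \<open>sin (t\<^sup>2)\<close> the autocorrelation is \<open>1/2\<close> at \<open>0\<close> and vanishes elsewhere, so the spectral
  density exists and is \<open>0\<close> although the power is \<open>1/2\<close>.\<close>

definition power_signals :: "(real \<Rightarrow> real^'n) set" where
  "power_signals = {u. bounded_signal u \<and> spec_exists u u \<and>
     (\<exists>l. (time_avg (\<lambda>t. (norm (u t))\<^sup>2) \<longlongrightarrow> l) at_top) \<and>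
     integrable lborel (\<lambda>\<omega>. trace (spec u u \<omega>)) \<and>
     complex_of_real ((pow_norm u)\<^sup>2) =
       1 / (2 * complex_of_real pi) * (LINT \<omega>|lborel. trace (spec u u \<omega>))}"


section \<open>Linear time-invariant mappings\<close>

text \<open>A member of \<open>RL_inf\<close> is \<open>D + fourier h\<close> on the imaginary axis for a unique \<open>D\<close> and an
  (almost everywhere) unique integrable two-sided impulse response \<open>h\<close>.  The mapping it induces is
  convolution with that response, restricted to \<open>t \<ge> 0\<close> because all signals vanish before time
  \<open>0\<close>.  If the transfer matrix is stable, then \<open>h\<close> is causal and the mapping is multiplication by
  the transfer matrix on Laplace transforms; an unstable one induces the bounded noncausal mapping.\<close>

definition impulse_response ::
  "(complex \<Rightarrow> complex^'m^'n) \<Rightarrow> real^'m^'n \<Rightarrow> (real \<Rightarrow> real^'m^'n) \<Rightarrow> bool" where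
  "impulse_response G D h \<longleftrightarrow> integrable lborel h \<and>
     (\<forall>\<omega>. G (\<i> * complex_of_real \<omega>) = cmat D + fourier h \<omega>)"

definition lti_map ::
  "(complex \<Rightarrow> complex^'m^'n) \<Rightarrow> (real \<Rightarrow> real^'m) \<Rightarrow> real \<Rightarrow> real^'n" where
  "lti_map G u t =
     (let (D, h) = (SOME (D, h). impulse_response G D h)
      in if t < 0 then 0 else D *v u t + (LINT \<sigma>|lborel. h (t - \<sigma>) *v u \<sigma>))"

definition dependent_weighting ::
  "(real \<Rightarrow> real^'y) \<Rightarrow> (real \<Rightarrow> real^'w) \<Rightarrow> (complex \<Rightarrow> complex^'y^'w) \<Rightarrow> (real \<Rightarrow> real^'w) \<Rightarrow> bool" where
  "dependent_weighting r w W w1 \<longleftrightarrow>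
     w \<in> power_signals \<and> w1 \<in> power_signals \<and> W \<in> RL_inf \<and>
     w = (\<lambda>t. lti_map W r t + w1 t) \<and>
     orthogonal_signals w1 r \<and> orthogonal_signals w1 (lti_map W r)"


section \<open>The closed loop\<close>

text \<open>\<open>x\<close> is the state with derivative \<open>g\<close> (in the Caratheodory sense) started from rest.\<close>

definition state_of :: "(real \<Rightarrow> real^'n) \<Rightarrow> (real \<Rightarrow> real^'n) \<Rightarrow> bool" where
  "state_of g x \<longleftrightarrow> (\<forall>t<0. x t = 0) \<and> (\<forall>t\<ge>0. (g has_integral x t) {0..t})"

definition closed_loop ::
  "real^'n^'n \<Rightarrow> real^'w^'n \<Rightarrow> real^'u^'n \<Rightarrow> real^'y^'z \<Rightarrow> real^'n^'y \<Rightarrow> real^'u^'z \<Rightarrow> real^'w^'y \<Rightarrow>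
   real^'c^'c \<Rightarrow> real^'y^'c \<Rightarrow> real^'c^'u \<Rightarrow> real^'y^'u \<Rightarrow>
   real^'k^'k \<Rightarrow> real^'y^'k \<Rightarrow> real^'k^'u \<Rightarrow> real^'y^'u \<Rightarrow>
   real^'y^'n \<Rightarrow> real^'u^'c \<Rightarrow>
   (real \<Rightarrow> real^'w) \<Rightarrow> (real \<Rightarrow> real^'y) \<Rightarrow> (real \<Rightarrow> real^'z) \<Rightarrow> bool" where
  "closed_loop A B1 B2 C1 C2 D12 D21 Ac Bc Cc Dc Ak Bk Ck Dk L Lc w r z \<longleftrightarrow>
   (let Dq = Dc - Dk;
        Aq = block_mat (Ac + Lc ** Cc)
               (block_row ((Bc + Lc ** Dq) ** C2) (- (Lc ** Ck)))
               0
               (block_mat (A + B2 ** Dk ** C2) (B2 ** Ck) (Bk ** C2) Ak);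
        Bq = block_col (- Bc - Lc ** Dq) (block_col (L - B2 ** Dk) (- Bk));
        Cq = block_row (- Cc) (block_row (- (Dq ** C2)) Ck)
    in \<exists>x xc xh xq u uc uq y f.
         state_of (\<lambda>t. A *v x t + B1 *v w t + B2 *v u t) x \<and>
         (\<forall>t. z t = C1 *v (C2 *v x t - r t) + D12 *v u t) \<and>
         (\<forall>t. y t = C2 *v x t + D21 *v w t) \<and>
         state_of (\<lambda>t. (Ac + Lc ** Cc) *v xc t - Lc *v u t + (Bc + Lc ** Dc) *v (y t - r t)) xc \<and>
         (\<forall>t. uc t = Cc *v xc t + Dc *v (y t - r t)) \<and>
         state_of (\<lambda>t. A *v xh t + B2 *v u t + L *v f t) xh \<and>
         (\<forall>t. f t = C2 *v xh t - y t) \<and>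
         state_of (\<lambda>t. Aq *v xq t + Bq *v f t) xq \<and>
         (\<forall>t. uq t = Cq *v xq t + Dq *v f t) \<and>
         (\<forall>t. u t = uc t + uq t))"

end

theory Submission
  imports Defs "HOL-Probability.Probability" "HOL-Computational_Algebra.Fundamental_Theorem_Algebra"
begin

text \<open>
  Bounded rational transfer matrices are a constant plus the transform of an integrable impulse
  response, so they act on bounded signals by convolution, and correlations pass through convolutions by
  dominated convergence: filtering \<open>a\<close> by \<open>G\<close> multiplies its cross density with any signal by \<open>G\<close>.
  The only delicate point is that a correlation must be recovered at lag \<open>0\<close> from its density. For a
  bounded power signal the difference of the two sides is a positive semidefinite matrix, of trace
  \<open>0\<close> because the density carries the whole power, hence it vanishes. Applied to the joint signal
  \<open>(w1, r)\<close> this turns \<open>S = 0\<close> into genuine orthogonality, and the power identities follow.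

  In the closed loop the observer error cancels, and the state splits into the state of the loop
  of \<open>K\<close> driven by \<open>w\<close> and that of the loop of \<open>C\<close> driven by \<open>r\<close>; this gives
  \<open>z = Tzw w + Tzr r\<close>.

  For the supremum, completion of squares with \<open>N = \<gamma>\<^sup>2 I - Tzw\<^sup>* Tzw\<close> shows that the integrand of the
  functional of \<open>V\<close> is the stated one minus \<open>trace (E S E\<^sup>* N)\<close> with \<open>E = V - Wt\<close>, which is
  nonnegative since \<open>E S E\<^sup>*\<close> is positive semidefinite. The supremum over \<open>w1\<close> is \<open>0\<close>, attained
  at \<open>w1 = 0\<close>, so the pair \<open>(Wt, 0)\<close> attains the joint supremum.
\<close>

section \<open>Convolution and Laplace transforms of integrable functions\<close>

text \<open>A correlation is only known to be integrable. Inversion therefore determines it almost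
  everywhere and is silent about lag 0, where the power sits. A convolution averages this gap away,
  a direct feedthrough term does not; so every density in the calculus carries its lag-0 identity
  along. One inequality comes for free: the inverse transform is continuous and almost everywhere
  bounded by the power, hence bounded by it at lag 0 as well. This is what makes the defect
  semidefinite and lets a single trace condition suffice.

  Weightings may have poles on both sides of the axis, and the worst one contains an adjoint, so it
  is noncausal in general; the loop is causal. The construction of impulse responses therefore runs
  in two modes.

  States of the loop are solutions of integral equations, with no transform attached. They are
  identified with convolutions through the time-domain form of the resolvent equation and a Gronwall
  estimate.

  The feedthrough of \<open>Tzw\<close> is \<open>D12 ** Dk ** D21\<close>: \<open>w\<close> reaches
  \<open>y\<close> through \<open>D21\<close>, \<open>u\<close> through \<open>Dk\<close>, and
  \<open>z\<close> through \<open>D12\<close>.\<close>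

abbreviation (input) jw :: "real \<Rightarrow> complex" where
  "jw \<omega> \<equiv> \<i> * complex_of_real \<omega>"

text \<open>The two-sided transform: the Fourier transform on the imaginary axis, and the Laplace
  transform if \<open>h\<close> vanishes on negative times.\<close>

definition lap :: "(real \<Rightarrow> complex) \<Rightarrow> complex \<Rightarrow> complex" where
  "lap h s = (LINT t|lborel. exp (- s * complex_of_real t) * h t)"

definition conv :: "(real \<Rightarrow> complex) \<Rightarrow> (real \<Rightarrow> complex) \<Rightarrow> real \<Rightarrow> complex" where
  "conv f g t = (LINT s|lborel. f s * g (t - s))"

lemma integrable_shift:
  fixes f :: "real \<Rightarrow> 'a::{banach, second_countable_topology}"
  assumes "integrable lborel f"
  shows "integrable lborel (\<lambda>t. f (t + c))" "integrable lborel (\<lambda>t. f (t - c))"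
    "integrable lborel (\<lambda>t. f (c - t))" "integrable lborel (\<lambda>t. f (- t))"
  using lborel_integrable_real_affine[OF assms, of 1 c] lborel_integrable_real_affine[OF assms, of 1 "- c"]
    lborel_integrable_real_affine[OF assms, of "-1" c] lborel_integrable_real_affine[OF assms, of "-1" 0]
  by (auto simp: algebra_simps)

lemma integral_shift:
  fixes f :: "real \<Rightarrow> 'a::{banach, second_countable_topology}"
  shows "(LINT t|lborel. f (t + c)) = (LINT t|lborel. f t)" "(LINT t|lborel. f (t - c)) = (LINT t|lborel. f t)"
    "(LINT t|lborel. f (c - t)) = (LINT t|lborel. f t)" "(LINT t|lborel. f (- t)) = (LINT t|lborel. f t)"
  using lborel_integral_real_affine[of 1 f c] lborel_integral_real_affine[of 1 f "- c"]
    lborel_integral_real_affine[of "-1" f c] lborel_integral_real_affine[of "-1" f 0]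
  by (auto simp: algebra_simps)

text \<open>By translation invariance the inner integral of the norm is \<open>norm (f s)\<close>
  times a constant, which is integrable in \<open>s\<close>.\<close>

lemma integrable_conv_kernel:
  fixes f g :: "real \<Rightarrow> complex"
  assumes f: "integrable lborel f" and g: "integrable lborel g"
  shows "integrable (lborel \<Otimes>\<^sub>M lborel) (\<lambda>(s, t). (f s :: complex) * g (t - s))"
proof (rule lborel_pair.Fubini_integrable)
  have [measurable]: "f \<in> borel_measurable lborel" "g \<in> borel_measurable lborel"
    using f g by auto
  show "(\<lambda>(s, t). f s * g (t - s)) \<in> borel_measurable (lborel \<Otimes>\<^sub>M lborel)"
    by measurable
  have "(\<integral>t. norm (f s * g (t - s)) \<partial>lborel) = norm (f s) * (\<integral>t. norm (g t) \<partial>lborel)" for s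
    using integral_shift(2)[of "\<lambda>t. norm (g t)"] by (simp add: norm_mult)
  thus "integrable lborel (\<lambda>s. \<integral>t. norm (case (s, t) of (s, t) \<Rightarrow> f s * g (t - s)) \<partial>lborel)"
    using f by simp
  show "AE s in lborel. integrable lborel (\<lambda>t. case (s, t) of (s, t) \<Rightarrow> f s * g (t - s))"
    using integrable_shift(2)[OF g] by auto
qed

lemma integrable_conv:
  assumes "integrable lborel f" "integrable lborel g"
  shows "integrable lborel (conv f g)"
proof -
  have "integrable lborel (\<lambda>t. LINT s|lborel. (\<lambda>s t. f s * g (t - s)) s t)"
    using integrable_conv_kernel[OF assms] by (intro lborel_pair.integrable_snd) (simp add: case_prod_unfold)
  thus ?thesis by (simp add: conv_def[abs_def])
qed

lemma conv_causal:
  assumes "\<And>s. s < 0 \<Longrightarrow> f s = 0" "\<And>s. s < 0 \<Longrightarrow> g s = 0" "t < 0"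
  shows "conv f g t = 0"
proof -
  have "f s * g (t - s) = 0" for s using assms by (cases "s < 0") auto
  hence "(\<lambda>s. f s * g (t - s)) = (\<lambda>s. 0)" by (rule ext)
  thus ?thesis by (simp add: conv_def)
qed

lemma integral_conv:
  assumes f: "integrable lborel f" and g: "integrable lborel g"
  shows "(LINT t|lborel. conv f g t) = (LINT t|lborel. f t) * (LINT t|lborel. g t)"
proof -
  have "(LINT t|lborel. conv f g t) = (LINT s|lborel. LINT t|lborel. f s * g (t - s))"
    unfolding conv_def using integrable_conv_kernel[OF assms] by (rule lborel_pair.Fubini_integral)
  also have "\<dots> = (LINT s|lborel. f s * (LINT t|lborel. g t))"
    by (simp add: integral_shift(2))
  finally show ?thesis using f by simp
qed

text \<open>The exponential is multiplicative along \<open>t = u + (t - u)\<close>, so it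
  distributes over a convolution. The convolution theorem at any \<open>s\<close> thus reduces to
  the integral of a convolution.\<close>

lemma exp_conv:
  "exp (- s * complex_of_real t) * conv f g t =
   conv (\<lambda>t. exp (- s * complex_of_real t) * f t) (\<lambda>t. exp (- s * complex_of_real t) * g t) t"
proof -
  have "exp (- s * complex_of_real t) * (f u * g (t - u)) =
     exp (- s * complex_of_real u) * f u * (exp (- s * complex_of_real (t - u)) * g (t - u))" for u
  proof -
    have "exp (- s * complex_of_real t) =
        exp (- s * complex_of_real u) * exp (- s * complex_of_real (t - u))"
      unfolding exp_add[symmetric] by (simp add: algebra_simps)
    thus ?thesis by (simp add: mult_ac)
  qed
  thus ?thesis
    unfolding conv_def integral_mult_right_zero[symmetric] by (intro Bochner_Integration.integral_cong refl)
qed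

text \<open>Integrability is asked of the weighted functions only, so that the step function, which
  is not integrable itself, is covered for \<open>Re s > 0\<close>.\<close>

lemma lap_conv:
  assumes "integrable lborel (\<lambda>t. exp (- s * complex_of_real t) * f t)"
    and "integrable lborel (\<lambda>t. exp (- s * complex_of_real t) * g t)"
  shows "integrable lborel (\<lambda>t. exp (- s * complex_of_real t) * conv f g t)"
    and "lap (conv f g) s = lap f s * lap g s"
  unfolding lap_def exp_conv using integrable_conv[OF assms] integral_conv[OF assms] by auto

lemma integrable_exp_imaginary:
  assumes "integrable lborel h"
  shows "integrable lborel (\<lambda>t. exp (- (jw \<omega>) * complex_of_real t) * (h t :: complex))"
  by (rule Bochner_Integration.integrable_bound[OF integrable_norm[OF assms]])
     (use assms in \<open>auto simp: norm_mult\<close>)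

lemma norm_exp_imaginary [simp]: "norm (exp (- (\<i> * complex_of_real a * complex_of_real b))) = 1"
  using norm_exp_i_times[of "-(a*b)"] by (simp add: algebra_simps)

section \<open>Uniqueness and inversion for the Fourier transform\<close>

text \<open>At frequency 0 the positive and negative parts of \<open>h\<close> have the same mass.
  Divided by it they become probability densities with equal characteristic functions, and Levy's
  uniqueness theorem identifies them.\<close>

lemma fourier_unique_real:
  fixes h :: "real \<Rightarrow> real"
  assumes h: "integrable lborel h"
    and z: "\<And>\<omega>. (LINT t|lborel. iexp (\<omega> * t) * complex_of_real (h t)) = 0"
  shows "AE t in lborel. h t = 0"
proof -
  have [measurable]: "h \<in> borel_measurable lborel" using h by auto
  define p where "p = (\<lambda>t. max 0 (h t))"
  define q where "q = (\<lambda>t. max 0 (- h t))"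
  have p: "integrable lborel p" and q: "integrable lborel q"
    unfolding p_def q_def using h by auto
  have hpq: "h t = p t - q t" for t by (auto simp: p_def q_def)
  have ie: "integrable lborel (\<lambda>t. iexp (\<omega> * t) * complex_of_real (f t))"
    if "integrable lborel f" for f \<omega>
    by (rule Bochner_Integration.integrable_bound[OF integrable_norm[OF that]])
       (use that in \<open>auto simp: norm_mult\<close>)
  have eq: "(LINT t|lborel. iexp (\<omega> * t) * complex_of_real (p t)) =
            (LINT t|lborel. iexp (\<omega> * t) * complex_of_real (q t))" for \<omega>
    using z[of \<omega>] ie[OF p, of \<omega>] ie[OF q, of \<omega>]
    by (simp add: hpq right_diff_distrib)
  define m where "m = (LINT t|lborel. p t)"
  have m': "m = (LINT t|lborel. q t)" using eq[of 0] by (simp add: m_def)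
  have "m \<ge> 0" unfolding m_def by (intro integral_nonneg_AE) (auto simp: p_def)
  show ?thesis
  proof (cases "m = 0")
    \<comment> \<open>Zero mass cannot be normalised, but then both parts vanish almost
      everywhere.\<close>
    case True
    have "AE t in lborel. p t = 0" "AE t in lborel. q t = 0"
      using integral_nonneg_eq_0_iff_AE[OF p] integral_nonneg_eq_0_iff_AE[OF q] True m'
      by (auto simp: p_def q_def m_def)
    thus ?thesis by eventually_elim (simp add: hpq)
  next
    case False
    hence mp: "m > 0" using \<open>m \<ge> 0\<close> by auto
    define D :: "(real \<Rightarrow> real) \<Rightarrow> real measure" where "D f = density lborel (\<lambda>t. ennreal (f t / m))" for f
    have D: "real_distribution (D f) \<and>
        char (D f) = (\<lambda>\<omega>. (LINT t|lborel. iexp (\<omega> * t) * complex_of_real (f t)) / complex_of_real m)"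
      if f: "integrable lborel f" "(LINT t|lborel. f t) = m" and nn: "\<And>t. f t \<ge> 0" for f
    proof
      have [measurable]: "f \<in> borel_measurable lborel" using f by auto
      have "emeasure (D f) (space (D f)) = (\<integral>\<^sup>+t. ennreal (f t / m) \<partial>lborel)"
        by (simp add: D_def emeasure_density)
      also have "\<dots> = ennreal (LINT t|lborel. f t / m)"
        using f mp nn by (intro nn_integral_eq_integral) auto
      also have "\<dots> = 1" using f mp by simp
      finally have "prob_space (D f)" by (rule prob_spaceI)
      thus "real_distribution (D f)"
        by (simp add: real_distribution_def real_distribution_axioms_def D_def)
      show "char (D f) = (\<lambda>\<omega>. (LINT t|lborel. iexp (\<omega> * t) * complex_of_real (f t)) / complex_of_real m)"
        unfolding char_def D_def using nn mp
        by (subst integral_density) (auto simp: scaleR_conv_of_real mult_ac simp flip: integral_divide_zero)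
    qed
    have "D p = D q"
      using D[OF p] D[OF q] eq m' mp
      by (intro Levy_uniqueness) (auto simp: m_def p_def q_def)
    hence "AE t in lborel. ennreal (p t / m) = ennreal (q t / m)"
      unfolding D_def using p q by (intro sigma_finite_measure.density_unique[OF lborel.sigma_finite_measure_axioms]) auto
    thus ?thesis
    proof eventually_elim
      case (elim t)
      have "p t / m = q t / m" using elim mp by (simp add: p_def q_def)
      thus ?case using mp by (simp add: hpq)
    qed
  qed
qed

text \<open>All real frequencies are available, so replacing a frequency by its negative shows that
  \<open>cnj h\<close> has transform 0 too, and with it the real and imaginary parts of
  \<open>h\<close>.\<close>

lemma fourier_unique:
  assumes h: "integrable lborel h"
    and z: "\<And>\<omega>. lap h (jw \<omega>) = 0"
  shows "AE t in lborel. h t = 0"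
proof -
  have I: "integrable lborel (\<lambda>t. iexp (\<omega> * t) * h t)" for \<omega>
    using integrable_exp_imaginary[OF h, of "-\<omega>"] by (simp add: algebra_simps)
  have z1: "(LINT t|lborel. iexp (\<omega> * t) * h t) = 0" for \<omega>
    using z[of "-\<omega>"] by (simp add: lap_def algebra_simps)
  have z2: "(LINT t|lborel. iexp (\<omega> * t) * cnj (h t)) = 0" for \<omega>
  proof -
    have "cnj (LINT t|lborel. iexp (- \<omega> * t) * h t) = (LINT t|lborel. iexp (\<omega> * t) * cnj (h t))"
      by (subst Bochner_Integration.integral_cnj[symmetric]) (simp add: exp_cnj del: Bochner_Integration.integral_cnj)
    thus ?thesis using z1[of "-\<omega>"] by simp
  qed
  have I2: "integrable lborel (\<lambda>t. iexp (\<omega> * t) * cnj (h t))" for \<omega>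
  proof -
    have "integrable lborel (\<lambda>t. cnj (iexp (-\<omega> * t) * h t))"
      using I[of "-\<omega>"] by (subst complex_integrable_cnj)
    thus ?thesis by (simp add: exp_cnj)
  qed
  have "(LINT t|lborel. iexp (\<omega> * t) * complex_of_real (Re (h t))) = 0" for \<omega>
  proof -
    have "(LINT t|lborel. iexp (\<omega> * t) * complex_of_real (Re (h t))) =
      (LINT t|lborel. (iexp (\<omega> * t) * h t + iexp (\<omega> * t) * cnj (h t)) / 2)"
      by (intro Bochner_Integration.integral_cong refl) (simp add: complex_eq_iff)
    also have "\<dots> = 0" using z1[of \<omega>] z2[of \<omega>] I[of \<omega>] I2[of \<omega>] by simp
    finally show ?thesis .
  qed
  from fourier_unique_real[OF _ this] h have 1: "AE t in lborel. Re (h t) = 0" by auto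
  have "(LINT t|lborel. iexp (\<omega> * t) * complex_of_real (Im (h t))) = 0" for \<omega>
  proof -
    have "(LINT t|lborel. iexp (\<omega> * t) * complex_of_real (Im (h t))) =
      (LINT t|lborel. (iexp (\<omega> * t) * h t - iexp (\<omega> * t) * cnj (h t)) / (2 * \<i>))"
    proof (intro Bochner_Integration.integral_cong refl)
      fix t show "iexp (\<omega> * t) * complex_of_real (Im (h t)) =
         (iexp (\<omega> * t) * h t - iexp (\<omega> * t) * cnj (h t)) / (2 * \<i>)"
        unfolding right_diff_distrib[symmetric] complex_diff_cnj by (simp add: mult_ac)
    qed
    also have "\<dots> = 0" using z1[of \<omega>] z2[of \<omega>] I[of \<omega>] I2[of \<omega>] by simp
    finally show ?thesis .
  qed
  from fourier_unique_real[OF _ this] h have 2: "AE t in lborel. Im (h t) = 0" by auto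
  from 1 2 show ?thesis by eventually_elim (simp add: complex_eq_iff)
qed

text \<open>A constant is removed by modulation: the transform of \<open>e\<^sup>i\<^sup>t h\<close> is a translate of that of \<open>h\<close>,
  so \<open>(e\<^sup>i\<^sup>t - 1) h\<close> has transform \<open>0\<close>.\<close>

lemma fourier_const_unique:
  assumes h: "integrable lborel h"
    and z: "\<And>\<omega>. c + lap h (jw \<omega>) = 0"
  shows "c = 0" and "AE t in lborel. h t = 0"
proof -
  have e: "exp (- (jw \<omega>) * complex_of_real t) * ((iexp t - 1) * h t) =
     exp (- (\<i> * complex_of_real (\<omega> - 1)) * complex_of_real t) * h t
     - exp (- (jw \<omega>) * complex_of_real t) * h t" for \<omega> t
    by (simp add: algebra_simps exp_add exp_diff exp_minus field_simps)
  have "lap (\<lambda>t. (iexp t - 1) * h t) (jw \<omega>) =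
      lap h (\<i> * complex_of_real (\<omega> - 1)) - lap h (jw \<omega>)" for \<omega>
    unfolding lap_def e
    using integrable_exp_imaginary[OF h, of "\<omega> - 1"] integrable_exp_imaginary[OF h, of \<omega>]
    by (rule Bochner_Integration.integral_diff)
  also have "\<dots> \<omega> = 0" for \<omega> using z[of "\<omega> - 1"] z[of \<omega>] by (simp add: add_eq_0_iff)
  finally have 1: "lap (\<lambda>t. (iexp t - 1) * h t) (jw \<omega>) = 0" for \<omega> .
  have "integrable lborel (\<lambda>t. (iexp t - 1) * h t)"
    using integrable_exp_imaginary[OF h, of "-1"] h by (simp add: algebra_simps)
  from fourier_unique[OF this 1] have "AE t in lborel. (iexp t - 1) * h t = 0" .
  \<comment> \<open>On the multiples of \<open>2 * pi\<close> the factor vanishes and nothing is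
    learned about \<open>h\<close>; they form a countable set.\<close>
  moreover have "AE t in lborel. t \<notin> {t. iexp t = 1}"
  proof (rule AE_not_in)
    have "{t. iexp t = 1} \<subseteq> range (\<lambda>n::int. real_of_int n * (2 * pi))"
      by (force simp: exp_eq_1)
    hence "countable {t. iexp t = 1}" by (rule countable_subset) auto
    thus "{t. iexp t = 1} \<in> null_sets lborel" by (rule countable_imp_null_set_lborel)
  qed
  ultimately show 2: "AE t in lborel. h t = 0" by eventually_elim auto
  \<comment> \<open>With \<open>h\<close> null, the hypothesis at a single frequency is left to give
    the constant.\<close>
  have "lap h 0 = 0" unfolding lap_def using 2 by (intro integral_eq_zero_AE) auto
  thus "c = 0" using z[of 0] by simp
qed

text \<open>Read off from the characteristic function of the standard normal distribution, whose
  density is this Gaussian divided by \<open>sqrt (2 * pi)\<close>.\<close>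

lemma lap_gauss:
  "lap (\<lambda>t. complex_of_real (exp (- t\<^sup>2 / 2))) (jw \<omega>) =
   complex_of_real (sqrt (2 * pi) * exp (- \<omega>\<^sup>2 / 2))"
proof -
  have "complex_of_real (exp (- \<omega>\<^sup>2 / 2)) = char std_normal_distribution (-\<omega>)"
    by (simp add: char_std_normal_distribution)
  also have "\<dots> = (LINT t|lborel. complex_of_real (std_normal_density t) * iexp (- \<omega> * t))"
    unfolding char_def by (subst integral_density) (auto simp: normal_density_nonneg scaleR_conv_of_real)
  also have "\<dots> = (LINT t|lborel. exp (- (jw \<omega>) * complex_of_real t) *
       complex_of_real (exp (- t\<^sup>2 / 2)) / complex_of_real (sqrt (2 * pi)))"
    by (intro Bochner_Integration.integral_cong refl)
       (simp add: std_normal_density_def algebra_simps)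
  also have "\<dots> = lap (\<lambda>t. complex_of_real (exp (- t\<^sup>2 / 2))) (jw \<omega>) / complex_of_real (sqrt (2 * pi))"
    unfolding lap_def by (rule integral_divide_zero)
  finally show ?thesis by (simp add: field_simps)
qed

lemma integrable_gauss: "integrable lborel (\<lambda>t. complex_of_real (exp (- t\<^sup>2 / 2)))"
proof -
  have "integrable lborel (\<lambda>t. sqrt (2 * pi) * std_normal_density t)" by simp
  thus ?thesis by (simp add: std_normal_density_def)
qed

text \<open>The common shape of several later exchanges of integrals: integrable factors in separate
  variables and a bounded kernel, for instance an exponential or a product of bounded
  signals.\<close>

lemma integrable_pair_times:
  fixes k :: "real \<times> real \<Rightarrow> complex"
  assumes f: "integrable lborel f" and g: "integrable lborel g"
    and [measurable]: "k \<in> borel_measurable (lborel \<Otimes>\<^sub>M lborel)"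
    and b: "\<And>s t. norm (k (s, t)) \<le> B"
  shows "integrable (lborel \<Otimes>\<^sub>M lborel) (\<lambda>(s, t). (f s :: complex) * g t * k (s, t))"
proof (rule Bochner_Integration.integrable_bound)
  have [measurable]: "f \<in> borel_measurable lborel" "g \<in> borel_measurable lborel" using f g by auto
  show "integrable (lborel \<Otimes>\<^sub>M lborel) (\<lambda>(s, t). norm (f s) * norm (g t) * B)"
    by (rule lborel_pair.Fubini_integrable) (use f g in \<open>auto simp: abs_mult\<close>)
  show "(\<lambda>(s, t). f s * g t * k (s, t)) \<in> borel_measurable (lborel \<Otimes>\<^sub>M lborel)" by measurable
  show "AE p in lborel \<Otimes>\<^sub>M lborel. norm (case p of (s, t) \<Rightarrow> f s * g t * k (s, t))
      \<le> norm (case p of (s, t) \<Rightarrow> norm (f s) * norm (g t) * B)"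
    by (rule AE_I2) (auto simp: norm_mult abs_mult intro!: mult_left_mono order_trans[OF b abs_ge_self])
qed

text \<open>Both sides are multiplied by a Gaussian, which makes them integrable; then their transforms agree
  by Fubini.\<close>

lemma fourier_inversion:
  assumes h: "integrable lborel h"
    and F: "integrable lborel (\<lambda>\<omega>. lap h (jw \<omega>))"
  shows "AE t in lborel. h t =
    1 / (2 * complex_of_real pi) * (LINT \<omega>|lborel. lap h (jw \<omega>) * iexp (\<omega> * t))"
proof -
  define g where "g = (\<lambda>t::real. complex_of_real (exp (- t\<^sup>2 / 2)))"
  define f where "f = (\<lambda>\<omega>. lap h (jw \<omega>))"
  define k where "k t = 1 / (2 * complex_of_real pi) * (LINT \<omega>|lborel. f \<omega> * iexp (\<omega> * t))" for t
  have [measurable]: "h \<in> borel_measurable borel" "g \<in> borel_measurable borel"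
      "f \<in> borel_measurable borel"
    using h F by (auto simp: g_def f_def)
  have g: "integrable lborel g" unfolding g_def by (rule integrable_gauss)
  have gt: "lap g (jw \<omega>) = complex_of_real (sqrt (2 * pi)) * g \<omega>" for \<omega>
    unfolding g_def lap_gauss by simp
  have ng: "norm (g t) \<le> 1" for t by (simp add: g_def)
  have kb: "norm (k t) \<le> (LINT \<omega>|lborel. norm (f \<omega>))" for t
  proof -
    have "norm (LINT \<omega>|lborel. f \<omega> * iexp (\<omega> * t)) \<le> (LINT \<omega>|lborel. norm (f \<omega> * iexp (\<omega> * t)))"
      by (rule integral_norm_bound)
    also have "\<dots> = (LINT \<omega>|lborel. norm (f \<omega>))" by (simp add: norm_mult)
    moreover have "norm (1 / (2 * complex_of_real pi)) \<le> 1"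
      using pi_gt3 by (simp add: norm_divide field_simps)
    ultimately show ?thesis unfolding k_def norm_mult
      by (smt (verit, best) mult_left_le_one_le norm_ge_zero)
  qed
  have [measurable]: "k \<in> borel_measurable borel" unfolding k_def by measurable
  have gh: "integrable lborel (\<lambda>t. g t * h t)"
    by (rule Bochner_Integration.integrable_bound[OF integrable_norm[OF h]])
       (auto simp: norm_mult intro!: mult_left_le_one_le ng)
  have gk: "integrable lborel (\<lambda>t. g t * k t)"
    by (rule Bochner_Integration.integrable_bound[OF integrable_mult_right[OF integrable_norm[OF g],
          of "LINT \<omega>|lborel. norm (f \<omega>)"]])
       (auto simp: norm_mult abs_mult mult.commute intro!: mult_mono order_trans[OF kb])
  \<comment> \<open>The inner integral over \<open>t\<close> is the transform of the Gaussian at the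
    difference of the two frequencies, which leaves a convolution of \<open>f\<close> with
    \<open>g\<close>.\<close>
  have eqk: "lap (\<lambda>t. g t * k t) (jw \<omega>) =
     complex_of_real (sqrt (2 * pi)) / (2 * complex_of_real pi) * (LINT \<nu>|lborel. f \<nu> * g (\<omega> - \<nu>))" for \<omega>
  proof -
    have int: "integrable (lborel \<Otimes>\<^sub>M lborel)
        (\<lambda>(t, \<nu>). g t * f \<nu> * (\<lambda>(t, \<nu>). exp (- (\<i> * complex_of_real (\<omega> - \<nu>)) * complex_of_real t)) (t, \<nu>))"
      by (rule integrable_pair_times[OF g, of _ _ 1]) (use F in \<open>auto simp: f_def norm_exp_eq_Re\<close>)
    have "lap (\<lambda>t. g t * k t) (jw \<omega>) = 1 / (2 * complex_of_real pi) *
       (LINT t|lborel. LINT \<nu>|lborel. g t * f \<nu> * exp (- (\<i> * complex_of_real (\<omega> - \<nu>)) * complex_of_real t))"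
      unfolding lap_def k_def integral_mult_right_zero[symmetric]
      by (intro Bochner_Integration.integral_cong refl)
         (simp add: algebra_simps exp_diff exp_minus exp_add field_simps)
    also have "(LINT t|lborel. LINT \<nu>|lborel. g t * f \<nu> * exp (- (\<i> * complex_of_real (\<omega> - \<nu>)) * complex_of_real t)) =
       (LINT \<nu>|lborel. LINT t|lborel. g t * f \<nu> * exp (- (\<i> * complex_of_real (\<omega> - \<nu>)) * complex_of_real t))"
      using int by (subst lborel_pair.Fubini_integral) auto
    also have "\<dots> = (LINT \<nu>|lborel. f \<nu> * lap g (\<i> * complex_of_real (\<omega> - \<nu>)))"
      unfolding lap_def integral_mult_right_zero[symmetric]
      by (intro Bochner_Integration.integral_cong refl) (simp add: mult_ac)
    also have "\<dots> = (LINT \<nu>|lborel. complex_of_real (sqrt (2 * pi)) * (f \<nu> * g (\<omega> - \<nu>)))"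
      unfolding gt by (intro Bochner_Integration.integral_cong refl) (simp add: mult_ac)
    finally show ?thesis unfolding integral_mult_right_zero by simp
  qed
  have eqh: "lap (\<lambda>t. g t * h t) (jw \<omega>) =
     1 / complex_of_real (sqrt (2 * pi)) * (LINT \<nu>|lborel. f \<nu> * g (\<omega> - \<nu>))" for \<omega>
  proof -
    have int: "integrable (lborel \<Otimes>\<^sub>M lborel)
        (\<lambda>(t, \<nu>). h t * g \<nu> * (\<lambda>(t, \<nu>). exp (- (\<i> * complex_of_real (\<omega> - \<nu>)) * complex_of_real t)) (t, \<nu>))"
      by (rule integrable_pair_times[OF h g, of _ 1]) (auto simp: norm_exp_eq_Re)
    \<comment> \<open>The Gaussian is its own transform up to a constant. Written as a frequency
      integral, it can be exchanged with the integral over \<open>h\<close>, which then yields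
      \<open>f\<close> at a shifted frequency.\<close>
    have g': "g t = 1 / complex_of_real (sqrt (2 * pi)) *
        (LINT \<nu>|lborel. iexp (\<nu> * t) * g \<nu>)" for t
      using gt[of "-t"] by (simp add: lap_def g_def field_simps)
    have "lap (\<lambda>t. g t * h t) (jw \<omega>) = 1 / complex_of_real (sqrt (2 * pi)) *
       (LINT t|lborel. LINT \<nu>|lborel. h t * g \<nu> * exp (- (\<i> * complex_of_real (\<omega> - \<nu>)) * complex_of_real t))"
      unfolding lap_def integral_mult_right_zero[symmetric]
      by (subst g', intro Bochner_Integration.integral_cong refl,
          simp only: integral_mult_right_zero[symmetric] integral_mult_left_zero[symmetric],
          intro Bochner_Integration.integral_cong refl)
         (simp add: algebra_simps exp_diff exp_minus exp_add field_simps)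
    also have "(LINT t|lborel. LINT \<nu>|lborel. h t * g \<nu> * exp (- (\<i> * complex_of_real (\<omega> - \<nu>)) * complex_of_real t)) =
       (LINT \<nu>|lborel. LINT t|lborel. h t * g \<nu> * exp (- (\<i> * complex_of_real (\<omega> - \<nu>)) * complex_of_real t))"
      using int by (subst lborel_pair.Fubini_integral) auto
    also have "\<dots> = (LINT \<nu>|lborel. f (\<omega> - \<nu>) * g \<nu>)"
      unfolding lap_def integral_mult_right_zero[symmetric] f_def integral_mult_left_zero[symmetric]
      by (intro Bochner_Integration.integral_cong refl) (simp add: mult_ac)
    also have "\<dots> = (LINT \<nu>|lborel. f \<nu> * g (\<omega> - \<nu>))"
      using lborel_integral_real_affine[of "-1" "\<lambda>\<nu>. f (\<omega> - \<nu>) * g \<nu>" \<omega>] by simp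
    finally show ?thesis .
  qed
  have sq: "complex_of_real (sqrt (2 * pi)) / (2 * complex_of_real pi) = 1 / complex_of_real (sqrt (2 * pi))"
  proof -
    have "complex_of_real (sqrt (2 * pi)) * complex_of_real (sqrt (2 * pi)) = 2 * complex_of_real pi"
      unfolding of_real_mult[symmetric] by simp
    thus ?thesis by (simp add: field_simps)
  qed
  have "AE t in lborel. g t * h t - g t * k t = 0"
  proof (rule fourier_unique)
    show "integrable lborel (\<lambda>t. g t * h t - g t * k t)" using gh gk by simp
    show "lap (\<lambda>t. g t * h t - g t * k t) (jw \<omega>) = 0" for \<omega>
      using integrable_exp_imaginary[OF gh, of \<omega>] integrable_exp_imaginary[OF gk, of \<omega>] eqh[of \<omega>] eqk[of \<omega>]
      unfolding lap_def right_diff_distrib by (subst Bochner_Integration.integral_diff) (auto simp: sq)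
  qed
  moreover have "g t \<noteq> 0" for t by (simp add: g_def)
  ultimately have "AE t in lborel. h t = k t"
    by (auto elim!: eventually_mono simp flip: right_diff_distrib)
  thus ?thesis unfolding k_def f_def .
qed

section \<open>Correlations of bounded complex signals\<close>

text \<open>Complex scalars, so that entries of vector signals can be combined with complex
  coefficients. Causality is left out because convolution with a two-sided kernel destroys
  it.\<close>

definition bsig :: "(real \<Rightarrow> complex) \<Rightarrow> bool" where
  "bsig a \<longleftrightarrow> a \<in> borel_measurable borel \<and> (\<exists>B. \<forall>t. norm (a t) \<le> B)"

text \<open>A relation with an explicit limit function, so that existence and value of a limit are
  carried through a calculation together.\<close>

definition has_corr :: "(real \<Rightarrow> complex) \<Rightarrow> (real \<Rightarrow> complex) \<Rightarrow> (real \<Rightarrow> complex) \<Rightarrow> bool" where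
  "has_corr a b R \<longleftrightarrow> (\<forall>\<tau>. (time_avg (\<lambda>t. a (t + \<tau>) * cnj (b t)) \<longlongrightarrow> R \<tau>) at_top)"

lemma measurable_cnj [measurable]:
  "f \<in> borel_measurable M \<Longrightarrow> (\<lambda>x. cnj (f x)) \<in> borel_measurable M"
  by (rule measurable_compose[of f M borel cnj]) (auto intro: borel_measurable_continuous_onI continuous_intros)

lemma norm_integral_le:
  fixes f :: "'a \<Rightarrow> 'b::{banach, second_countable_topology}"
  assumes "integrable M f" "integrable M g" "\<And>x. norm (f x) \<le> g x"
  shows "norm (LINT x|M. f x) \<le> (LINT x|M. g x)"
  using assms by (intro order_trans[OF Bochner_Integration.integral_norm_bound] integral_mono) auto

lemma bsig_measurable [measurable_dest]: "bsig a \<Longrightarrow> a \<in> borel_measurable borel"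
  by (simp add: bsig_def)

lemma bsigE:
  assumes "bsig a" obtains B where "B \<ge> 0" "\<And>t. norm (a t) \<le> B"
  using assms unfolding bsig_def by (meson norm_ge_zero order_trans)

lemma bsigI: "a \<in> borel_measurable borel \<Longrightarrow> (\<And>t. norm (a t) \<le> B) \<Longrightarrow> bsig a"
  unfolding bsig_def by blast

lemma bsig_shift: "bsig a \<Longrightarrow> bsig (\<lambda>t. a (t + \<tau>))"
  by (auto simp: bsig_def)

lemma bsig_cnj: "bsig a \<Longrightarrow> bsig (\<lambda>t. cnj (a t))"
  by (auto simp: bsig_def)

lemma bsig_zero: "bsig (\<lambda>t. 0)"
  by (auto simp: bsig_def)

lemma bsig_mult: assumes "bsig a" "bsig b" shows "bsig (\<lambda>t. a t * b t)"
proof -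
  obtain A B where "A \<ge> 0" "\<And>t. norm (a t) \<le> A" "B \<ge> 0" "\<And>t. norm (b t) \<le> B"
    using assms by (meson bsigE)
  thus ?thesis using assms
    by (intro bsigI[of _ "A * B"]) (auto simp: norm_mult bsig_def intro!: mult_mono)
qed

lemma bsig_add: assumes "bsig a" "bsig b" shows "bsig (\<lambda>t. a t + b t)"
proof -
  obtain A B where "A \<ge> 0" "\<And>t. norm (a t) \<le> A" "B \<ge> 0" "\<And>t. norm (b t) \<le> B"
    using assms by (meson bsigE)
  thus ?thesis using assms
    by (intro bsigI[of _ "A + B"]) (auto simp: bsig_def intro!: norm_triangle_mono)
qed

lemma bsig_cmult: assumes "bsig a" shows "bsig (\<lambda>t. c * a t)"
proof -
  obtain A where "A \<ge> 0" "\<And>t. norm (a t) \<le> A"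
    using assms by (meson bsigE)
  thus ?thesis using assms
    by (intro bsigI[of _ "norm c * A"]) (auto simp: norm_mult bsig_def intro!: mult_left_mono)
qed

lemma bsig_diff: assumes "bsig a" "bsig b" shows "bsig (\<lambda>t. a t - b t)"
  using bsig_add[OF assms(1) bsig_cmult[OF assms(2), of "-1"]] by simp

lemma bsig_sum: "finite I \<Longrightarrow> (\<And>i. i \<in> I \<Longrightarrow> bsig (a i)) \<Longrightarrow> bsig (\<lambda>t. \<Sum>i\<in>I. a i t)"
  by (induction I rule: finite_induct) (auto intro: bsig_zero bsig_add)

lemma bsig_trunc [intro]: assumes "bsig a" shows "bsig (\<lambda>t. if t < 0 then 0 else a t)"
proof -
  obtain A where "A \<ge> 0" "\<And>t. norm (a t) \<le> A"
    using assms by (meson bsigE)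
  thus ?thesis using assms by (intro bsigI[of _ A]) auto
qed

lemma norm_conv_le:
  assumes h: "integrable lborel h" and a: "bsig a" and B: "\<And>t. norm (a t) \<le> B"
  shows "integrable lborel (\<lambda>s. h s * a (t - s))" "norm (conv h a t) \<le> B * (LINT s|lborel. norm (h s))"
proof -
  have [measurable]: "h \<in> borel_measurable borel" "a \<in> borel_measurable borel"
    using h a by (auto simp: bsig_def)
  have I: "integrable lborel (\<lambda>s. B * norm (h s))" using h by simp
  have le: "norm (h s * a (t - s)) \<le> B * norm (h s)" for s
    using mult_right_mono[OF B norm_ge_zero, of "t - s" "h s"] by (simp add: norm_mult mult.commute)
  show J: "integrable lborel (\<lambda>s. h s * a (t - s))"
    by (rule Bochner_Integration.integrable_bound[OF I]) (auto intro!: order_trans[OF le abs_ge_self])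
  show "norm (conv h a t) \<le> B * (LINT s|lborel. norm (h s))"
    unfolding conv_def using le
    by (subst integral_mult_right_zero[symmetric], intro norm_integral_le J I) auto
qed

lemma measurable_conv [measurable]:
  assumes [measurable]: "h \<in> borel_measurable borel" "a \<in> borel_measurable borel"
  shows "conv h a \<in> borel_measurable borel"
  unfolding conv_def[abs_def] by measurable

lemma bsig_conv: assumes "integrable lborel h" "bsig a" shows "bsig (conv h a)"
proof -
  obtain B where "\<And>t. norm (a t) \<le> B" using assms by (meson bsigE)
  from norm_conv_le(2)[OF assms this] show ?thesis
    by (rule bsigI[rotated]) (use assms in auto)
qed

section \<open>Time averages\<close>

lemma integrable_indicator_interval [simp]: "integrable lborel (indicat_real {x..y::real})"
proof (rule integrable_real_indicator)
  show "emeasure lborel {x..y} < \<infinity>" using emeasure_lborel_cbox_finite[of x y] by simp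
qed simp

lemma integrable_bsig_interval:
  assumes "bsig f" shows "integrable lborel (\<lambda>t. indicat_real {x..y} t *\<^sub>R f t)"
proof -
  obtain B where B: "B \<ge> 0" "\<And>t. norm (f t) \<le> B" using assms by (meson bsigE)
  have [measurable]: "f \<in> borel_measurable borel" using assms by auto
  show ?thesis
    by (rule Bochner_Integration.integrable_bound[of _ "\<lambda>t. indicat_real {x..y} t *\<^sub>R B"])
       (use B in \<open>auto intro!: AE_I2 split: split_indicator\<close>)
qed

lemma set_integrable_bsig: "bsig f \<Longrightarrow> set_integrable lborel {0..T} f"
  by (simp add: set_integrable_def integrable_bsig_interval)

lemma time_avg_add: "bsig f \<Longrightarrow> bsig g \<Longrightarrow> time_avg (\<lambda>t. f t + g t) T = time_avg f T + time_avg g T"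
  unfolding time_avg_def by (subst set_integral_add) (auto intro: set_integrable_bsig simp: scaleR_add_right)

lemma time_avg_cmult: "time_avg (\<lambda>t. c * f t) T = c * (time_avg f T :: complex)"
  unfolding time_avg_def by simp

lemma time_avg_norm_le:
  assumes f: "bsig f" and T: "T > 0" and B: "\<And>t. norm (f t) \<le> B"
  shows "norm (time_avg f T) \<le> B"
proof -
  have "norm (LINT t:{0..T}|lborel. f t) \<le> (LINT t:{0..T}|lborel. B)"
    unfolding set_lebesgue_integral_def
    by (rule norm_integral_le) (use integrable_bsig_interval[OF f] B in \<open>auto split: split_indicator\<close>)
  also have "\<dots> = B * T" using T by (simp add: set_lebesgue_integral_def)
  finally show ?thesis using T by (simp add: time_avg_def field_simps)
qed

text \<open>The integral over \<open>{0..T}\<close> stays below \<open>B * \<bar>c\<bar>\<close>,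
  while the average divides it by \<open>T\<close>.\<close>

lemma time_avg_vanish:
  assumes f: "bsig f" and c: "\<And>t. t > c \<Longrightarrow> f t = 0"
  shows "(time_avg f \<longlongrightarrow> 0) at_top"
proof -
  obtain B where B: "B \<ge> 0" "\<And>t. norm (f t) \<le> B" using f by (meson bsigE)
  have [measurable]: "f \<in> borel_measurable borel" using f by auto
  have "norm (time_avg f T) \<le> B * \<bar>c\<bar> / T" if T: "T > 0" for T
  proof -
    have "norm (LINT t:{0..T}|lborel. f t) \<le> (LINT t|lborel. indicator {0..\<bar>c\<bar>} t *\<^sub>R B)"
      unfolding set_lebesgue_integral_def
    proof (rule norm_integral_le)
      show "integrable lborel (\<lambda>t. indicator {0..T} t *\<^sub>R f t)"
        by (rule integrable_bsig_interval[OF f])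
      show "norm (indicat_real {0..T} t *\<^sub>R f t) \<le> indicator {0..\<bar>c\<bar>} t *\<^sub>R B" for t
        using B c[of t] by (cases "t > c") (auto simp: indicator_def)
    qed auto
    also have "\<dots> = B * \<bar>c\<bar>" by simp
    finally show ?thesis using T by (simp add: time_avg_def field_simps)
  qed
  hence "eventually (\<lambda>T. norm (time_avg f T) \<le> B * \<bar>c\<bar> / T) at_top"
    by (intro eventually_mono[OF eventually_gt_at_top[of 0]]) auto
  moreover have "((\<lambda>T. B * \<bar>c\<bar> / T) \<longlongrightarrow> 0) at_top"
    by (intro tendsto_divide_0[OF tendsto_const] filterlim_at_top_imp_at_infinity filterlim_ident)
  ultimately show ?thesis by (rule Lim_null_comparison)
qed

text \<open>A shift changes the integral only on two intervals of length
  \<open>\<bar>\<tau>\<bar>\<close> at the ends of \<open>{0..T}\<close>, by at most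
  \<open>2 * B * \<bar>\<tau>\<bar>\<close> in total.\<close>

lemma time_avg_shift:
  assumes f: "bsig f" and l: "(time_avg f \<longlongrightarrow> l) at_top"
  shows "(time_avg (\<lambda>t. f (t + \<tau>)) \<longlongrightarrow> l) at_top"
proof -
  obtain B where B: "B \<ge> 0" "\<And>t. norm (f t) \<le> B" using f by (meson bsigE)
  have [measurable]: "f \<in> borel_measurable borel" using f by auto
  note I = integrable_bsig_interval[OF f]
  have "norm (time_avg (\<lambda>t. f (t + \<tau>)) T - time_avg f T) \<le> (2 * B * \<bar>\<tau>\<bar>) / T" if T: "T > 0" for T
  proof -
    have "(LINT t:{0..T}|lborel. f (t + \<tau>)) =
        (LINT t|lborel. (\<lambda>t. indicat_real {\<tau>..T+\<tau>} t *\<^sub>R f t) (t + \<tau>))"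
      unfolding set_lebesgue_integral_def
      by (intro Bochner_Integration.integral_cong refl) (auto simp: indicator_def)
    also have "\<dots> = (LINT t|lborel. indicat_real {\<tau>..T+\<tau>} t *\<^sub>R f t)" by (rule integral_shift)
    finally have "norm ((LINT t:{0..T}|lborel. f (t + \<tau>)) - (LINT t:{0..T}|lborel. f t)) =
      norm (LINT t|lborel. indicat_real {\<tau>..T+\<tau>} t *\<^sub>R f t - indicat_real {0..T} t *\<^sub>R f t)"
      unfolding set_lebesgue_integral_def using I by simp
    also have "\<dots> \<le> (LINT t|lborel. indicat_real {min 0 \<tau>..max 0 \<tau>} t *\<^sub>R B +
        indicat_real {min T (T+\<tau>)..max T (T+\<tau>)} t *\<^sub>R B)"
    proof (rule norm_integral_le)
      show "norm (indicat_real {\<tau>..T+\<tau>} t *\<^sub>R f t - indicat_real {0..T} t *\<^sub>R f t) \<le>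
        indicat_real {min 0 \<tau>..max 0 \<tau>} t *\<^sub>R B + indicat_real {min T (T+\<tau>)..max T (T+\<tau>)} t *\<^sub>R B" for t
        using B(1) B(2)[of t] T by (auto simp: indicator_def min_def max_def)
    qed (use I in auto)
    also have "\<dots> = 2 * B * \<bar>\<tau>\<bar>"
      by (subst Bochner_Integration.integral_add) (auto simp: min_def max_def)
    finally show ?thesis using T unfolding time_avg_def
      by (simp add: divide_right_mono flip: scaleR_diff_right)
  qed
  hence "eventually (\<lambda>T. norm (time_avg (\<lambda>t. f (t + \<tau>)) T - time_avg f T) \<le> (2 * B * \<bar>\<tau>\<bar>) / T) at_top"
    by (intro eventually_mono[OF eventually_gt_at_top[of 0]]) auto
  moreover have "((\<lambda>T. (2 * B * \<bar>\<tau>\<bar>) / T) \<longlongrightarrow> 0) at_top"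
    by (intro tendsto_divide_0[OF tendsto_const] filterlim_at_top_imp_at_infinity filterlim_ident)
  ultimately have "((\<lambda>T. time_avg (\<lambda>t. f (t + \<tau>)) T - time_avg f T) \<longlongrightarrow> 0) at_top"
    by (rule Lim_null_comparison)
  from tendsto_add[OF this l] show ?thesis by simp
qed

lemma time_avg_cnj: "time_avg (\<lambda>t. cnj (f t)) T = cnj (time_avg f T)"
proof -
  have "(LINT t|lborel. indicat_real {0..T} t *\<^sub>R cnj (f t)) = (LINT t|lborel. cnj (indicat_real {0..T} t *\<^sub>R f t))"
    by (intro Bochner_Integration.integral_cong refl) (simp add: complex_eq_iff)
  also have "\<dots> = cnj (LINT t|lborel. indicat_real {0..T} t *\<^sub>R f t)"
    by (rule Bochner_Integration.integral_cnj)
  finally show ?thesis unfolding time_avg_def set_lebesgue_integral_def by simp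
qed

section \<open>Correlations under linear combination, reflection, truncation and convolution\<close>

lemma has_corr_unique: "has_corr a b R \<Longrightarrow> has_corr a b R' \<Longrightarrow> R = R'"
  unfolding has_corr_def using tendsto_unique[OF trivial_limit_at_top_linorder] by blast

lemma has_corr_add:
  assumes "bsig a" "bsig a'" "bsig b" "has_corr a b R" "has_corr a' b R'"
  shows "has_corr (\<lambda>t. a t + a' t) b (\<lambda>\<tau>. R \<tau> + R' \<tau>)"
  unfolding has_corr_def
proof
  fix \<tau>
  have *: "time_avg (\<lambda>t. (a (t + \<tau>) + a' (t + \<tau>)) * cnj (b t)) =
    (\<lambda>T. time_avg (\<lambda>t. a (t + \<tau>) * cnj (b t)) T + time_avg (\<lambda>t. a' (t + \<tau>) * cnj (b t)) T)"
    unfolding ring_distribs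
    by (intro ext time_avg_add bsig_mult bsig_shift bsig_cnj assms)
  show "(time_avg (\<lambda>t. (a (t + \<tau>) + a' (t + \<tau>)) * cnj (b t)) \<longlongrightarrow> R \<tau> + R' \<tau>) at_top"
    unfolding * using assms(4,5) by (intro tendsto_add) (auto simp: has_corr_def)
qed

lemma has_corr_cmult:
  assumes "has_corr a b R"
  shows "has_corr (\<lambda>t. c * a t) b (\<lambda>\<tau>. c * R \<tau>)"
proof -
  have "time_avg (\<lambda>t. c * a (t + \<tau>) * cnj (b t)) = (\<lambda>T. c * time_avg (\<lambda>t. a (t + \<tau>) * cnj (b t)) T)" for \<tau>
    by (rule ext) (simp add: mult.assoc time_avg_cmult)
  thus ?thesis using assms unfolding has_corr_def by (auto intro!: tendsto_mult_left)
qed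

lemma has_corr_zero: "has_corr (\<lambda>t. 0) b (\<lambda>\<tau>. 0)"
proof -
  have "time_avg (\<lambda>t. 0 :: complex) = (\<lambda>T. 0)" by (rule ext) (simp add: time_avg_def)
  thus ?thesis by (simp add: has_corr_def)
qed

lemma has_corr_sum:
  assumes "finite I" "\<And>i. i \<in> I \<Longrightarrow> bsig (a i)" "bsig b" "\<And>i. i \<in> I \<Longrightarrow> has_corr (a i) b (R i)"
  shows "has_corr (\<lambda>t. \<Sum>i\<in>I. a i t) b (\<lambda>\<tau>. \<Sum>i\<in>I. R i \<tau>)"
  using assms by (induction I rule: finite_induct) (auto intro!: has_corr_zero has_corr_add bsig_sum)

text \<open>Shifting time by the lag moves the lag to the other factor; the boundary effect is
  harmless by \<open>time_avg_shift\<close>.\<close>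

lemma has_corr_flip:
  assumes a: "bsig a" and b: "bsig b" and R: "has_corr a b R"
  shows "has_corr b a (\<lambda>\<tau>. cnj (R (- \<tau>)))"
  unfolding has_corr_def
proof
  fix \<tau>
  have "((\<lambda>T. cnj (time_avg (\<lambda>t. a (t + - \<tau>) * cnj (b t)) T)) \<longlongrightarrow> cnj (R (- \<tau>))) at_top"
    using R unfolding has_corr_def by (intro tendsto_cnj) blast
  moreover have "(\<lambda>T. cnj (time_avg (\<lambda>t. a (t + - \<tau>) * cnj (b t)) T)) = time_avg (\<lambda>t. cnj (a (t - \<tau>)) * b t)"
    by (simp flip: time_avg_cnj)
  ultimately have "(time_avg (\<lambda>t. cnj (a (t - \<tau>)) * b t) \<longlongrightarrow> cnj (R (- \<tau>))) at_top"
    by simp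
  moreover have "bsig (\<lambda>t. cnj (a (t - \<tau>)) * b t)"
    using bsig_mult[OF bsig_cnj[OF bsig_shift[OF a, of "- \<tau>"]] b] by simp
  ultimately have "(time_avg (\<lambda>t. (\<lambda>t. cnj (a (t - \<tau>)) * b t) (t + \<tau>)) \<longlongrightarrow> cnj (R (- \<tau>))) at_top"
    by (intro time_avg_shift)
  thus "(time_avg (\<lambda>t. b (t + \<tau>) * cnj (a t)) \<longlongrightarrow> cnj (R (- \<tau>))) at_top"
    by (simp add: mult.commute)
qed

text \<open>Models the cut at time 0 in \<open>lti_map\<close>. For lag \<open>\<tau>\<close> it
  alters the averaged product only at times below \<open>- \<tau>\<close>, which no average sees in
  the limit.\<close>

lemma has_corr_trunc:
  assumes a: "bsig a" and b: "bsig b" and R: "has_corr a b R"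
  shows "has_corr (\<lambda>t. if t < 0 then 0 else a t) b R"
  unfolding has_corr_def
proof
  fix \<tau>
  define a' where "a' t = (if t < 0 then 0 else a t)" for t
  have a': "bsig a'" using bsig_trunc[OF a] by (simp add: a'_def[abs_def])
  have "(time_avg (\<lambda>t. (a' (t + \<tau>) - a (t + \<tau>)) * cnj (b t)) \<longlongrightarrow> 0) at_top"
    by (rule time_avg_vanish[where c = "- \<tau>"]) 
       (auto simp: a'_def[of "_ + \<tau>"] intro!: bsig_mult bsig_cnj b bsig_diff bsig_shift a a')
  hence "((\<lambda>T. time_avg (\<lambda>t. (a' (t + \<tau>) - a (t + \<tau>)) * cnj (b t)) T
     + time_avg (\<lambda>t. a (t + \<tau>) * cnj (b t)) T) \<longlongrightarrow> 0 + R \<tau>) at_top"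
    using R unfolding has_corr_def by (intro tendsto_add) auto
  moreover have "time_avg (\<lambda>t. (a' (t + \<tau>) - a (t + \<tau>)) * cnj (b t)) T
     + time_avg (\<lambda>t. a (t + \<tau>) * cnj (b t)) T = time_avg (\<lambda>t. a' (t + \<tau>) * cnj (b t)) T" for T
    by (subst time_avg_add[symmetric])
       (auto intro!: bsig_mult bsig_cnj b bsig_diff bsig_shift a a' simp: algebra_simps)
  ultimately show "(time_avg (\<lambda>t. (if t + \<tau> < 0 then 0 else a (t + \<tau>)) * cnj (b t)) \<longlongrightarrow> R \<tau>) at_top"
    unfolding a'_def by simp
qed

text \<open>The limit along the natural numbers already exhibits \<open>R\<close> as a pointwise
  limit of measurable functions, so that \<open>R\<close> may be integrated.\<close>

lemma has_corr_measurable: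
  assumes a: "bsig a" and b: "bsig b" and R: "has_corr a b R"
  shows "R \<in> borel_measurable borel"
proof (rule borel_measurable_LIMSEQ_metric)
  have [measurable]: "a \<in> borel_measurable borel" "b \<in> borel_measurable borel"
    using a b by auto
  show "(\<lambda>\<tau>. time_avg (\<lambda>t. a (t + \<tau>) * cnj (b t)) (real n)) \<in> borel_measurable borel" for n
    unfolding time_avg_def set_lebesgue_integral_def by measurable
  show "(\<lambda>n. time_avg (\<lambda>t. a (t + \<tau>) * cnj (b t)) (real n)) \<longlonglongrightarrow> R \<tau>" for \<tau>
    using R filterlim_compose[OF _ filterlim_real_sequentially] unfolding has_corr_def by blast
qed

text \<open>For finite \<open>T\<close> the average and the integral against \<open>h\<close> are
  exchanged by Fubini. The averages are bounded by \<open>A * B\<close> uniformly in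
  \<open>T > 0\<close>, so a multiple of \<open>norm (h s)\<close> dominates as \<open>T\<close>
  grows.\<close>

lemma has_corr_conv:
  assumes a: "bsig a" and b: "bsig b" and R: "has_corr a b R" and h: "integrable lborel h"
  shows "has_corr (conv h a) b (conv h R)"
  unfolding has_corr_def
proof
  fix \<tau>
  have [measurable]: "a \<in> borel_measurable borel" "b \<in> borel_measurable borel"
     "h \<in> borel_measurable borel" "R \<in> borel_measurable borel"
    using a b h has_corr_measurable[OF a b R] by auto
  obtain A B where AB: "A \<ge> 0" "\<And>t. norm (a t) \<le> A" "B \<ge> 0" "\<And>t. norm (b t) \<le> B"
    using a b by (meson bsigE)
  hence le: "norm (a (t + \<tau>) * cnj (b t)) \<le> A * B" for t \<tau>
    by (auto simp: norm_mult intro!: mult_mono)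
  define f where "f T s = h s * time_avg (\<lambda>t. a (t + (\<tau> - s)) * cnj (b t)) T" for T s
  have "((\<lambda>T. LINT s|lborel. f T s) \<longlongrightarrow> (LINT s|lborel. h s * R (\<tau> - s))) at_top"
  proof (rule integral_dominated_convergence_at_top)
    show "integrable lborel (\<lambda>s. norm (h s) * (A * B))" using h by auto
    show "f T \<in> borel_measurable lborel" for T
      unfolding f_def time_avg_def set_lebesgue_integral_def by measurable
    show "AE s in lborel. ((\<lambda>T. f T s) \<longlongrightarrow> h s * R (\<tau> - s)) at_top"
      unfolding f_def using R by (intro AE_I2 tendsto_mult_left) (auto simp: has_corr_def)
    show "\<forall>\<^sub>F T in at_top. AE s in lborel. norm (f T s) \<le> norm (h s) * (A * B)"
      unfolding f_def norm_mult
      by (intro eventually_mono[OF eventually_gt_at_top[of 0]] AE_I2 mult_left_mono time_avg_norm_le le)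
         (auto intro!: bsig_mult bsig_cnj b bsig_shift a)
  qed simp
  moreover have "(LINT s|lborel. f T s) = time_avg (\<lambda>t. conv h a (t + \<tau>) * cnj (b t)) T" for T
  proof -
    have I: "integrable lborel (\<lambda>t. complex_of_real (indicat_real {0..T} t))"
      by (intro integrable_of_real) simp
    have int: "integrable (lborel \<Otimes>\<^sub>M lborel) (\<lambda>(s, t). h s * complex_of_real (indicat_real {0..T} t)
        * (\<lambda>(s, t). a (t + (\<tau> - s)) * cnj (b t)) (s, t))"
      by (rule integrable_pair_times[OF h I, of _ "A * B"]) (use le in auto)
    have "(LINT s|lborel. f T s) = (1 / T) *\<^sub>R (LINT s|lborel. LINT t|lborel.
        h s * complex_of_real (indicat_real {0..T} t) * (a (t + (\<tau> - s)) * cnj (b t)))"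
      unfolding f_def time_avg_def set_lebesgue_integral_def
      by (simp add: scaleR_conv_of_real mult_ac flip: integral_mult_right_zero)
    also have "\<dots> = (1 / T) *\<^sub>R (LINT t|lborel. LINT s|lborel.
        h s * complex_of_real (indicat_real {0..T} t) * (a (t + (\<tau> - s)) * cnj (b t)))"
      using int by (subst lborel_pair.Fubini_integral) auto
    also have "\<dots> = time_avg (\<lambda>t. conv h a (t + \<tau>) * cnj (b t)) T"
      unfolding conv_def time_avg_def set_lebesgue_integral_def
      by (simp add: scaleR_conv_of_real algebra_simps flip: integral_mult_right_zero integral_mult_left_zero)
    finally show ?thesis .
  qed
  ultimately show "(time_avg (\<lambda>t. conv h a (t + \<tau>) * cnj (b t)) \<longlongrightarrow> conv h R \<tau>) at_top"
    unfolding conv_def by simp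
qed

section \<open>Spectral densities\<close>

text \<open>The last conjunct says that the density carries the whole (cross) power.\<close>

definition has_spec :: "(real \<Rightarrow> complex) \<Rightarrow> (real \<Rightarrow> complex) \<Rightarrow> (real \<Rightarrow> complex) \<Rightarrow> bool" where
  "has_spec a b S \<longleftrightarrow> (\<exists>R. has_corr a b R \<and> integrable lborel R \<and>
     (\<forall>\<omega>. lap R (jw \<omega>) = S \<omega>) \<and> integrable lborel S \<and>
     R 0 = 1 / (2 * complex_of_real pi) * (LINT \<omega>|lborel. S \<omega>))"

lemma lap_lin:
  assumes "integrable lborel f" "integrable lborel g"
  shows "lap (\<lambda>t. c * f t + d * g t) (jw \<omega>) =
    c * lap f (jw \<omega>) + d * lap g (jw \<omega>)"
proof -
  have "lap (\<lambda>t. c * f t + d * g t) (jw \<omega>) =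
     (LINT t|lborel. c * (exp (- (jw \<omega>) * complex_of_real t) * f t) +
                     d * (exp (- (jw \<omega>) * complex_of_real t) * g t))"
    unfolding lap_def by (simp add: algebra_simps)
  also have "\<dots> = c * lap f (jw \<omega>) + d * lap g (jw \<omega>)"
    unfolding lap_def integral_mult_right_zero[symmetric]
    by (intro Bochner_Integration.integral_add integrable_mult_right integrable_exp_imaginary assms)
  finally show ?thesis .
qed

lemma norm_lap_le:
  assumes "integrable lborel h"
  shows "norm (lap h (jw \<omega>)) \<le> (LINT t|lborel. norm (h t))"
  unfolding lap_def
  by (rule norm_integral_le[OF integrable_exp_imaginary[OF assms] integrable_norm[OF assms]])
     (simp add: norm_mult)

lemma measurable_lap:
  assumes [measurable]: "h \<in> borel_measurable borel"
  shows "(\<lambda>\<omega>. lap h (jw \<omega>)) \<in> borel_measurable borel"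
  unfolding lap_def by measurable

lemma has_spec_add:
  assumes "bsig a" "bsig a'" "bsig b" "has_spec a b S" "has_spec a' b S'"
  shows "has_spec (\<lambda>t. a t + a' t) b (\<lambda>\<omega>. S \<omega> + S' \<omega>)"
proof -
  obtain R R' where *: "has_corr a b R" "integrable lborel R" "\<And>\<omega>. lap R (jw \<omega>) = S \<omega>"
     "integrable lborel S" "R 0 = 1 / (2 * complex_of_real pi) * (LINT \<omega>|lborel. S \<omega>)"
    "has_corr a' b R'" "integrable lborel R'" "\<And>\<omega>. lap R' (jw \<omega>) = S' \<omega>"
     "integrable lborel S'" "R' 0 = 1 / (2 * complex_of_real pi) * (LINT \<omega>|lborel. S' \<omega>)"
    using assms(4,5) by (auto simp: has_spec_def)
  show ?thesis
    unfolding has_spec_def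
    using has_corr_add[OF assms(1-3) *(1,6)] lap_lin[OF *(2,7), of 1 1] *
    by (intro exI[of _ "\<lambda>\<tau>. R \<tau> + R' \<tau>"]) (auto simp: distrib_left)
qed

lemma has_spec_cmult:
  assumes "has_spec a b S"
  shows "has_spec (\<lambda>t. c * a t) b (\<lambda>\<omega>. c * S \<omega>)"
proof -
  obtain R where *: "has_corr a b R" "integrable lborel R" "\<And>\<omega>. lap R (jw \<omega>) = S \<omega>"
     "integrable lborel S" "R 0 = 1 / (2 * complex_of_real pi) * (LINT \<omega>|lborel. S \<omega>)"
    using assms by (auto simp: has_spec_def)
  show ?thesis
    unfolding has_spec_def
    using has_corr_cmult[OF *(1)] lap_lin[OF *(2,2), of c 0] *
    by (intro exI[of _ "\<lambda>\<tau>. c * R \<tau>"]) auto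
qed

lemma has_spec_zero: "has_spec (\<lambda>t. 0) b (\<lambda>\<omega>. 0)"
  unfolding has_spec_def by (intro exI[of _ "\<lambda>_. 0"]) (auto simp: has_corr_zero lap_def)

lemma has_spec_sum:
  assumes "finite I" "\<And>i. i \<in> I \<Longrightarrow> bsig (a i)" "bsig b" "\<And>i. i \<in> I \<Longrightarrow> has_spec (a i) b (S i)"
  shows "has_spec (\<lambda>t. \<Sum>i\<in>I. a i t) b (\<lambda>\<omega>. \<Sum>i\<in>I. S i \<omega>)"
  using assms by (induction I rule: finite_induct) (auto intro!: has_spec_zero has_spec_add bsig_sum)

lemma has_spec_trunc:
  assumes "bsig a" "bsig b" "has_spec a b S"
  shows "has_spec (\<lambda>t. if t < 0 then 0 else a t) b S"
  using assms has_corr_trunc unfolding has_spec_def by blast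

lemma lap_flip: "lap (\<lambda>\<tau>. cnj (R (- \<tau>))) (jw \<omega>) = cnj (lap R (jw \<omega>))"
proof -
  have "lap (\<lambda>\<tau>. cnj (R (- \<tau>))) (jw \<omega>) =
     (LINT t|lborel. (\<lambda>t. cnj (exp (- (jw \<omega>) * complex_of_real t) * R t)) (- t))"
    unfolding lap_def by (simp add: exp_cnj)
  also have "\<dots> = (LINT t|lborel. cnj (exp (- (jw \<omega>) * complex_of_real t) * R t))"
    by (rule integral_shift)
  also have "\<dots> = cnj (lap R (jw \<omega>))"
    unfolding lap_def by (rule Bochner_Integration.integral_cnj)
  finally show ?thesis .
qed

lemma integrable_flip: fixes R :: "real \<Rightarrow> complex" shows "integrable lborel R \<Longrightarrow> integrable lborel (\<lambda>\<tau>. cnj (R (- \<tau>)))"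
  using integrable_shift(4)[of R] by simp

lemma has_spec_flip:
  assumes "bsig a" "bsig b" "has_spec a b S"
  shows "has_spec b a (\<lambda>\<omega>. cnj (S \<omega>))"
proof -
  obtain R where *: "has_corr a b R" "integrable lborel R" "\<And>\<omega>. lap R (jw \<omega>) = S \<omega>"
     "integrable lborel S" "R 0 = 1 / (2 * complex_of_real pi) * (LINT \<omega>|lborel. S \<omega>)"
    using assms by (auto simp: has_spec_def)
  show ?thesis
    unfolding has_spec_def using *
    by (intro exI[of _ "\<lambda>\<tau>. cnj (R (- \<tau>))"])
       (auto simp: lap_flip integrable_shift(4) intro!: has_corr_flip assms)
qed

text \<open>Inversion gives \<open>R\<close> only almost everywhere, which is enough here because
  the lag-0 value of \<open>conv h R\<close> is an integral of \<open>R\<close>. The feedthrough of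
  a filter is where the exact \<open>R 0\<close> enters, through
  \<open>has_spec_cmult\<close>.\<close>

lemma has_spec_conv:
  assumes a: "bsig a" and b: "bsig b" and S: "has_spec a b S" and h: "integrable lborel h"
  shows "has_spec (conv h a) b (\<lambda>\<omega>. lap h (jw \<omega>) * S \<omega>)"
proof -
  obtain R where *: "has_corr a b R" "integrable lborel R" "\<And>\<omega>. lap R (jw \<omega>) = S \<omega>"
     "integrable lborel S" "R 0 = 1 / (2 * complex_of_real pi) * (LINT \<omega>|lborel. S \<omega>)"
    using assms by (auto simp: has_spec_def)
  have [measurable]: "h \<in> borel_measurable borel" "S \<in> borel_measurable borel"
    using h *(4) by auto
  note [measurable] = measurable_lap
  have inv: "AE t in lborel. R t = 1 / (2 * complex_of_real pi) * (LINT \<omega>|lborel. S \<omega> * iexp (\<omega> * t))"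
    using fourier_inversion[OF *(2)] *(3,4) by simp
  \<comment> \<open>At lag 0 the convolution samples \<open>R\<close> at \<open>- s\<close>, so the
    exceptional null set has to be reflected.\<close>
  have inv': "AE s in lborel. R (- s) = 1 / (2 * complex_of_real pi) * (LINT \<omega>|lborel. S \<omega> * iexp (\<omega> * - s))"
  proof -
    have "AE t in distr lborel borel uminus. R t = 1 / (2 * complex_of_real pi) * (LINT \<omega>|lborel. S \<omega> * iexp (\<omega> * t))"
      using inv by (simp only: lborel_distr_uminus)
    thus ?thesis by (subst (asm) AE_distr_iff) (use *(2) in auto)
  qed
  have int: "integrable (lborel \<Otimes>\<^sub>M lborel)
        (\<lambda>(s, \<omega>). h s * S \<omega> * (\<lambda>(s, \<omega>). iexp (\<omega> * - s)) (s, \<omega>))"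
    by (rule integrable_pair_times[OF h *(4), of _ 1]) (auto simp: norm_exp_eq_Re)
  have "conv h R 0 = (LINT s|lborel. h s * (1 / (2 * complex_of_real pi) * (LINT \<omega>|lborel. S \<omega> * iexp (\<omega> * - s))))"
    unfolding conv_def
    by (rule integral_cong_AE) (use inv' *(2) in \<open>auto elim: eventually_mono\<close>)
  also have "\<dots> = 1 / (2 * complex_of_real pi) * (LINT s|lborel. LINT \<omega>|lborel. h s * S \<omega> * iexp (\<omega> * - s))"
    by (simp add: mult_ac flip: integral_mult_right_zero)
  also have "(LINT s|lborel. LINT \<omega>|lborel. h s * S \<omega> * iexp (\<omega> * - s)) =
      (LINT \<omega>|lborel. LINT s|lborel. h s * S \<omega> * iexp (\<omega> * - s))"
    using int by (subst lborel_pair.Fubini_integral) auto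
  also have "\<dots> = (LINT \<omega>|lborel. lap h (jw \<omega>) * S \<omega>)"
    unfolding lap_def integral_mult_left_zero[symmetric]
    by (intro Bochner_Integration.integral_cong refl) (simp add: mult_ac)
  finally have 0: "conv h R 0 = 1 / (2 * complex_of_real pi) * (LINT \<omega>|lborel. lap h (jw \<omega>) * S \<omega>)" .
  have "integrable lborel (\<lambda>\<omega>. lap h (jw \<omega>) * S \<omega>)"
    by (rule Bochner_Integration.integrable_bound[OF integrable_mult_right[OF integrable_norm[OF *(4)],
            of "LINT t|lborel. norm (h t)"]])
       (auto simp: norm_mult abs_mult intro!: AE_I2 mult_right_mono norm_lap_le[OF h])
  thus ?thesis unfolding has_spec_def
    using has_corr_conv[OF a b *(1) h] integrable_conv[OF h *(2)] 0
       lap_conv(2)[OF integrable_exp_imaginary[OF h] integrable_exp_imaginary[OF *(2)]] *(3)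
    by (intro exI[of _ "conv h R"]) auto
qed

section \<open>Power and positivity of a single signal\<close>

lemma has_corr_self_power:
  assumes a: "bsig a" and R: "has_corr a a R"
  shows "((\<lambda>T. LINT t|lborel. indicat_real {0..T} t * (norm (a t))\<^sup>2 / T) \<longlongrightarrow> Re (R 0)) at_top"
    and "Im (R 0) = 0" and "Re (R 0) \<ge> 0"
proof -
  define q where "q T = (LINT t|lborel. indicat_real {0..T} t * (norm (a t))\<^sup>2 / T)" for T
  have lim: "(time_avg (\<lambda>t. a t * cnj (a t)) \<longlongrightarrow> R 0) at_top"
    using R unfolding has_corr_def by (auto dest: spec[of _ 0])
  have "time_avg (\<lambda>t. a t * cnj (a t)) T = complex_of_real (q T)" for T
  proof -
    have "time_avg (\<lambda>t. a t * cnj (a t)) T = (LINT t|lborel. complex_of_real (indicat_real {0..T} t * (norm (a t))\<^sup>2 / T))"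
      unfolding time_avg_def set_lebesgue_integral_def integral_scaleR_right[symmetric]
      by (intro Bochner_Integration.integral_cong refl)
         (simp add: scaleR_conv_of_real complex_norm_square del: of_real_power)
    thus ?thesis unfolding q_def by (simp only: integral_complex_of_real)
  qed
  hence "time_avg (\<lambda>t. a t * cnj (a t)) = (\<lambda>T. complex_of_real (q T))" by auto
  with lim have lim': "((\<lambda>T. complex_of_real (q T)) \<longlongrightarrow> R 0) at_top" by simp
  have "(q \<longlongrightarrow> Re (R 0)) at_top" using tendsto_Re[OF lim'] by simp
  thus "((\<lambda>T. LINT t|lborel. indicat_real {0..T} t * (norm (a t))\<^sup>2 / T) \<longlongrightarrow> Re (R 0)) at_top"
    unfolding q_def .
  show "Im (R 0) = 0"
    using tendsto_Im[OF lim'] tendsto_unique[OF trivial_limit_at_top_linorder _ tendsto_const] by simp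
  show "Re (R 0) \<ge> 0"
    by (rule tendsto_lowerbound[OF \<open>(q \<longlongrightarrow> Re (R 0)) at_top\<close>])
       (auto intro!: eventually_mono[OF eventually_gt_at_top[of 0]] integral_nonneg_AE simp: q_def)
qed

text \<open>A Cauchy-Schwarz argument: the signal \<open>a (t + \<tau>) + c * a t\<close> with
  \<open>cmod c = 1\<close> has the nonnegative power
  \<open>2 * R 0 + 2 * Re (cnj c * R \<tau>)\<close>, and the phase of \<open>c\<close> is chosen to
  make the second term equal to \<open>- 2 * norm (R \<tau>)\<close>.\<close>

lemma has_corr_norm_le:
  assumes a: "bsig a" and R: "has_corr a a R"
  shows "norm (R \<tau>) \<le> Re (R 0)"
proof (cases "R \<tau> = 0")
  case True thus ?thesis using has_corr_self_power(3)[OF a R] by simp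
next
  case False
  define c where "c = - (R \<tau> / norm (R \<tau>))"
  have c: "cmod c = 1" using False by (simp add: c_def norm_divide)
  define b where "b t = a (t + \<tau>) + c * a t" for t
  have b: "bsig b" unfolding b_def[abs_def] by (intro bsig_add bsig_cmult bsig_shift a)
  define l where "l = R 0 + R 0 * (c * cnj c) + R \<tau> * cnj c + cnj (R \<tau> * cnj c)"
  have s: "bsig (\<lambda>t. a t * cnj (a t))" using a by (intro bsig_mult bsig_cnj)
  have l0: "(time_avg (\<lambda>t. a t * cnj (a t)) \<longlongrightarrow> R 0) at_top"
    using R unfolding has_corr_def by (auto dest: spec[of _ 0])
  have l1: "(time_avg (\<lambda>t. a (t + \<tau>) * cnj (a t)) \<longlongrightarrow> R \<tau>) at_top"
    using R unfolding has_corr_def by auto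
  have l2: "(time_avg (\<lambda>t. a (t + \<tau>) * cnj (a (t + \<tau>))) \<longlongrightarrow> R 0) at_top"
    using time_avg_shift[OF s l0] by simp
  have "time_avg (\<lambda>t. b t * cnj (b t)) T =
     time_avg (\<lambda>t. a (t + \<tau>) * cnj (a (t + \<tau>))) T
     + (c * cnj c) * time_avg (\<lambda>t. a t * cnj (a t)) T
     + cnj c * time_avg (\<lambda>t. a (t + \<tau>) * cnj (a t)) T
     + c * cnj (time_avg (\<lambda>t. a (t + \<tau>) * cnj (a t)) T)" for T
    unfolding time_avg_cmult[symmetric] time_avg_cnj[symmetric]
    by (subst time_avg_add[symmetric],
        (intro bsig_add bsig_cmult bsig_mult bsig_cnj bsig_shift a; fail),
        (intro bsig_add bsig_cmult bsig_mult bsig_cnj bsig_shift a; fail))+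
       (simp add: b_def algebra_simps)
  hence "time_avg (\<lambda>t. b t * cnj (b t)) = (\<lambda>T. time_avg (\<lambda>t. a (t + \<tau>) * cnj (a (t + \<tau>))) T
     + (c * cnj c) * time_avg (\<lambda>t. a t * cnj (a t)) T
     + cnj c * time_avg (\<lambda>t. a (t + \<tau>) * cnj (a t)) T
     + c * cnj (time_avg (\<lambda>t. a (t + \<tau>) * cnj (a t)) T))" by blast
  hence "(time_avg (\<lambda>t. b t * cnj (b t)) \<longlongrightarrow> R 0 + (c * cnj c) * R 0 + cnj c * R \<tau> + c * cnj (R \<tau>)) at_top"
    by (simp only:) (intro tendsto_intros l0 l1 l2)
  moreover have "c * cnj c = 1" using c by (simp add: complex_norm_square[symmetric])
  ultimately have lim: "(time_avg (\<lambda>t. b t * cnj (b t)) \<longlongrightarrow> 2 * R 0 + cnj c * R \<tau> + c * cnj (R \<tau>)) at_top"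
    by simp
  have "0 \<le> Re (2 * R 0 + cnj c * R \<tau> + c * cnj (R \<tau>))"
  proof (rule tendsto_lowerbound[OF tendsto_Re[OF lim]])
    have "0 \<le> Re (time_avg (\<lambda>t. b t * cnj (b t)) T)" if "T > 0" for T
    proof -
      have "time_avg (\<lambda>t. b t * cnj (b t)) T = (1/T) *\<^sub>R (LINT t|lborel. complex_of_real (indicat_real {0..T} t * (norm (b t))\<^sup>2))"
        unfolding time_avg_def set_lebesgue_integral_def
        by (intro arg_cong[where f = "\<lambda>x. (1/T) *\<^sub>R x"] Bochner_Integration.integral_cong refl)
           (simp add: scaleR_conv_of_real complex_norm_square del: of_real_power)
      also have "\<dots> = (1/T) *\<^sub>R complex_of_real (LINT t|lborel. indicat_real {0..T} t * (norm (b t))\<^sup>2)"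
        by (simp only: integral_complex_of_real)
      finally show ?thesis using that by (auto intro!: integral_nonneg_AE)
    qed
    thus "\<forall>\<^sub>F T in at_top. 0 \<le> Re (time_avg (\<lambda>t. b t * cnj (b t)) T)"
      by (intro eventually_mono[OF eventually_gt_at_top[of 0]]) auto
  qed simp
  moreover have eq: "c * cnj (R \<tau>) = - complex_of_real (norm (R \<tau>))"
  proof -
    have "R \<tau> * cnj (R \<tau>) = complex_of_real (norm (R \<tau>)) * complex_of_real (norm (R \<tau>))"
      using complex_norm_square[of "R \<tau>"] by (simp add: power2_eq_square)
    thus ?thesis using False by (simp add: c_def)
  qed
  moreover have "cnj c * R \<tau> = - complex_of_real (norm (R \<tau>))"
    using arg_cong[OF eq, of cnj] by simp
  ultimately show ?thesis by simp
qed

text \<open>Convolution with the truncated oscillation \<open>g = e\<^sup>i\<^sup>\<omega>\<^sup>t 1[0,N]\<close>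
  turns \<open>a\<close> into a signal
  of power \<open>\<integral> e\<^sup>-\<^sup>i\<^sup>\<omega>\<^sup>\<tau> R(\<tau>) max 0 (N - |\<tau>|) d\<tau>\<close>.\<close>

lemma spec_nonneg:
  assumes a: "bsig a" and R: "has_corr a a R" and I: "integrable lborel R"
  shows "Re (lap R (jw \<omega>)) \<ge> 0" "Im (lap R (jw \<omega>)) = 0"
proof -
  have [measurable]: "R \<in> borel_measurable borel" using I by auto
  \<comment> \<open>The Fejer means of the transform of \<open>R\<close>. The triangular weight lies
    between 0 and 1 and tends to 1, so \<open>F\<close> tends to that transform; it remains to see
    that each \<open>F N\<close> is a nonnegative real.\<close>
  define F where "F N = (LINT \<tau>|lborel. exp (- (jw \<omega>) * complex_of_real \<tau>) * R \<tau> *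
      complex_of_real (max 0 (N - \<bar>\<tau>\<bar>) / N))" for N
  have "Re (F N) \<ge> 0 \<and> Im (F N) = 0" if N: "N > 0" for N
  proof -
    define g where "g t = complex_of_real (indicat_real {0..N} t) * iexp (\<omega> * t)" for t
    have [measurable]: "g \<in> borel_measurable borel" unfolding g_def by measurable
    have g: "integrable lborel g"
      by (rule Bochner_Integration.integrable_bound[of _ "indicat_real {0..N}"])
         (auto simp: g_def norm_mult)
    have ga: "bsig (conv g a)" by (rule bsig_conv[OF g a])
    \<comment> \<open>Filtering is available in the left argument of a correlation, so both
      arguments are reached by filtering, flipping and filtering again.\<close>
    define P where "P = conv g (\<lambda>\<tau>. cnj (conv g R (- \<tau>)))"
    have P: "has_corr (conv g a) (conv g a) P"
      unfolding P_def by (intro has_corr_conv has_corr_flip a ga R g)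
    have "cnj (P 0) = (LINT s|lborel. LINT u|lborel. cnj (g s) * (g u * R (s - u)))"
      unfolding P_def conv_def
      by (subst Bochner_Integration.integral_cnj[symmetric])
         (simp flip: integral_mult_right_zero)
    also have "\<dots> = (LINT u|lborel. LINT s|lborel. cnj (g s) * (g u * R (s - u)))"
    proof (subst lborel_pair.Fubini_integral)
      have "integrable (lborel \<Otimes>\<^sub>M lborel) (\<lambda>(u, s). g u * R (s - u))"
        by (rule integrable_conv_kernel[OF g I])
      hence "integrable (lborel \<Otimes>\<^sub>M lborel) (\<lambda>(u, s). cnj (g s) * (g u * R (s - u)))"
        by (rule Bochner_Integration.integrable_bound)
           (auto simp: norm_mult g_def intro!: AE_I2 mult_left_le_one_le split: split_indicator)
      thus "integrable (lborel \<Otimes>\<^sub>M lborel) (\<lambda>(u, s). cnj (g s) * (g u * R (s - u)))" .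
    qed simp
    also have "\<dots> = (LINT u|lborel. LINT \<tau>|lborel. cnj (g (\<tau> + u)) * (g u * R \<tau>))"
    proof (rule Bochner_Integration.integral_cong[OF refl])
      fix u :: real
      show "(LINT s|lborel. cnj (g s) * (g u * R (s - u))) = (LINT \<tau>|lborel. cnj (g (\<tau> + u)) * (g u * R \<tau>))"
        using integral_shift(1)[of "\<lambda>s. cnj (g s) * (g u * R (s - u))" u] by simp
    qed
    also have "\<dots> = (LINT \<tau>|lborel. LINT u|lborel. cnj (g (\<tau> + u)) * (g u * R \<tau>))"
    proof (rule lborel_pair.Fubini_integral)
      have "integrable (lborel \<Otimes>\<^sub>M lborel) (\<lambda>(\<tau>, u). R \<tau> * g u * (\<lambda>(\<tau>, u). cnj (g (\<tau> + u))) (\<tau>, u))"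
        by (rule integrable_pair_times[OF I g, of _ 1]) (auto simp: g_def norm_mult)
      thus "integrable (lborel \<Otimes>\<^sub>M lborel) (\<lambda>(\<tau>, u). cnj (g (\<tau> + u)) * (g u * R \<tau>))"
        by (simp add: mult_ac case_prod_unfold)
    qed
    also have "\<dots> = (LINT \<tau>|lborel. exp (- (jw \<omega>) * complex_of_real \<tau>) * R \<tau> *
      complex_of_real (max 0 (N - \<bar>\<tau>\<bar>)))"
    proof (rule Bochner_Integration.integral_cong[OF refl])
      fix \<tau> :: real
      \<comment> \<open>The two phases combine to one that does not depend on \<open>u\<close>. The
        indicators leave the overlap of \<open>{0..N}\<close> with its translate, an interval of
        length \<open>max 0 (N - \<bar>\<tau>\<bar>)\<close>.\<close>
      have "cnj (g (\<tau> + u)) * (g u * R \<tau>) = exp (- (jw \<omega>) * complex_of_real \<tau>) * R \<tau> *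
         complex_of_real (indicat_real {max 0 (-\<tau>)..min N (N - \<tau>)} u)" for u
      proof -
        have "cnj (iexp (\<omega> * (\<tau> + u))) * iexp (\<omega> * u) = exp (- (jw \<omega>) * complex_of_real \<tau>)"
          unfolding exp_cnj exp_add[symmetric] by (simp add: algebra_simps)
        moreover have "indicat_real {0..N} (\<tau> + u) * indicat_real {0..N} u = indicat_real {max 0 (-\<tau>)..min N (N - \<tau>)} u"
          by (auto simp: indicator_def)
        ultimately show ?thesis unfolding g_def by (simp add: mult_ac) (metis mult.commute mult.left_commute of_real_mult)
      qed
      moreover have "(LINT u|lborel. complex_of_real (indicat_real {max 0 (-\<tau>)..min N (N - \<tau>)} u)) =
          complex_of_real (max 0 (N - \<bar>\<tau>\<bar>))"
        unfolding integral_complex_of_real using N by (auto simp: measure_def max_def min_def)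
      ultimately show "(LINT u|lborel. cnj (g (\<tau> + u)) * (g u * R \<tau>)) =
         exp (- (jw \<omega>) * complex_of_real \<tau>) * R \<tau> * complex_of_real (max 0 (N - \<bar>\<tau>\<bar>))"
        by (simp only: integral_mult_right_zero)
    qed
    also have "\<dots> = (LINT \<tau>|lborel. complex_of_real N * (exp (- (jw \<omega>) * complex_of_real \<tau>) * R \<tau> *
      complex_of_real (max 0 (N - \<bar>\<tau>\<bar>) / N)))"
      using N by (intro Bochner_Integration.integral_cong refl) (simp add: field_simps)
    also have "\<dots> = complex_of_real N * F N" unfolding F_def by (rule integral_mult_right_zero)
    finally have eq: "cnj (P 0) = complex_of_real N * F N" .
    have "Re (P 0) = N * Re (F N)" "- Im (P 0) = N * Im (F N)"
      using arg_cong[OF eq, of Re] arg_cong[OF eq, of Im] by auto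
    thus ?thesis using has_corr_self_power(2,3)[OF ga P] N by (auto simp: zero_le_mult_iff)
  qed
  moreover have "(F \<longlongrightarrow> lap R (jw \<omega>)) at_top"
    unfolding F_def lap_def
  proof (rule integral_dominated_convergence_at_top)
    show "integrable lborel (\<lambda>\<tau>. norm (R \<tau>))" using I by auto
    have lim: "((\<lambda>N. max 0 (N - \<bar>\<tau>\<bar>) / N) \<longlongrightarrow> 1) at_top" for \<tau> :: real
    proof (rule Lim_transform_eventually)
      show "((\<lambda>N. 1 - \<bar>\<tau>\<bar> / N) \<longlongrightarrow> 1) at_top" 
        using tendsto_diff[OF tendsto_const[of "1::real"] tendsto_divide_0[OF tendsto_const[of "\<bar>\<tau>\<bar>"] 
           filterlim_at_top_imp_at_infinity[OF filterlim_ident]]] by simp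
      show "\<forall>\<^sub>F N in at_top. 1 - \<bar>\<tau>\<bar> / N = max 0 (N - \<bar>\<tau>\<bar>) / N"
        by (intro eventually_mono[OF eventually_gt_at_top[of "\<bar>\<tau>\<bar>"]]) (auto simp: field_simps max_def)
    qed
    show "AE \<tau> in lborel. ((\<lambda>N. exp (- (jw \<omega>) * complex_of_real \<tau>) * R \<tau> *
        complex_of_real (max 0 (N - \<bar>\<tau>\<bar>) / N)) \<longlongrightarrow> exp (- (jw \<omega>) * complex_of_real \<tau>) * R \<tau>) at_top"
    proof (rule AE_I2)
      fix \<tau> show "((\<lambda>N. exp (- (jw \<omega>) * complex_of_real \<tau>) * R \<tau> *
        complex_of_real (max 0 (N - \<bar>\<tau>\<bar>) / N)) \<longlongrightarrow> exp (- (jw \<omega>) * complex_of_real \<tau>) * R \<tau>) at_top"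
        using tendsto_mult[OF tendsto_const tendsto_of_real[OF lim[of \<tau>]],
          of "exp (- (jw \<omega>) * complex_of_real \<tau>) * R \<tau>"] by simp
    qed
    show "\<forall>\<^sub>F N in at_top. AE \<tau> in lborel. norm (exp (- (jw \<omega>) * complex_of_real \<tau>) * R \<tau> *
        complex_of_real (max 0 (N - \<bar>\<tau>\<bar>) / N)) \<le> norm (R \<tau>)"
    proof (rule eventually_mono[OF eventually_gt_at_top[of 0]], rule AE_I2)
      fix N \<tau> :: real assume "N > 0"
      hence "\<bar>max 0 (N - \<bar>\<tau>\<bar>) / N\<bar> \<le> 1" by (auto simp: max_def field_simps)
      thus "norm (exp (- (jw \<omega>) * complex_of_real \<tau>) * R \<tau> *
        complex_of_real (max 0 (N - \<bar>\<tau>\<bar>) / N)) \<le> norm (R \<tau>)"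
        unfolding norm_mult norm_of_real using mult_left_le[of "\<bar>max 0 (N - \<bar>\<tau>\<bar>) / N\<bar>" "norm (R \<tau>)"]
        by (simp only: norm_exp_eq_Re) simp
    qed
  qed auto
  ultimately show "Re (lap R (jw \<omega>)) \<ge> 0" "Im (lap R (jw \<omega>)) = 0"
    using tendsto_lowerbound[OF tendsto_Re, of F "lap R (jw \<omega>)" at_top 0]
      tendsto_unique[OF _ tendsto_Im[of F "lap R (jw \<omega>)" at_top], of 0]
      tendsto_eventually[of "\<lambda>N. Im (F N)" 0 at_top] eventually_mono[OF eventually_gt_at_top[of "0::real"]]
    by (force, simp add: eventually_at_top_dense) 
qed

text \<open>Lag 0 itself may be exceptional for inversion, and there equality can fail. The inverse
  transform is however continuous and, by \<open>has_corr_norm_le\<close>, bounded by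
  \<open>Re (R 0)\<close> almost everywhere, so the bound extends to every lag.\<close>

lemma power_ge_spec_integral:
  assumes a: "bsig a" and R: "has_corr a a R" and I: "integrable lborel R"
    and S: "integrable lborel (\<lambda>\<omega>. lap R (jw \<omega>))"
  shows "Re (R 0) \<ge> Re (1 / (2 * complex_of_real pi) * (LINT \<omega>|lborel. lap R (jw \<omega>)))"
proof -
  define f where "f t = 1 / (2 * complex_of_real pi) * (LINT \<omega>|lborel. lap R (jw \<omega>) * iexp (\<omega> * t))" for t
  have [measurable]: "(\<lambda>\<omega>. lap R (jw \<omega>)) \<in> borel_measurable borel" using S by auto
  have cont: "continuous_on UNIV f"
  proof -
    have "isCont (\<lambda>t. LINT \<omega>|lborel. lap R (jw \<omega>) * iexp (\<omega> * t)) t" for t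
      unfolding continuous_at_sequentially comp_def
    proof (intro allI impI)
      fix x assume x: "x \<longlonglongrightarrow> t"
      show "(\<lambda>n. LINT \<omega>|lborel. lap R (jw \<omega>) * iexp (\<omega> * x n)) \<longlonglongrightarrow>
         (LINT \<omega>|lborel. lap R (jw \<omega>) * iexp (\<omega> * t))"
        by (rule integral_dominated_convergence[where w = "\<lambda>\<omega>. norm (lap R (jw \<omega>))"])
           (use S in \<open>auto simp: norm_mult intro!: AE_I2 tendsto_intros x\<close>)
    qed
    thus ?thesis unfolding f_def
      by (intro continuous_intros) (simp add: continuous_on_eq_continuous_at)
  qed
  have "AE t in lborel. norm (f t) \<le> Re (R 0)"
    using fourier_inversion[OF I S] unfolding f_def[symmetric]
    by eventually_elim (use has_corr_norm_le[OF a R] in metis)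
  \<comment> \<open>A closed set of full measure is the whole line, and in particular contains
    0.\<close>
  hence "AE t in lebesgue. t \<in> {t. norm (f t) \<le> Re (R 0)}"
    by (intro AE_completion) auto
  moreover have "closed {t. norm (f t) \<le> Re (R 0)}"
    by (intro closed_Collect_le continuous_intros cont)
  ultimately have "0 \<in> {t. norm (f t) \<le> Re (R 0)}" using mem_closed_if_AE_lebesgue by blast
  hence "norm (f 0) \<le> Re (R 0)" by simp
  thus ?thesis using complex_Re_le_cmod[of "f 0"] by (simp add: f_def)
qed

section \<open>Correlation and density matrices of finite families\<close>

lemma has_corr_comb:
  fixes a :: "'i::finite \<Rightarrow> real \<Rightarrow> complex"
  assumes a: "\<And>i. bsig (a i)" and R: "\<And>i j. has_corr (a i) (a j) (R i j)"
  shows "bsig (\<lambda>t. \<Sum>i\<in>UNIV. v i * a i t)"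
    and "has_corr (\<lambda>t. \<Sum>i\<in>UNIV. v i * a i t) (\<lambda>t. \<Sum>i\<in>UNIV. v i * a i t)
           (\<lambda>\<tau>. \<Sum>j\<in>UNIV. \<Sum>i\<in>UNIV. v i * cnj (v j) * R i j \<tau>)"
proof -
  define b where "b t = (\<Sum>i\<in>UNIV. v i * a i t)" for t
  show b: "bsig (\<lambda>t. \<Sum>i\<in>UNIV. v i * a i t)" by (intro bsig_sum bsig_cmult a) auto
  hence b': "bsig b" by (simp add: b_def[abs_def])
  have 1: "has_corr (a j) b (\<lambda>\<tau>. \<Sum>i\<in>UNIV. cnj (v i) * R j i \<tau>)" for j
  proof -
    \<comment> \<open>Linearity holds in the left argument; flipping carries it to the right one,
      where the coefficients appear conjugated.\<close>
    have "has_corr b (a j) (\<lambda>\<tau>. \<Sum>i\<in>UNIV. v i * R i j \<tau>)"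
      unfolding b_def by (intro has_corr_sum has_corr_cmult R bsig_cmult a) auto
    from has_corr_flip[OF b' a this]
    have "has_corr (a j) b (\<lambda>\<tau>. \<Sum>i\<in>UNIV. cnj (v i) * cnj (R i j (- \<tau>)))" by simp
    moreover have "(\<lambda>\<tau>. cnj (R i j (- \<tau>))) = R j i" for i
      using has_corr_flip[OF a a R[of i j]] R[of j i] has_corr_unique by blast
    ultimately show ?thesis by (simp add: fun_eq_iff)
  qed
  have "has_corr (\<lambda>t. \<Sum>j\<in>UNIV. v j * a j t) b (\<lambda>\<tau>. \<Sum>j\<in>UNIV. v j * (\<Sum>i\<in>UNIV. cnj (v i) * R j i \<tau>))"
    by (intro has_corr_sum has_corr_cmult 1 bsig_cmult a b') auto
  moreover have "(\<Sum>j\<in>UNIV. v j * (\<Sum>i\<in>UNIV. cnj (v i) * R j i \<tau>)) = (\<Sum>j\<in>UNIV. \<Sum>i\<in>UNIV. v i * cnj (v j) * R i j \<tau>)" for \<tau>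
    unfolding sum_distrib_left by (subst sum.swap) (simp add: mult_ac)
  ultimately show "has_corr (\<lambda>t. \<Sum>i\<in>UNIV. v i * a i t) (\<lambda>t. \<Sum>i\<in>UNIV. v i * a i t)
           (\<lambda>\<tau>. \<Sum>j\<in>UNIV. \<Sum>i\<in>UNIV. v i * cnj (v j) * R i j \<tau>)"
    by (simp add: b_def[abs_def])
qed

lemma lap_sum2:
  fixes R :: "'i::finite \<Rightarrow> 'i \<Rightarrow> real \<Rightarrow> complex"
  assumes "\<And>i j. integrable lborel (R i j)"
  shows "lap (\<lambda>\<tau>. \<Sum>j\<in>UNIV. \<Sum>i\<in>UNIV. c i j * R i j \<tau>) (jw \<omega>) =
    (\<Sum>j\<in>UNIV. \<Sum>i\<in>UNIV. c i j * lap (R i j) (jw \<omega>))"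
proof -
  have "lap (\<lambda>\<tau>. \<Sum>j\<in>UNIV. \<Sum>i\<in>UNIV. c i j * R i j \<tau>) (jw \<omega>) =
     (LINT t|lborel. (\<Sum>j\<in>UNIV. \<Sum>i\<in>UNIV. c i j * (exp (- (jw \<omega>) * complex_of_real t) * R i j t)))"
    unfolding lap_def sum_distrib_left by (simp add: mult_ac)
  also have "\<dots> = (\<Sum>j\<in>UNIV. \<Sum>i\<in>UNIV. c i j * lap (R i j) (jw \<omega>))"
    using integrable_exp_imaginary[OF assms]
    by (subst Bochner_Integration.integral_sum)
       (auto intro!: Bochner_Integration.integrable_sum integrable_mult_right simp: lap_def Bochner_Integration.integral_sum)
  finally show ?thesis .
qed

text \<open>The quadratic form at \<open>v\<close> is the density of the scalar signal that combines
  the \<open>a i\<close> with coefficients \<open>v i\<close>, so \<open>spec_nonneg\<close>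
  applies.\<close>

lemma spec_psd:
  fixes a :: "'i::finite \<Rightarrow> real \<Rightarrow> complex"
  assumes a: "\<And>i. bsig (a i)" and R: "\<And>i j. has_corr (a i) (a j) (R i j)"
    and I: "\<And>i j. integrable lborel (R i j)"
  shows "Re (\<Sum>j\<in>UNIV. \<Sum>i\<in>UNIV. v i * cnj (v j) * lap (R i j) (jw \<omega>)) \<ge> 0"
proof -
  have "integrable lborel (\<lambda>\<tau>. \<Sum>j\<in>UNIV. \<Sum>i\<in>UNIV. v i * cnj (v j) * R i j \<tau>)"
    by (intro Bochner_Integration.integrable_sum integrable_mult_right I)
  from spec_nonneg(1)[OF has_corr_comb[OF a R] this, of \<omega>]
  show ?thesis by (simp only: lap_sum2[OF I])
qed

lemma diag_nonneg:
  fixes m :: "'i::finite \<Rightarrow> 'i \<Rightarrow> complex"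
  assumes q: "\<And>v. Re (\<Sum>j\<in>UNIV. \<Sum>i\<in>UNIV. v i * cnj (v j) * m i j) \<ge> 0"
  shows "Re (m k k) \<ge> 0"
proof -
  define v where "v l = (if l = k then 1 else 0 :: complex)" for l
  have "(\<Sum>l\<in>UNIV. \<Sum>n\<in>UNIV. v n * cnj (v l) * m n l) = (\<Sum>l\<in>UNIV. if l = k then m k k else 0)"
    by (intro sum.cong refl) (simp add: v_def if_distrib[of "\<lambda>x. x * _"] cong: if_cong)
  thus ?thesis using q[of v] by simp
qed

text \<open>Test vector with 1 at \<open>i\<close> and a unimodular \<open>c\<close> at
  \<open>j\<close>; the phase of \<open>c\<close> turns both cross terms into
  \<open>- norm (m i j)\<close>.\<close>

lemma norm_offdiag_le:
  fixes m :: "'i::finite \<Rightarrow> 'i \<Rightarrow> complex"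
  assumes ij: "i \<noteq> j" and herm: "m j i = cnj (m i j)"
    and q: "\<And>v. Re (\<Sum>j\<in>UNIV. \<Sum>i\<in>UNIV. v i * cnj (v j) * m i j) \<ge> 0"
  shows "2 * norm (m i j) \<le> Re (m i i) + Re (m j j)"
proof (cases "m i j = 0")
  case False
  define c where "c = - (m i j / norm (m i j))"
  have c: "norm c = 1" using False by (simp add: c_def norm_divide)
  have "m i j * cnj (m i j) = complex_of_real (norm (m i j)) * complex_of_real (norm (m i j))"
    using complex_norm_square[of "m i j"] by (simp add: power2_eq_square)
  hence c1: "c * cnj (m i j) = - complex_of_real (norm (m i j))" using False by (simp add: c_def)
  have c2: "cnj c * m i j = - complex_of_real (norm (m i j))" using arg_cong[OF c1, of cnj]
    by (simp only: complex_cnj_mult complex_cnj_cnj complex_cnj_minus complex_cnj_complex_of_real)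
  define v where "v k = (if k = i then 1 else if k = j then c else 0)" for k
  have s: "(\<Sum>k\<in>UNIV. f k) = f i + f j" if "\<And>k. k \<noteq> i \<Longrightarrow> k \<noteq> j \<Longrightarrow> f k = 0" for f :: "'i \<Rightarrow> complex"
  proof -
    have "(\<Sum>k\<in>UNIV. f k) = (\<Sum>k\<in>{i,j}. f k)" using that by (intro sum.mono_neutral_right) auto
    thus ?thesis using ij by simp
  qed
  have "(\<Sum>l\<in>UNIV. \<Sum>k\<in>UNIV. v k * cnj (v l) * m k l) = m i i + c * m j i + (cnj c * m i j + c * cnj c * m j j)"
    using ij by (subst s, force simp: v_def, subst s, force simp: v_def, subst s, force simp: v_def) (simp add: v_def)
  moreover have "c * cnj c = 1" using c complex_norm_square[of c] by simp
  ultimately show ?thesis using q[of v] c1 c2 herm by simp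
next
  case True
  thus ?thesis using diag_nonneg[of m, OF q] by (simp add: add_nonneg_nonneg)
qed

text \<open>The defect \<open>R(0) - 1/2\<pi> \<integral> S\<close> is positive semidefinite; if it has trace \<open>0\<close> it vanishes.\<close>

lemma has_spec_of_trace:
  fixes a :: "'i::finite \<Rightarrow> real \<Rightarrow> complex"
  assumes a: "\<And>i. bsig (a i)" and R: "\<And>i j. has_corr (a i) (a j) (R i j)"
    and I: "\<And>i j. integrable lborel (R i j)"
    and S: "integrable lborel (\<lambda>\<omega>. \<Sum>i\<in>UNIV. lap (R i i) (jw \<omega>))"
    and tr: "(\<Sum>i\<in>UNIV. R i i 0) =
      1 / (2 * complex_of_real pi) * (LINT \<omega>|lborel. (\<Sum>i\<in>UNIV. lap (R i i) (jw \<omega>)))"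
  shows "has_spec (a i) (a j) (\<lambda>\<omega>. lap (R i j) (jw \<omega>))"
proof -
  define s where "s i j \<omega> = lap (R i j) (jw \<omega>)" for i j \<omega>
  have [measurable]: "s i j \<in> borel_measurable borel" for i j
    unfolding s_def[abs_def] using I[of i j] by (intro measurable_lap) auto
  have flip: "(\<lambda>\<tau>. cnj (R i j (- \<tau>))) = R j i" for i j
    using has_corr_flip[OF a a R[of i j]] R[of j i] has_corr_unique by blast
  have sh: "s j i \<omega> = cnj (s i j \<omega>)" for i j \<omega>
    using lap_flip[of "R i j" \<omega>] unfolding flip s_def .
  have sq: "Re (\<Sum>j\<in>UNIV. \<Sum>i\<in>UNIV. v i * cnj (v j) * s i j \<omega>) \<ge> 0" for v \<omega>
    unfolding s_def by (rule spec_psd[OF a R I])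
  have sd: "Re (s k k \<omega>) \<ge> 0" "Im (s k k \<omega>) = 0" for k \<omega>
    using diag_nonneg[OF sq, where k = k] sh[of k k \<omega>] by (auto simp: complex_eq_iff)
  \<comment> \<open>Integrability is given for the trace alone. Each diagonal density is dominated
    by the trace, and off-diagonal ones are dominated by diagonal ones through positivity.\<close>
  have sk: "integrable lborel (\<lambda>\<omega>. Re (s k k \<omega>))" for k
  proof (rule Bochner_Integration.integrable_bound[OF S])
    show "AE \<omega> in lborel. norm (Re (s k k \<omega>)) \<le> norm (\<Sum>i\<in>UNIV. lap (R i i) (jw \<omega>))"
    proof (rule AE_I2)
      fix \<omega>
      have "Re (s k k \<omega>) \<le> (\<Sum>i\<in>UNIV. Re (s i i \<omega>))" using sd by (intro member_le_sum) auto
      also have "\<dots> \<le> norm (\<Sum>i\<in>UNIV. s i i \<omega>)"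
        using complex_Re_le_cmod[of "\<Sum>i\<in>UNIV. s i i \<omega>"] by simp
      finally show "norm (Re (s k k \<omega>)) \<le> norm (\<Sum>i\<in>UNIV. lap (R i i) (jw \<omega>))"
        using sd[of k \<omega>] by (simp add: s_def)
    qed
  qed simp
  have si: "integrable lborel (s i j)" for i j
  proof (rule Bochner_Integration.integrable_bound[OF Bochner_Integration.integrable_add[OF sk[of i] sk[of j]]])
    show "AE \<omega> in lborel. norm (s i j \<omega>) \<le> norm (Re (s i i \<omega>) + Re (s j j \<omega>))"
    proof (rule AE_I2)
      fix \<omega>
      show "norm (s i j \<omega>) \<le> norm (Re (s i i \<omega>) + Re (s j j \<omega>))"
      proof (cases "i = j")
        case True thus ?thesis using sd[of i \<omega>] by (simp add: cmod_eq_Re)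
      next
        case False
        have "2 * norm (s i j \<omega>) \<le> Re (s i i \<omega>) + Re (s j j \<omega>)"
          by (rule norm_offdiag_le[OF False, where m = "\<lambda>i j. s i j \<omega>", OF sh sq])
        thus ?thesis using sd(1)[of i \<omega>] sd(1)[of j \<omega>] norm_ge_zero[of "s i j \<omega>"]
          by (simp del: norm_ge_zero)
      qed
    qed
  qed simp
  define m where "m i j = R i j 0 - 1 / (2 * complex_of_real pi) * (LINT \<omega>|lborel. s i j \<omega>)" for i j
  have mh: "m j i = cnj (m i j)" for i j
  proof -
    have "(LINT \<omega>|lborel. s j i \<omega>) = cnj (LINT \<omega>|lborel. s i j \<omega>)"
      using Bochner_Integration.integral_cnj[of lborel "s i j"] by (simp add: sh[of i j])
    moreover have "R j i 0 = cnj (R i j 0)" using fun_cong[OF flip[of i j], of 0] by simp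
    ultimately show ?thesis by (simp add: m_def)
  qed
  \<comment> \<open>The form of the defect at \<open>v\<close> is the defect of the scalar signal
    \<open>b\<close>, which \<open>power_ge_spec_integral\<close> bounds from below.\<close>
  have mq: "Re (\<Sum>j\<in>UNIV. \<Sum>i\<in>UNIV. v i * cnj (v j) * m i j) \<ge> 0" for v
  proof -
    define b where "b t = (\<Sum>i\<in>UNIV. v i * a i t)" for t
    define \<rho> where "\<rho> \<tau> = (\<Sum>j\<in>UNIV. \<Sum>i\<in>UNIV. v i * cnj (v j) * R i j \<tau>)" for \<tau>
    have b: "bsig b" and br: "has_corr b b \<rho>"
      using has_corr_comb[OF a R, of v] by (simp_all add: b_def[abs_def] \<rho>_def[abs_def])
    have ri: "integrable lborel \<rho>"
      unfolding \<rho>_def[abs_def] by (intro Bochner_Integration.integrable_sum integrable_mult_right I)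
    have rs: "lap \<rho> (jw \<omega>) = (\<Sum>j\<in>UNIV. \<Sum>i\<in>UNIV. v i * cnj (v j) * s i j \<omega>)" for \<omega>
      unfolding \<rho>_def[abs_def] s_def by (rule lap_sum2[OF I])
    have rsi: "integrable lborel (\<lambda>\<omega>. lap \<rho> (jw \<omega>))"
      unfolding rs by (intro Bochner_Integration.integrable_sum integrable_mult_right si)
    have "Re (\<rho> 0) - Re (1 / (2 * complex_of_real pi) * (LINT \<omega>|lborel. lap \<rho> (jw \<omega>))) \<ge> 0"
      using power_ge_spec_integral[OF b br ri rsi] by linarith
    moreover have "(LINT \<omega>|lborel. lap \<rho> (jw \<omega>)) = (\<Sum>j\<in>UNIV. \<Sum>i\<in>UNIV. v i * cnj (v j) * (LINT \<omega>|lborel. s i j \<omega>))"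
      unfolding rs using si
      by (subst Bochner_Integration.integral_sum)
         (auto intro!: Bochner_Integration.integrable_sum integrable_mult_right simp: Bochner_Integration.integral_sum)
    moreover have "(\<Sum>j\<in>UNIV. \<Sum>i\<in>UNIV. v i * cnj (v j) * m i j) = \<rho> 0 - 1 / (2 * complex_of_real pi) *
       (\<Sum>j\<in>UNIV. \<Sum>i\<in>UNIV. v i * cnj (v j) * (LINT \<omega>|lborel. s i j \<omega>))"
      unfolding m_def \<rho>_def right_diff_distrib sum_subtractf sum_distrib_left
      by (simp add: mult_ac)
    ultimately show ?thesis by simp
  qed
  have md: "Re (m k k) \<ge> 0" "Im (m k k) = 0" for k
    using diag_nonneg[OF mq, where k = k] mh[of k k] by (auto simp: complex_eq_iff)
  have "(\<Sum>k\<in>UNIV. m k k) = 0"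
    unfolding m_def sum_subtractf using tr si
    by (simp add: s_def[symmetric] sum_divide_distrib[symmetric])
  hence "(\<Sum>k\<in>UNIV. Re (m k k)) = 0" by (metis Re_sum zero_complex.simps(1))
  hence m0: "Re (m k k) = 0" for k using md by (simp add: sum_nonneg_eq_0_iff)
  have "m i j = 0"
  proof (cases "i = j")
    case True thus ?thesis using m0[of i] md(2)[of i] by (simp add: complex_eq_iff)
  next
    case False
    have "2 * norm (m i j) \<le> Re (m i i) + Re (m j j)"
      by (rule norm_offdiag_le[OF False mh mq])
    thus ?thesis using m0 by simp
  qed
  hence "R i j 0 = 1 / (2 * complex_of_real pi) * (LINT \<omega>|lborel. s i j \<omega>)" by (simp add: m_def)
  thus ?thesis unfolding has_spec_def using R I si[of i j]
    by (intro exI[of _ "R i j"]) (auto simp: s_def[abs_def])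
qed

section \<open>Bounded power signals and their spectral densities\<close>

lemma bounded_linear_axis: "bounded_linear (axis i :: 'b::euclidean_space \<Rightarrow> 'b^'n)"
  by (intro linear_conv_bounded_linear[THEN iffD1] linearI) (auto simp: axis_def vec_eq_iff)

lemma vec_eq_sum_axis: "(x :: 'b::euclidean_space^'n) = (\<Sum>i\<in>UNIV. axis i (x $ i))"
  by (auto simp: vec_eq_iff axis_def if_distrib cong: if_cong)

lemma integrable_vec_iff:
  fixes f :: "'a \<Rightarrow> ('b::euclidean_space)^'n"
  shows "integrable M f \<longleftrightarrow> (\<forall>i. integrable M (\<lambda>x. f x $ i))"
proof
  show "integrable M f \<Longrightarrow> \<forall>i. integrable M (\<lambda>x. f x $ i)"
    using integrable_bounded_linear[OF bounded_linear_vec_nth] by blast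
  assume "\<forall>i. integrable M (\<lambda>x. f x $ i)"
  hence "integrable M (\<lambda>x. \<Sum>i\<in>UNIV. axis i (f x $ i))"
    by (intro Bochner_Integration.integrable_sum integrable_bounded_linear[OF bounded_linear_axis]) auto
  thus "integrable M f" by (simp flip: vec_eq_sum_axis)
qed

lemma measurable_vec_iff:
  fixes f :: "'a \<Rightarrow> ('b::euclidean_space)^'n"
  shows "f \<in> borel_measurable M \<longleftrightarrow> (\<forall>i. (\<lambda>x. f x $ i) \<in> borel_measurable M)"
proof
  show "f \<in> borel_measurable M \<Longrightarrow> \<forall>i. (\<lambda>x. f x $ i) \<in> borel_measurable M"
    by (auto intro!: measurable_compose[of f M borel "\<lambda>x. x $ _"]
      borel_measurable_continuous_onI continuous_intros)
  assume "\<forall>i. (\<lambda>x. f x $ i) \<in> borel_measurable M"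
  hence "(\<lambda>x. \<Sum>i\<in>UNIV. axis i (f x $ i)) \<in> borel_measurable M"
    by (intro borel_measurable_sum measurable_compose[of "\<lambda>x. f x $ _" M borel "axis _"]
       borel_measurable_continuous_onI linear_continuous_on bounded_linear_axis) auto
  thus "f \<in> borel_measurable M" by (simp flip: vec_eq_sum_axis)
qed

lemma integral_vec_nth':
  fixes f :: "'a \<Rightarrow> ('b::euclidean_space)^'n"
  assumes "integrable M f"
  shows "(LINT x|M. f x) $ i = (LINT x|M. f x $ i)"
  using integral_bounded_linear[OF bounded_linear_vec_nth assms] by simp

section \<open>Vector signals in coordinates\<close>

abbreviation coord :: "(real \<Rightarrow> real^'n) \<Rightarrow> 'n \<Rightarrow> real \<Rightarrow> complex" where
  "coord u i \<equiv> (\<lambda>t. complex_of_real (u t $ i))"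

lemma bounded_signal_iff:
  "bounded_signal (u :: real \<Rightarrow> real^'n) \<longleftrightarrow> (\<forall>t<0. u t = 0) \<and> (\<forall>i. bsig (coord u i))"
proof -
  have "u \<in> borel_measurable borel \<longleftrightarrow> (\<forall>i. coord u i \<in> borel_measurable borel)"
  proof -
    have "coord u i \<in> borel_measurable borel \<longleftrightarrow> (\<lambda>t. u t $ i) \<in> borel_measurable borel" for i
    proof
      assume "coord u i \<in> borel_measurable borel"
      from measurable_compose[OF this borel_measurable_Re]
      show "(\<lambda>t. u t $ i) \<in> borel_measurable borel" by simp
    qed simp
    thus ?thesis by (simp add: measurable_vec_iff)
  qed
  moreover have "bounded (range u) \<longleftrightarrow> (\<forall>i. \<exists>B. \<forall>t. norm (coord u i t) \<le> B)"
  proof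
    assume "bounded (range u)"
    then obtain B where "\<And>t. norm (u t) \<le> B" by (auto simp: bounded_iff)
    thus "\<forall>i. \<exists>B. \<forall>t. norm (coord u i t) \<le> B"
      using component_le_norm_cart order_trans by (metis norm_of_real)
  next
    assume "\<forall>i. \<exists>B. \<forall>t. norm (coord u i t) \<le> B"
    then obtain B where B: "\<And>i t. \<bar>u t $ i\<bar> \<le> B i" by (metis norm_of_real)
    have "norm (u t) \<le> (\<Sum>i\<in>UNIV. B i)" for t
      by (rule order_trans[OF norm_le_l1_cart]) (intro sum_mono B)
    thus "bounded (range u)" by (auto simp: bounded_iff)
  qed
  ultimately show ?thesis by (auto simp: bounded_signal_def bsig_def)
qed

lemma bsig_coord: "bounded_signal u \<Longrightarrow> bsig (coord u i)"
  by (simp add: bounded_signal_iff)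

text \<open>The density is an argument rather than \<open>spec u v\<close>, so that it can be
  computed before the existence of the matrix correlation is established; \<open>cspec_spec\<close>
  supplies the equality afterwards.\<close>

definition cspec :: "(real \<Rightarrow> real^'n) \<Rightarrow> (real \<Rightarrow> real^'m) \<Rightarrow> (real \<Rightarrow> complex^'m^'n) \<Rightarrow> bool" where
  "cspec u v S \<longleftrightarrow> (\<forall>i j. has_spec (coord u i) (coord v j) (\<lambda>\<omega>. S \<omega> $ i $ j))"

lemma time_avg_of_real: "time_avg (\<lambda>t. complex_of_real (f t)) T = complex_of_real (time_avg f T)"
  unfolding time_avg_def set_lebesgue_integral_def
  by (simp add: scaleR_conv_of_real del: of_real_mult flip: integral_complex_of_real)
     (simp add: scaleR_conv_of_real)

lemma time_avg_outer:
  assumes "bounded_signal u" "bounded_signal v"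
  shows "complex_of_real (time_avg (\<lambda>t. outer (u (t + \<tau>)) (v t)) T $ i $ j) =
     time_avg (\<lambda>t. coord u i (t + \<tau>) * cnj (coord v j t)) T"
proof -
  have I: "integrable lborel (\<lambda>t. indicat_real {0..T} t * (u (t + \<tau>) $ i * v t $ j))" for i j
  proof -
    have "bsig (\<lambda>t. coord u i (t + \<tau>) * coord v j t)"
      using assms by (intro bsig_mult bsig_shift bsig_coord)
    from integrable_Re[OF integrable_bsig_interval[OF this]] show ?thesis by simp
  qed
  have "(LINT t|lborel. indicat_real {0..T} t *\<^sub>R outer (u (t + \<tau>)) (v t)) $ i $ j =
     (LINT t|lborel. indicat_real {0..T} t * (u (t + \<tau>) $ i * v t $ j))"
  proof -
    have J: "integrable lborel (\<lambda>t. indicat_real {0..T} t *\<^sub>R outer (u (t + \<tau>)) (v t))"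
      using I by (simp add: integrable_vec_iff outer_def)
    hence J': "integrable lborel (\<lambda>t. (indicat_real {0..T} t *\<^sub>R outer (u (t + \<tau>)) (v t)) $ i)"
      unfolding integrable_vec_iff[of _ "\<lambda>t. indicat_real {0..T} t *\<^sub>R outer (u (t + \<tau>)) (v t)"] by blast
    show ?thesis
      unfolding integral_vec_nth'[OF J] integral_vec_nth'[OF J'] by (simp add: outer_def)
  qed
  hence "time_avg (\<lambda>t. outer (u (t + \<tau>)) (v t)) T $ i $ j = time_avg (\<lambda>t. u (t + \<tau>) $ i * v t $ j) T"
    by (simp add: time_avg_def set_lebesgue_integral_def)
  thus ?thesis by (simp flip: time_avg_of_real)
qed

lemma corr_limit_iff:
  assumes "bounded_signal u" "bounded_signal v"
  shows "(time_avg (\<lambda>t. outer (u (t + \<tau>)) (v t)) \<longlongrightarrow> R) at_top \<longleftrightarrow>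
    (\<forall>i j. (time_avg (\<lambda>t. coord u i (t + \<tau>) * cnj (coord v j t)) \<longlongrightarrow> complex_of_real (R $ i $ j)) at_top)"
proof -
  have e: "time_avg (\<lambda>t. coord u i (t + \<tau>) * cnj (coord v j t)) =
     (\<lambda>T. complex_of_real (time_avg (\<lambda>t. outer (u (t + \<tau>)) (v t)) T $ i $ j))" for i j
    by (rule ext) (simp add: time_avg_outer[OF assms])
  show ?thesis unfolding e tendsto_of_real_iff
  proof (intro iffI allI)
    fix i j
    assume "(time_avg (\<lambda>t. outer (u (t + \<tau>)) (v t)) \<longlongrightarrow> R) at_top"
    thus "((\<lambda>T. time_avg (\<lambda>t. outer (u (t + \<tau>)) (v t)) T $ i $ j) \<longlongrightarrow> R $ i $ j) at_top"
      by (intro tendsto_vec_nth)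
  next
    assume *: "\<forall>i j. ((\<lambda>T. time_avg (\<lambda>t. outer (u (t + \<tau>)) (v t)) T $ i $ j) \<longlongrightarrow> R $ i $ j) at_top"
    show "(time_avg (\<lambda>t. outer (u (t + \<tau>)) (v t)) \<longlongrightarrow> R) at_top"
      by (rule vec_tendstoI, rule vec_tendstoI) (use * in blast)
  qed
qed

lemma tendsto_Lim_at_top:
  "\<exists>l. (f \<longlongrightarrow> l) at_top \<Longrightarrow> (f \<longlongrightarrow> (Lim at_top f :: 'a::t2_space)) (at_top :: real filter)"
  using tendsto_Lim[OF trivial_limit_at_top_linorder] by metis

text \<open>The scalar limits are complex a priori. They are limits of averages of real products,
  hence real, and can be assembled into a real matrix.\<close>

lemma corr_of_has_corr:
  assumes "bounded_signal u" "bounded_signal v"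
    and R: "\<And>i j. has_corr (coord u i) (coord v j) (R i j)"
  shows "corr_exists u v" and "complex_of_real (corr u v \<tau> $ i $ j) = R i j \<tau>"
proof -
  have lim: "(time_avg (\<lambda>t. outer (u (t + \<tau>)) (v t)) \<longlongrightarrow> (\<chi> i j. Re (R i j \<tau>))) at_top" for \<tau>
  proof (subst corr_limit_iff[OF assms(1,2)], intro allI)
    fix i j
    have l: "(time_avg (\<lambda>t. coord u i (t + \<tau>) * cnj (coord v j t)) \<longlongrightarrow> R i j \<tau>) at_top"
      using R by (simp add: has_corr_def)
    have "Im (time_avg (\<lambda>t. coord u i (t + \<tau>) * cnj (coord v j t)) T) = 0" for T
      unfolding time_avg_outer[OF assms(1,2), symmetric] by (rule Im_complex_of_real)
    with tendsto_Im[OF l] have "Im (R i j \<tau>) = 0"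
      using tendsto_unique[OF trivial_limit_at_top_linorder _ tendsto_const] by auto
    hence "complex_of_real (Re (R i j \<tau>)) = R i j \<tau>" by (simp add: complex_eq_iff)
    with l show "(time_avg (\<lambda>t. coord u i (t + \<tau>) * cnj (coord v j t)) \<longlongrightarrow>
        complex_of_real ((\<chi> i j. Re (R i j \<tau>)) $ i $ j)) at_top"
      by simp
  qed
  thus "corr_exists u v" unfolding corr_exists_def by blast
  have "corr u v \<tau> = (\<chi> i j. Re (R i j \<tau>))"
    unfolding corr_def using lim by (intro tendsto_Lim) auto
  with lim[of \<tau>] have "(time_avg (\<lambda>t. outer (u (t + \<tau>)) (v t)) \<longlongrightarrow> corr u v \<tau>) at_top" by simp
  hence "(time_avg (\<lambda>t. coord u i (t + \<tau>) * cnj (coord v j t)) \<longlongrightarrow> complex_of_real (corr u v \<tau> $ i $ j)) at_top"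
    using corr_limit_iff[OF assms(1,2)] by blast
  thus "complex_of_real (corr u v \<tau> $ i $ j) = R i j \<tau>"
    using R[of i j] unfolding has_corr_def
    by (intro tendsto_unique[OF trivial_limit_at_top_linorder]) blast+
qed

lemma has_corr_of_corr:
  assumes "bounded_signal u" "bounded_signal v" "spec_exists u v"
  shows "has_corr (coord u i) (coord v j) (\<lambda>\<tau>. complex_of_real (corr u v \<tau> $ i $ j))"
    and "integrable lborel (\<lambda>\<tau>. complex_of_real (corr u v \<tau> $ i $ j))"
    and "lap (\<lambda>\<tau>. complex_of_real (corr u v \<tau> $ i $ j)) (jw \<omega>) = spec u v \<omega> $ i $ j"
proof -
  have "(time_avg (\<lambda>t. outer (u (t + \<tau>)) (v t)) \<longlongrightarrow> corr u v \<tau>) at_top" for \<tau>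
    using assms(3) unfolding spec_exists_def corr_exists_def corr_def
    by (intro tendsto_Lim_at_top) blast
  thus "has_corr (coord u i) (coord v j) (\<lambda>\<tau>. complex_of_real (corr u v \<tau> $ i $ j))"
    unfolding has_corr_def using corr_limit_iff[OF assms(1,2)] by blast
  have "integrable lborel (\<lambda>\<tau>. corr u v \<tau> $ i $ j)"
    using assms(3) unfolding spec_exists_def by (auto simp: integrable_vec_iff)
  thus "integrable lborel (\<lambda>\<tau>. complex_of_real (corr u v \<tau> $ i $ j))" by simp
  show "lap (\<lambda>\<tau>. complex_of_real (corr u v \<tau> $ i $ j)) (jw \<omega>) = spec u v \<omega> $ i $ j"
    by (simp add: lap_def spec_def fourier_def mult_ac)
qed

lemma cspec_spec:
  assumes u: "bounded_signal u" "bounded_signal v" and S: "cspec u v S"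
  shows "spec_exists u v" "spec u v = S"
    "complex_of_real (corr u v 0 $ i $ j) = 1 / (2 * complex_of_real pi) * (LINT \<omega>|lborel. S \<omega> $ i $ j)"
    "integrable lborel (\<lambda>\<omega>. S \<omega> $ i $ j)"
proof -
  obtain R where R: "\<And>i j. has_corr (coord u i) (coord v j) (R i j)" "\<And>i j. integrable lborel (R i j)"
     "\<And>i j \<omega>. lap (R i j) (jw \<omega>) = S \<omega> $ i $ j"
     "\<And>i j. integrable lborel (\<lambda>\<omega>. S \<omega> $ i $ j)"
     "\<And>i j. R i j 0 = 1 / (2 * complex_of_real pi) * (LINT \<omega>|lborel. S \<omega> $ i $ j)"
    using S unfolding cspec_def has_spec_def by metis
  note c = corr_of_has_corr[OF u R(1)]
  have "integrable lborel (\<lambda>\<tau>. corr u v \<tau> $ i $ j)" for i j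
    using integrable_Re[OF R(2)[of i j]] by (simp flip: c(2))
  thus ex: "spec_exists u v" using c(1) by (simp add: spec_exists_def integrable_vec_iff)
  show "spec u v = S"
    using has_corr_of_corr(3)[OF u ex] c(2) R(3) by (simp add: fun_eq_iff vec_eq_iff)
  show "complex_of_real (corr u v 0 $ i $ j) = 1 / (2 * complex_of_real pi) * (LINT \<omega>|lborel. S \<omega> $ i $ j)"
    "integrable lborel (\<lambda>\<omega>. S \<omega> $ i $ j)"
    using c(2) R(4,5) by auto
qed

section \<open>Power signals in terms of their densities\<close>

text \<open>The trace of \<open>outer x x\<close> is the squared norm of \<open>x\<close>, and
  taking the trace commutes with time averages and with limits.\<close>

lemma power_limit:
  assumes u: "bounded_signal u" and ex: "corr_exists u u"
  shows "(time_avg (\<lambda>t. (norm (u t))\<^sup>2) \<longlongrightarrow> trace (corr u u 0)) at_top" and "(pow_norm u)\<^sup>2 = trace (corr u u 0)"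
proof -
  have lim: "(time_avg (\<lambda>t. outer (u (t + 0)) (u t)) \<longlongrightarrow> corr u u 0) at_top"
    using ex unfolding corr_exists_def corr_def
    by (intro tendsto_Lim_at_top) blast
  have I: "integrable lborel (\<lambda>t. indicat_real {0..T} t * (u t $ i * u t $ i))" for i T
  proof -
    have "bsig (\<lambda>t. coord u i t * coord u i t)"
      using assms by (intro bsig_mult bsig_coord)
    from integrable_Re[OF integrable_bsig_interval[OF this]] show ?thesis by simp
  qed
  have nn: "time_avg (\<lambda>t. (norm (u t))\<^sup>2) T = trace (time_avg (\<lambda>t. outer (u (t + 0)) (u t)) T)" for T
  proof -
    have "time_avg (\<lambda>t. outer (u (t + 0)) (u t)) T $ i $ i = time_avg (\<lambda>t. u t $ i * u t $ i) T" for i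
      using time_avg_outer[OF u u, of 0 T i i] by (simp flip: of_real_mult add: time_avg_of_real)
    moreover have "time_avg (\<lambda>t. (norm (u t))\<^sup>2) T = (\<Sum>i\<in>UNIV. time_avg (\<lambda>t. u t $ i * u t $ i) T)"
      unfolding time_avg_def set_lebesgue_integral_def power2_norm_eq_inner inner_vec_def
      using Bochner_Integration.integral_sum[of UNIV lborel "\<lambda>i t. indicat_real {0..T} t * (u t $ i * u t $ i)", OF I]
      by (simp add: sum_distrib_left[symmetric] sum_divide_distrib)
    ultimately show ?thesis by (simp add: trace_def)
  qed
  have "((\<lambda>T. trace (time_avg (\<lambda>t. outer (u (t + 0)) (u t)) T)) \<longlongrightarrow> trace (corr u u 0)) at_top"
    unfolding trace_def by (intro tendsto_sum tendsto_vec_nth lim)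
  thus l: "(time_avg (\<lambda>t. (norm (u t))\<^sup>2) \<longlongrightarrow> trace (corr u u 0)) at_top" by (simp only: nn[symmetric])
  have "trace (corr u u 0) \<ge> 0"
    by (rule tendsto_lowerbound[OF l])
       (auto intro!: eventually_mono[OF eventually_gt_at_top[of 0]] integral_nonneg_AE
          simp: time_avg_def set_lebesgue_integral_def)
  thus "(pow_norm u)\<^sup>2 = trace (corr u u 0)"
    unfolding pow_norm_def using tendsto_Lim[OF trivial_limit_at_top_linorder l] by simp
qed

text \<open>This is how filtered signals enter the space: once a density has been calculated,
  membership and the formula for the seminorm follow.\<close>

lemma power_signals_of_cspec:
  assumes u: "bounded_signal u" and S: "cspec u u S"
  shows "u \<in> power_signals" "spec u u = S" "integrable lborel (\<lambda>\<omega>. trace (S \<omega>))"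
    "complex_of_real ((pow_norm u)\<^sup>2) = 1 / (2 * complex_of_real pi) * (LINT \<omega>|lborel. trace (S \<omega>))"
proof -
  note c = cspec_spec[OF u u S]
  note p = power_limit[OF u]
  show I: "integrable lborel (\<lambda>\<omega>. trace (S \<omega>))" unfolding trace_def using c(4) by auto
  show "spec u u = S" by (rule c)
  have ex: "corr_exists u u" using c(1) by (simp add: spec_exists_def)
  show P: "complex_of_real ((pow_norm u)\<^sup>2) = 1 / (2 * complex_of_real pi) * (LINT \<omega>|lborel. trace (S \<omega>))"
    unfolding p(2)[OF ex] trace_def using c(3,4)
    by (simp add: Bochner_Integration.integral_sum sum_divide_distrib)
  show "u \<in> power_signals"
    unfolding power_signals_def using u c(1,2) p(1)[OF ex] I P by auto
qed

text \<open>Membership controls only the trace of the power; \<open>has_spec_of_trace\<close>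
  extends the lag-0 identity to every entry of the density matrix.\<close>

lemma power_signalsD:
  assumes "u \<in> power_signals"
  shows "bounded_signal u" "spec_exists u u" "cspec u u (spec u u)"
proof -
  show u: "bounded_signal u" and ex: "spec_exists u u"
    using assms by (auto simp: power_signals_def)
  have ce: "corr_exists u u" using ex by (simp add: spec_exists_def)
  note h = has_corr_of_corr[OF u u ex]
  have I: "integrable lborel (\<lambda>\<omega>. trace (spec u u \<omega>))"
    and P: "complex_of_real ((pow_norm u)\<^sup>2) = 1 / (2 * complex_of_real pi) * (LINT \<omega>|lborel. trace (spec u u \<omega>))"
    using assms by (auto simp: power_signals_def)
  show "cspec u u (spec u u)" unfolding cspec_def h(3)[symmetric]
  proof (intro allI, rule has_spec_of_trace)
    show "integrable lborel (\<lambda>\<omega>. \<Sum>i\<in>UNIV. lap (\<lambda>\<tau>. complex_of_real (corr u u \<tau> $ i $ i)) (jw \<omega>))"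
      using I unfolding h(3) trace_def .
    show "(\<Sum>i\<in>UNIV. complex_of_real (corr u u 0 $ i $ i)) = 1 / (2 * complex_of_real pi) *
      (LINT \<omega>|lborel. (\<Sum>i\<in>UNIV. lap (\<lambda>\<tau>. complex_of_real (corr u u \<tau> $ i $ i)) (jw \<omega>)))"
      using P unfolding h(3) trace_def[symmetric] power_limit(2)[OF u ce] by (simp add: trace_def)
  qed (use h bsig_coord[OF u] in auto)
qed

lemma UNIV_sum_type: "(\<Sum>i\<in>(UNIV :: ('a::finite + 'b::finite) set). f i) = (\<Sum>i\<in>UNIV. f (Inl i)) + (\<Sum>i\<in>UNIV. f (Inr i))"
  by (simp add: UNIV_Plus_UNIV[symmetric] sum.Plus del: UNIV_Plus_UNIV)

text \<open>The trace identity of the joint signal \<open>(u, v)\<close> is the sum of those of \<open>u\<close> and \<open>v\<close>, so the cross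
  density carries the cross power without further assumptions.\<close>

lemma cspec_of_spec_exists:
  fixes u :: "real \<Rightarrow> real^'n" and v :: "real \<Rightarrow> real^'m"
  assumes u: "u \<in> power_signals" and v: "v \<in> power_signals" and ex: "spec_exists u v"
  shows "cspec u v (spec u v)"
proof -
  note U = power_signalsD[OF u] and V = power_signalsD[OF v]
  note hu = has_corr_of_corr[OF U(1,1,2)] and hv = has_corr_of_corr[OF V(1,1,2)]
    and h = has_corr_of_corr[OF U(1) V(1) ex]
  define a where "a k = (case k of Inl i \<Rightarrow> coord u i | Inr j \<Rightarrow> coord v j)" for k
  \<comment> \<open>Only the correlation of \<open>u\<close> with \<open>v\<close> is given. The
    lower left block is its reflection, so existence of the correlation of \<open>v\<close> with
    \<open>u\<close> is a consequence.\<close>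
  define R where "R k l = (\<lambda>\<tau>. case k of
      Inl i \<Rightarrow> (case l of Inl i' \<Rightarrow> complex_of_real (corr u u \<tau> $ i $ i') | Inr j \<Rightarrow> complex_of_real (corr u v \<tau> $ i $ j))
    | Inr j \<Rightarrow> (case l of Inl i \<Rightarrow> cnj (complex_of_real (corr u v (- \<tau>) $ i $ j)) | Inr j' \<Rightarrow> complex_of_real (corr v v \<tau> $ j $ j')))" for k l
  have ba: "bsig (a k)" for k
    unfolding a_def using bsig_coord[OF U(1)] bsig_coord[OF V(1)] by (cases k) auto
  have Ra: "has_corr (a k) (a l) (R k l)" for k l
  proof (cases k)
    case k: (Inl i)
    show ?thesis unfolding k a_def R_def by (cases l) (use hu(1) h(1) in auto)
  next
    case k: (Inr j)
    show ?thesis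
    proof (cases l)
      case (Inl i)
      thus ?thesis unfolding k a_def R_def
        using has_corr_flip[OF bsig_coord[OF U(1)] bsig_coord[OF V(1)] h(1)] by simp
    qed (use k hv(1) in \<open>simp add: a_def R_def\<close>)
  qed
  have Ri: "integrable lborel (R k l)" for k l
  proof (cases k)
    case k: (Inl i)
    show ?thesis unfolding k R_def by (cases l) (use hu(2) h(2) in auto)
  next
    case k: (Inr j)
    show ?thesis
    proof (cases l)
      case (Inl i)
      thus ?thesis unfolding k R_def using integrable_flip[OF h(2)] by simp
    qed (use k hv(2) in \<open>simp add: R_def\<close>)
  qed
  have L: "lap (R (Inl i) (Inl i')) (jw \<omega>) = spec u u \<omega> $ i $ i'"
    "lap (R (Inr j) (Inr j')) (jw \<omega>) = spec v v \<omega> $ j $ j'"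
    "lap (R (Inl i) (Inr j)) (jw \<omega>) = spec u v \<omega> $ i $ j" for i i' j j' \<omega>
    unfolding R_def using hu(3) hv(3) h(3) by auto
  note pu = power_signals_of_cspec[OF U(1,3)] and pv = power_signals_of_cspec[OF V(1,3)]
  have ce: "corr_exists u u" "corr_exists v v" using U(2) V(2) by (auto simp: spec_exists_def)
  have tr: "(\<Sum>k\<in>UNIV. lap (R k k) (jw \<omega>)) = trace (spec u u \<omega>) + trace (spec v v \<omega>)" for \<omega>
    unfolding UNIV_sum_type L trace_def ..
  have "has_spec (a (Inl i)) (a (Inr j)) (\<lambda>\<omega>. lap (R (Inl i) (Inr j)) (jw \<omega>))" for i j
  proof (rule has_spec_of_trace[OF ba Ra Ri])
    show "integrable lborel (\<lambda>\<omega>. \<Sum>k\<in>UNIV. lap (R k k) (jw \<omega>))"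
      unfolding tr using pu(3) pv(3) by auto
    have "(\<Sum>k\<in>UNIV. R k k 0) = complex_of_real ((pow_norm u)\<^sup>2) + complex_of_real ((pow_norm v)\<^sup>2)"
      unfolding UNIV_sum_type power_limit(2)[OF U(1) ce(1)] power_limit(2)[OF V(1) ce(2)]
      by (simp add: R_def trace_def)
    also have "\<dots> = 1 / (2 * complex_of_real pi) * (LINT \<omega>|lborel. trace (spec u u \<omega>) + trace (spec v v \<omega>))"
      unfolding pu(4) pv(4) using pu(3) pv(3) by (simp add: add_divide_distrib)
    finally show "(\<Sum>k\<in>UNIV. R k k 0) = 1 / (2 * complex_of_real pi) * (LINT \<omega>|lborel. (\<Sum>k\<in>UNIV. lap (R k k) (jw \<omega>)))"
      unfolding tr .
  qed
  thus ?thesis unfolding cspec_def L by (simp add: a_def)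
qed

lemma cspec_flip:
  assumes "bounded_signal u" "bounded_signal v" "cspec u v S"
  shows "cspec v u (\<lambda>\<omega>. conj_transpose (S \<omega>))"
  using assms unfolding cspec_def conj_transpose_def
  by (auto intro!: has_spec_flip bsig_coord)

lemma cspec_add:
  assumes "bounded_signal u" "bounded_signal u'" "bounded_signal v" "cspec u v S" "cspec u' v S'"
  shows "cspec (\<lambda>t. u t + u' t) v (\<lambda>\<omega>. S \<omega> + S' \<omega>)"
  using assms unfolding cspec_def
  by (auto intro!: has_spec_add bsig_coord)

lemma bounded_signal_add:
  assumes "bounded_signal u" "bounded_signal v"
  shows "bounded_signal (\<lambda>t. u t + v t)"
  using assms by (auto simp: bounded_signal_iff intro!: bsig_add)

lemma cspec_cong: "cspec u v S \<Longrightarrow> (\<And>\<omega>. S \<omega> = S' \<omega>) \<Longrightarrow> cspec u v S'"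
  by (simp add: cspec_def)

section \<open>Filtering of bounded power signals\<close>

text \<open>Whatever pair the choice operator picks, it is one and the same for all inputs and
  times.\<close>

lemma lti_map_impulse_response:
  fixes G :: "complex \<Rightarrow> complex^'m^'n"
  assumes "\<exists>D h. impulse_response G D h"
  obtains D h where "impulse_response G D h"
    "\<And>u t. lti_map G u t = (if t < 0 then 0 else D *v u t + (LINT \<sigma>|lborel. h (t - \<sigma>) *v u \<sigma>))"
proof -
  define p where "p = (SOME (D, h). impulse_response G D h)"
  have "case p of (D, h) \<Rightarrow> impulse_response G D h"
    unfolding p_def by (rule someI_ex) (use assms in auto)
  moreover have "lti_map G u t = (if t < 0 then 0 else fst p *v u t + (LINT \<sigma>|lborel. snd p (t - \<sigma>) *v u \<sigma>))" for u t
    unfolding lti_map_def p_def[symmetric] Let_def by (simp add: case_prod_unfold)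
  ultimately show ?thesis using that[of "fst p" "snd p"] by (auto simp: case_prod_unfold)
qed

lemma integrable_kernel_mv:
  assumes h: "integrable lborel h" and u: "bounded_signal u"
  shows "integrable lborel (\<lambda>\<sigma>. h (t - \<sigma>) *v u \<sigma>)"
    and "complex_of_real ((LINT \<sigma>|lborel. h (t - \<sigma>) *v u \<sigma>) $ i) =
      (\<Sum>k\<in>UNIV. conv (\<lambda>t. complex_of_real (h t $ i $ k)) (coord u k) t)"
proof -
  have hi: "integrable lborel (\<lambda>t. complex_of_real (h t $ i $ k))" for i k
    using h by (simp add: integrable_vec_iff)
  have I: "integrable lborel (\<lambda>\<sigma>. complex_of_real (h (t - \<sigma>) $ i $ k * u \<sigma> $ k))" for i k
  proof -
    obtain B where "\<And>t. norm (coord u k t) \<le> B" using bsigE[OF bsig_coord[OF u]] by blast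
    from norm_conv_le(1)[OF hi bsig_coord[OF u] this, of i k t]
    show ?thesis using integrable_shift(3)[of "\<lambda>s. complex_of_real (h s $ i $ k) * coord u k (t - s)" t] by simp
  qed
  have I': "integrable lborel (\<lambda>\<sigma>. (h (t - \<sigma>) *v u \<sigma>) $ i)" for i
    using integrable_Re[OF I, of i] unfolding matrix_vector_mult_def
    by (simp add: Bochner_Integration.integrable_sum)
  thus J: "integrable lborel (\<lambda>\<sigma>. h (t - \<sigma>) *v u \<sigma>)" by (simp add: integrable_vec_iff)
  have "complex_of_real ((LINT \<sigma>|lborel. h (t - \<sigma>) *v u \<sigma>) $ i) =
     (LINT \<sigma>|lborel. (\<Sum>k\<in>UNIV. complex_of_real (h (t - \<sigma>) $ i $ k * u \<sigma> $ k)))"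
    unfolding integral_vec_nth'[OF J] integral_complex_of_real[symmetric]
    by (simp add: matrix_vector_mult_def)
  also have "\<dots> = (\<Sum>k\<in>UNIV. LINT \<sigma>|lborel. complex_of_real (h (t - \<sigma>) $ i $ k * u \<sigma> $ k))"
    using I by (rule Bochner_Integration.integral_sum)
  also have "\<dots> = (\<Sum>k\<in>UNIV. conv (\<lambda>t. complex_of_real (h t $ i $ k)) (coord u k) t)"
  proof (intro sum.cong refl)
    fix k
    show "(LINT \<sigma>|lborel. complex_of_real (h (t - \<sigma>) $ i $ k * u \<sigma> $ k)) = conv (\<lambda>t. complex_of_real (h t $ i $ k)) (coord u k) t"
      unfolding conv_def
      using integral_shift(3)[of "\<lambda>s. complex_of_real (h s $ i $ k) * coord u k (t - s)" t] by simp
  qed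
  finally show "complex_of_real ((LINT \<sigma>|lborel. h (t - \<sigma>) *v u \<sigma>) $ i) =
      (\<Sum>k\<in>UNIV. conv (\<lambda>t. complex_of_real (h t $ i $ k)) (coord u k) t)" .
qed

lemma fourier_nth: "fourier h \<omega> $ i $ j = lap (\<lambda>t. complex_of_real (h t $ i $ j)) (jw \<omega>)"
  by (simp add: lap_def fourier_def mult_ac)

text \<open>The feedthrough acts on densities by \<open>has_spec_cmult\<close> and the kernel by
  \<open>has_spec_conv\<close>. Their factors add up to \<open>G\<close> on the axis, and the cut at
  time 0 is absorbed by \<open>has_spec_trunc\<close>.\<close>

lemma lti_map_filter:
  fixes G :: "complex \<Rightarrow> complex^'m^'n"
  assumes ex: "\<exists>D h. impulse_response G D h" and u: "bounded_signal u"
  shows "bounded_signal (lti_map G u)"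
    and "bounded_signal v \<Longrightarrow> cspec u v S \<Longrightarrow> cspec (lti_map G u) v (\<lambda>\<omega>. G (jw \<omega>) ** S \<omega>)"
proof -
  from ex obtain D h where ir: "impulse_response G D h"
    and lti: "\<And>u t. lti_map G u t = (if t < 0 then 0 else D *v u t + (LINT \<sigma>|lborel. h (t - \<sigma>) *v u \<sigma>))"
    using lti_map_impulse_response by blast
  have h: "integrable lborel h" and G: "\<And>\<omega>. G (jw \<omega>) = cmat D + fourier h \<omega>"
    using ir by (auto simp: impulse_response_def)
  define H where "H i k = (\<lambda>t. complex_of_real (h t $ i $ k))" for i k
  have H: "integrable lborel (H i k)" for i k
    using h by (simp add: integrable_vec_iff H_def)
  define y where "y i t = (\<Sum>k\<in>UNIV. complex_of_real (D $ i $ k) * coord u k t + conv (H i k) (coord u k) t)" for i t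
  have c: "coord (lti_map G u) i = (\<lambda>t. if t < 0 then 0 else y i t)" for i
  proof
    fix t
    show "coord (lti_map G u) i t = (if t < 0 then 0 else y i t)"
      unfolding lti y_def using integrable_kernel_mv(2)[OF h u, of t i]
      by (simp add: matrix_vector_mult_def sum.distrib H_def)
  qed
  have yk: "bsig (\<lambda>t. complex_of_real (D $ i $ k) * coord u k t + conv (H i k) (coord u k) t)" for i k
    by (intro bsig_add bsig_cmult bsig_conv H bsig_coord u)
  have yb: "bsig (y i)" for i
    unfolding y_def[abs_def] by (intro bsig_sum yk) auto
  show bl: "bounded_signal (lti_map G u)"
    unfolding bounded_signal_iff c using yb lti by auto
  assume v: "bounded_signal v" and S: "cspec u v S"
  have "has_spec (y i) (coord v j) (\<lambda>\<omega>. \<Sum>k\<in>UNIV. complex_of_real (D $ i $ k) * S \<omega> $ k $ j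
      + lap (H i k) (jw \<omega>) * S \<omega> $ k $ j)" for i j
    unfolding y_def[abs_def] using S
    by (intro has_spec_sum yk has_spec_add has_spec_cmult has_spec_conv bsig_cmult bsig_conv H bsig_coord u v)
       (auto simp: cspec_def)
  moreover have "(\<Sum>k\<in>UNIV. complex_of_real (D $ i $ k) * S \<omega> $ k $ j
      + lap (H i k) (jw \<omega>) * S \<omega> $ k $ j) = (G (jw \<omega>) ** S \<omega>) $ i $ j" for i j \<omega>
    unfolding G matrix_matrix_mult_def H_def by (simp add: cmat_def fourier_nth distrib_right)
  ultimately show "cspec (lti_map G u) v (\<lambda>\<omega>. G (jw \<omega>) ** S \<omega>)"
    unfolding cspec_def c by (auto intro!: has_spec_trunc yb bsig_coord v)
qed

section \<open>Impulse responses of rational functions\<close>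

text \<open>With \<open>C\<close> the impulse response is causal and the representation holds on the closed right
  half-plane, otherwise it holds on the imaginary axis.\<close>

definition lap_region :: "bool \<Rightarrow> complex set" where
  "lap_region C = {s. Re s = 0 \<or> C \<and> Re s \<ge> 0}"

definition lap_class :: "bool \<Rightarrow> (real \<Rightarrow> complex) set" where
  "lap_class C = {h. integrable lborel h \<and> (C \<longrightarrow> (\<forall>t<0. h t = 0))}"

definition lap_rep :: "bool \<Rightarrow> (complex \<Rightarrow> complex) \<Rightarrow> bool" where
  "lap_rep C f \<longleftrightarrow> (\<exists>c. \<exists>h\<in>lap_class C. \<forall>s\<in>lap_region C. f s = c + lap h s)"

text \<open>Wherever \<open>h\<close> can be nonzero the exponential has norm at most 1: always on
  the axis, and for nonnegative times in the right half-plane.\<close>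

lemma lap_class_integrable:
  assumes h: "h \<in> lap_class C" and s: "s \<in> lap_region C"
  shows "integrable lborel (\<lambda>t. exp (- s * complex_of_real t) * h t)"
proof (rule Bochner_Integration.integrable_bound)
  have i: "integrable lborel h" using h by (simp add: lap_class_def)
  thus "integrable lborel h" .
  have [measurable]: "h \<in> borel_measurable borel" using i by auto
  show "(\<lambda>t. exp (- s * complex_of_real t) * h t) \<in> borel_measurable lborel" by measurable
  have "norm (exp (- s * complex_of_real t) * h t) \<le> norm (h t)" for t
  proof (cases "C \<and> t < 0")
    case True thus ?thesis using h by (simp add: lap_class_def)
  next
    case False
    hence "Re s * t \<ge> 0" using s by (auto simp: lap_region_def)
    hence "norm (exp (- s * complex_of_real t)) \<le> 1" by (simp add: norm_exp_eq_Re)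
    thus ?thesis unfolding norm_mult by (simp add: mult_left_le_one_le)
  qed
  thus "AE t in lborel. norm (exp (- s * complex_of_real t) * h t) \<le> norm (h t)" by simp
qed

lemma lap_class_lin:
  assumes "h \<in> lap_class C" "k \<in> lap_class C"
  shows "(\<lambda>t. c * h t + d * k t) \<in> lap_class C"
    "s \<in> lap_region C \<Longrightarrow> lap (\<lambda>t. c * h t + d * k t) s = c * lap h s + d * lap k s"
proof -
  show "(\<lambda>t. c * h t + d * k t) \<in> lap_class C" using assms by (auto simp: lap_class_def)
  assume s: "s \<in> lap_region C"
  have "lap (\<lambda>t. c * h t + d * k t) s =
     (LINT t|lborel. c * (exp (- s * complex_of_real t) * h t) + d * (exp (- s * complex_of_real t) * k t))"
    unfolding lap_def by (simp add: algebra_simps)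
  also have "\<dots> = c * lap h s + d * lap k s"
    unfolding lap_def integral_mult_right_zero[symmetric]
    by (intro Bochner_Integration.integral_add integrable_mult_right lap_class_integrable[OF _ s] assms)
  finally show "lap (\<lambda>t. c * h t + d * k t) s = c * lap h s + d * lap k s" .
qed

lemma lap_class_conv:
  assumes h: "h \<in> lap_class C" and k: "k \<in> lap_class C"
  shows "conv h k \<in> lap_class C"
proof -
  have "conv h k t = 0" if C and "t < 0" for t
    using h k that by (intro conv_causal) (auto simp: lap_class_def)
  thus ?thesis using assms integrable_conv by (auto simp: lap_class_def)
qed

lemma zero_lap_class: "(\<lambda>t. 0) \<in> lap_class C"
  by (simp add: lap_class_def)

lemma lap_zero [simp]: "lap (\<lambda>t. 0) s = 0"
  by (simp add: lap_def)

lemma lap_rep_cong: "lap_rep C f \<Longrightarrow> (\<And>s. s \<in> lap_region C \<Longrightarrow> f s = g s) \<Longrightarrow> lap_rep C g"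
  unfolding lap_rep_def by (metis (no_types, lifting))

lemma lap_rep_const: "lap_rep C (\<lambda>s. c)"
  unfolding lap_rep_def by (intro exI[of _ c] bexI[OF _ zero_lap_class]) simp

lemma lap_rep_mult:
  assumes "lap_rep C f" "lap_rep C g"
  shows "lap_rep C (\<lambda>s. f s * g s)"
proof -
  obtain c h d k where *: "h \<in> lap_class C" "\<And>s. s \<in> lap_region C \<Longrightarrow> f s = c + lap h s"
     "k \<in> lap_class C" "\<And>s. s \<in> lap_region C \<Longrightarrow> g s = d + lap k s"
    using assms unfolding lap_rep_def by blast
  \<comment> \<open>The time-domain form of the expanded product without its constant term; the
    factors \<open>1\<close> fit it to the linear combinations of
    \<open>lap_class_lin\<close>.\<close>
  define m where "m = (\<lambda>t. 1 * (c * k t + d * h t) + 1 * conv h k t)"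
  have m: "m \<in> lap_class C" unfolding m_def by (intro lap_class_lin lap_class_conv *)
  have "f s * g s = c * d + lap m s" if s: "s \<in> lap_region C" for s
    unfolding m_def using s *(2,4) lap_conv(2)[OF lap_class_integrable[OF *(1) s] lap_class_integrable[OF *(3) s]]
    by (subst lap_class_lin(2)[OF lap_class_lin(1)[OF *(3,1)] lap_class_conv[OF *(1,3)] s],
        subst lap_class_lin(2)[OF *(3,1) s]) (simp add: algebra_simps)
  thus ?thesis unfolding lap_rep_def using m by blast
qed

lemma lap_rep_add:
  assumes "lap_rep C f" "lap_rep C g"
  shows "lap_rep C (\<lambda>s. f s + g s)"
proof -
  obtain c h d k where *: "h \<in> lap_class C" "\<And>s. s \<in> lap_region C \<Longrightarrow> f s = c + lap h s"
     "k \<in> lap_class C" "\<And>s. s \<in> lap_region C \<Longrightarrow> g s = d + lap k s"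
    using assms unfolding lap_rep_def by blast
  have "f s + g s = (c + d) + lap (\<lambda>t. 1 * h t + 1 * k t) s" if "s \<in> lap_region C" for s
    using that *(2,4) by (subst lap_class_lin(2)[OF *(1,3)]) auto
  thus ?thesis unfolding lap_rep_def using lap_class_lin(1)[OF *(1,3)] by blast
qed

lemma exp_halfline:
  assumes z: "Re z > 0"
  shows "integrable lborel (\<lambda>t. indicat_real {0<..} t *\<^sub>R exp (- z * complex_of_real t))"
    and "(LINT t|lborel. indicat_real {0<..} t *\<^sub>R exp (- z * complex_of_real t)) = 1 / z"
proof -
  show I: "integrable lborel (\<lambda>t. indicat_real {0<..} t *\<^sub>R exp (- z * complex_of_real t))"
    by (rule Bochner_Integration.integrable_bound[OF integrable_I0i_exp_mscale[OF z, unfolded set_integrable_def]])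
       (auto simp: norm_exp_eq_Re mult.commute split: split_indicator)
  have z0: "z \<noteq> 0" using z by auto
  define F where "F t = - (1 / z) * exp (- z * complex_of_real t)" for t
  have tz: "((\<lambda>t. exp (- z * complex_of_real t)) \<longlongrightarrow> 0) at_top"
  proof (rule tendsto_norm_zero_cancel)
    have "LIM x at_top. (- Re z) * x :> at_bot"
      using z by (intro filterlim_tendsto_neg_mult_at_bot[OF tendsto_const] filterlim_ident) auto
    hence "((\<lambda>t. exp ((- Re z) * t)) \<longlongrightarrow> 0) at_top"
      by (rule filterlim_compose[OF exp_at_bot])
    thus "((\<lambda>t. norm (exp (- z * complex_of_real t))) \<longlongrightarrow> 0) at_top"
      by (simp add: norm_exp_eq_Re)
  qed
  have "(LBINT t=ereal 0..\<infinity>. exp (- z * complex_of_real t)) = 0 - F 0"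
  proof (rule interval_integral_FTC_integrable)
    show "(F has_vector_derivative exp (- z * complex_of_real t)) (at t)" for t
      unfolding F_def using z0
      by (intro has_vector_derivative_real_field) (auto intro!: derivative_eq_intros)
    show "isCont (\<lambda>t. exp (- z * complex_of_real t)) t" for t by (intro continuous_intros)
    show "set_integrable lborel (einterval (ereal 0) \<infinity>) (\<lambda>t. exp (- z * complex_of_real t))"
      using I by (simp add: set_integrable_def)
    have "isCont F 0" unfolding F_def by (intro continuous_intros)
    hence "(F \<longlongrightarrow> F 0) (at_right 0)" by (simp add: isCont_def filterlim_at_split)
    thus "((F \<circ> real_of_ereal) \<longlongrightarrow> F 0) (at_right (ereal 0))"
      by (simp add: ereal_tendsto_simps)
    have "(F \<longlongrightarrow> - (1 / z) * 0) at_top" unfolding F_def by (intro tendsto_mult tendsto_const tz)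
    thus "((F \<circ> real_of_ereal) \<longlongrightarrow> 0) (at_left \<infinity>)"
      by (simp add: ereal_tendsto_simps)
  qed simp
  thus "(LINT t|lborel. indicat_real {0<..} t *\<^sub>R exp (- z * complex_of_real t)) = 1 / z"
    by (simp add: interval_integral_to_infinity_eq set_lebesgue_integral_def F_def)
qed

lemma lap_rep_pole_left:
  assumes a: "Re a < 0"
  shows "lap_rep C (\<lambda>s. 1 / (s - a))"
proof -
  define h where "h t = indicat_real {0<..} t *\<^sub>R exp (- (- a) * complex_of_real t)" for t
  have h: "h \<in> lap_class C"
    using exp_halfline(1)[of "- a"] a by (simp add: lap_class_def h_def[abs_def])
  have "lap h s = 1 / (s - a)" if s: "s \<in> lap_region C" for s
  proof -
    have "lap h s = (LINT t|lborel. indicat_real {0<..} t *\<^sub>R exp (- (s - a) * complex_of_real t))"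
      unfolding lap_def h_def
      by (intro Bochner_Integration.integral_cong refl)
         (simp add: algebra_simps scaleR_conv_of_real flip: exp_add)
    thus ?thesis using exp_halfline(2)[of "s - a"] a s by (auto simp: lap_region_def)
  qed
  thus ?thesis unfolding lap_rep_def using h by (intro exI[of _ 0] bexI[of _ h]) auto
qed

lemma lap_rep_pole:
  assumes a: "a \<notin> lap_region C"
  shows "lap_rep C (\<lambda>s. 1 / (s - a))"
proof (cases "Re a < 0")
  case True thus ?thesis by (rule lap_rep_pole_left)
next
  case False
  hence C: "\<not> C" and "Re (- a) < 0" using a by (auto simp: lap_region_def)
  from lap_rep_pole_left[OF this(2), of C] obtain c h where *: "h \<in> lap_class C"
     "\<And>s. s \<in> lap_region C \<Longrightarrow> 1 / (s - - a) = c + lap h s"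
    unfolding lap_rep_def by blast
  \<comment> \<open>The zero summand pads the reflected kernel to a linear combination as in
    \<open>lap_class_lin\<close>.\<close>
  define k where "k = (\<lambda>t. (-1) * h (- t) + 0 * h (-t))"
  have hk: "(\<lambda>t. h (- t)) \<in> lap_class C" using *(1) C integrable_shift(4) by (auto simp: lap_class_def)
  have "1 / (s - a) = - c + lap k s" if s: "s \<in> lap_region C" for s
  proof -
    have s': "- s \<in> lap_region C" using s C by (auto simp: lap_region_def)
    have "lap (\<lambda>t. h (- t)) s = lap h (- s)"
      unfolding lap_def using integral_shift(4)[of "\<lambda>t. exp (s * complex_of_real t) * h t"] by simp
    moreover have "1 / (s - a) = - (1 / (- s - - a))"
      by (metis minus_diff_minus minus_divide_right minus_minus)
    ultimately show ?thesis unfolding k_def lap_class_lin(2)[OF hk hk s] *(2)[OF s'] by simp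
  qed
  moreover have "k \<in> lap_class C" unfolding k_def by (intro lap_class_lin hk)
  ultimately show ?thesis unfolding lap_rep_def by blast
qed

text \<open>Induction on the degree of \<open>q\<close>, dividing \<open>p\<close> by one linear
  factor of \<open>q\<close>: with \<open>p = (s - a) * p' + p(a)\<close> the quotient is
  \<open>p' / q' + p(a) * (1 / (s - a)) * (1 / q')\<close>. Since products are available through
  convolution, partial fractions with multiplicities are avoided.\<close>

lemma lap_rep_rational:
  fixes q :: "complex poly"
  assumes "\<And>s. s \<in> lap_region C \<Longrightarrow> poly q s \<noteq> 0" "degree p \<le> degree q"
  shows "lap_rep C (\<lambda>s. poly p s / poly q s)"
  using assms
proof (induction "degree q" arbitrary: p q)
  case 0
  then obtain c d where "p = [:c:]" "q = [:d:]" by (metis degree_0_id degree_eq_zeroE le_zero_eq)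
  thus ?case by (simp add: lap_rep_const)
next
  case (Suc n)
  have "\<not> constant (poly q)" using Suc(2) constant_degree by (metis nat.distinct(1))
  then obtain a where a: "poly q a = 0" using fundamental_theorem_of_algebra by blast
  then obtain q' where q: "q = [:- a, 1:] * q'" using poly_eq_0_iff_dvd by blast
  have "q' \<noteq> 0" using Suc(2) q by auto
  hence "degree q = degree [:- a, 1:] + degree q'" unfolding q by (intro degree_mult_eq) auto
  hence dq: "degree q' = n" using Suc(2) by simp
  have aC: "a \<notin> lap_region C" using a Suc(3) by blast
  have q'0: "poly q' s \<noteq> 0" if "s \<in> lap_region C" for s using Suc(3)[OF that] q by auto
  define p' where "p' = synthetic_div p a"
  have p: "p = [:- a, 1:] * p' + [:poly p a:]" unfolding p'_def by (simp only: synthetic_div_correct')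
  have dp': "degree p' \<le> degree q'" using Suc(2,4) dq by (simp add: p'_def degree_synthetic_div)
  have l1: "lap_rep C (\<lambda>s. poly p' s / poly q' s)"
    using Suc(1)[OF dq[symmetric] q'0 dp'] .
  have l2: "lap_rep C (\<lambda>s. poly 1 s / poly q' s)"
    using Suc(1)[OF dq[symmetric] q'0, of 1] by simp
  have frac: "d \<noteq> 0 \<Longrightarrow> y \<noteq> 0 \<Longrightarrow> x / y + c * (1 / d * (1 / y)) = (d * x + c) / (d * y)" for c d x y :: complex
    by (simp add: divide_simps)
  have "lap_rep C (\<lambda>s. poly p' s / poly q' s + poly p a * (1 / (s - a) * (poly 1 s / poly q' s)))"
    by (intro lap_rep_add lap_rep_mult lap_rep_const lap_rep_pole aC l1 l2)
  thus ?case
  proof (rule lap_rep_cong)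
    fix s assume s: "s \<in> lap_region C"
    have "s - a \<noteq> 0" using s aC by auto
    moreover have "poly p s = (s - a) * poly p' s + poly p a" by (subst p) (simp add: algebra_simps)
    moreover have "poly q s = (s - a) * poly q' s" by (subst q) (simp add: algebra_simps)
    ultimately show "poly p' s / poly q' s + poly p a * (1 / (s - a) * (poly 1 s / poly q' s)) = poly p s / poly q s"
      using q'0[OF s] frac[of "s - a" "poly q' s" "poly p' s" "poly p a"] by simp
  qed
qed

lemma lap_rep_bounded:
  assumes "lap_rep C f"
  obtains B where "\<And>\<omega>. norm (f (jw \<omega>)) \<le> B"
proof -
  obtain c h where *: "h \<in> lap_class C" "\<And>s. s \<in> lap_region C \<Longrightarrow> f s = c + lap h s"
    using assms unfolding lap_rep_def by blast
  have h: "integrable lborel h" using *(1) by (simp add: lap_class_def)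
  have "norm (f (jw \<omega>)) \<le> norm c + (LINT t|lborel. norm (h t))" for \<omega>
  proof -
    have "f (jw \<omega>) = c + lap h (jw \<omega>)"
      by (rule *(2)) (simp add: lap_region_def)
    thus ?thesis using norm_lap_le[OF h, of \<omega>] norm_triangle_ineq[of c "lap h (jw \<omega>)"]
      by simp
  qed
  thus ?thesis using that by blast
qed

text \<open>Boundedness along one ray of the axis stands in for a degree condition, which is awkward
  for unreduced fractions. The remainder over \<open>q\<close> is bounded, so the polynomial part is
  bounded on the ray and must be constant.\<close>

lemma lap_rep_bounded_rational:
  fixes q :: "complex poly"
  assumes q: "\<And>s. s \<in> lap_region C \<Longrightarrow> poly q s \<noteq> 0"
    and b: "\<And>\<omega>. \<omega> \<ge> K \<Longrightarrow> norm (poly p (jw \<omega>) / poly q (jw \<omega>)) \<le> B"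
  shows "lap_rep C (\<lambda>s. poly p s / poly q s)"
proof -
  have "q \<noteq> 0" using q[of 0] by (auto simp: lap_region_def)
  define d r where "d = p div q" and "r = p mod q"
  have p: "p = d * q + r" unfolding d_def r_def by simp
  have "degree r \<le> degree q" using degree_mod_less[OF \<open>q \<noteq> 0\<close>, of p] unfolding r_def by auto
  hence lr: "lap_rep C (\<lambda>s. poly r s / poly q s)" by (intro lap_rep_rational q)
  then obtain B' where B': "\<And>\<omega>. norm (poly r (jw \<omega>) / poly q (jw \<omega>)) \<le> B'"
    by (rule lap_rep_bounded) blast
  have pq: "poly p s / poly q s = poly d s + poly r s / poly q s" if "s \<in> lap_region C" for s
    using q[OF that] by (simp add: p field_simps)
  have bd: "norm (poly d (jw \<omega>)) \<le> B + B'" if "\<omega> \<ge> K" for \<omega>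
  proof -
    have "poly d (jw \<omega>) = poly p (jw \<omega>) / poly q (jw \<omega>)
        - poly r (jw \<omega>) / poly q (jw \<omega>)"
      by (subst pq) (auto simp: lap_region_def)
    thus ?thesis using b[OF that] B'[of \<omega>] by (simp only:) (rule order_trans[OF norm_triangle_ineq4 add_mono])
  qed
  obtain a d' where d: "d = pCons a d'" by (cases d)
  have "d' = 0"
  proof (rule ccontr)
    assume "d' \<noteq> 0"
    from poly_infinity[OF this, of "B + B' + 1" a] obtain R
      where R: "\<And>z. R \<le> norm z \<Longrightarrow> B + B' + 1 \<le> norm (poly d z)" unfolding d by blast
    have "R \<le> norm (\<i> * complex_of_real (max \<bar>R\<bar> K))"
      unfolding norm_mult norm_of_real by simp
    from R[OF this] bd[of "max \<bar>R\<bar> K"] show False by simp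
  qed
  hence "poly d s = a" for s by (simp add: d)
  hence "lap_rep C (\<lambda>s. poly d s + poly r s / poly q s)"
    by (simp only:) (intro lap_rep_add lap_rep_const lr)
  thus ?thesis by (rule lap_rep_cong) (simp add: pq)
qed

section \<open>Real rational functions\<close>

definition cpoly :: "real poly \<Rightarrow> complex \<Rightarrow> complex" where
  "cpoly p s = poly (map_poly complex_of_real p) s"

lemma cpoly_add [simp]: "cpoly (p + q) s = cpoly p s + cpoly q s"
proof -
  have "map_poly complex_of_real (p + q) = map_poly complex_of_real p + map_poly complex_of_real q"
    by (rule poly_eqI) (simp add: coeff_map_poly)
  thus ?thesis by (simp add: cpoly_def)
qed

lemma cpoly_const [simp]: "cpoly [:c:] s = complex_of_real c" "cpoly 0 s = 0" "cpoly 1 s = 1"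
  by (simp_all add: cpoly_def map_poly_pCons)

lemma cpoly_pCons [simp]: "cpoly (pCons c p) s = complex_of_real c + s * cpoly p s"
  by (simp add: cpoly_def map_poly_pCons)

lemma cpoly_smult [simp]: "cpoly (smult c p) s = complex_of_real c * cpoly p s"
  by (simp add: cpoly_def map_poly_smult)

lemma cpoly_minus [simp]: "cpoly (- p) s = - cpoly p s"
  using cpoly_smult[of "-1" p s] by simp

lemma cpoly_mult [simp]: "cpoly (p * q) s = cpoly p s * cpoly q s"
  by (induction p) (simp_all add: algebra_simps)

lemma cpoly_cnj: "cpoly p (cnj s) = cnj (cpoly p s)"
  by (induction p) simp_all

lemma cpoly_neg: "cpoly (pcompose p [:0, -1:]) s = cpoly p (- s)"
  by (induction p) (simp_all add: pcompose_pCons)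

text \<open>Fractions need not be reduced, and \<open>f\<close> is constrained only off the zeros of
  the chosen denominator, none of which lies in \<open>X\<close>. With \<open>X\<close> the
  imaginary axis this is the entry condition of \<open>RL_inf\<close>.\<close>

definition rat_fun :: "complex set \<Rightarrow> (complex \<Rightarrow> complex) \<Rightarrow> bool" where
  "rat_fun X f \<longleftrightarrow> (\<exists>p q. (\<forall>s\<in>X. cpoly q s \<noteq> 0) \<and> (\<forall>s. cpoly q s \<noteq> 0 \<longrightarrow> f s = cpoly p s / cpoly q s))"

lemma rat_fun_const: "rat_fun X (\<lambda>s. complex_of_real c)"
  unfolding rat_fun_def by (intro exI[of _ "[:c:]"] exI[of _ 1]) simp

lemma rat_fun_id: "rat_fun X (\<lambda>s. s)"
  unfolding rat_fun_def by (intro exI[of _ "[:0, 1:]"] exI[of _ 1]) simp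

lemma rat_fun_add:
  assumes "rat_fun X f" "rat_fun X g" shows "rat_fun X (\<lambda>s. f s + g s)"
proof -
  obtain p q p' q' where *: "\<forall>s\<in>X. cpoly q s \<noteq> 0" "\<forall>s. cpoly q s \<noteq> 0 \<longrightarrow> f s = cpoly p s / cpoly q s"
    "\<forall>s\<in>X. cpoly q' s \<noteq> 0" "\<forall>s. cpoly q' s \<noteq> 0 \<longrightarrow> g s = cpoly p' s / cpoly q' s"
    using assms unfolding rat_fun_def by blast
  show ?thesis unfolding rat_fun_def
    by (rule exI[of _ "p * q' + p' * q"], rule exI[of _ "q * q'"]) (use * in \<open>auto simp: add_frac_eq\<close>)
qed

lemma rat_fun_mult:
  assumes "rat_fun X f" "rat_fun X g" shows "rat_fun X (\<lambda>s. f s * g s)"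
proof -
  obtain p q p' q' where *: "\<forall>s\<in>X. cpoly q s \<noteq> 0" "\<forall>s. cpoly q s \<noteq> 0 \<longrightarrow> f s = cpoly p s / cpoly q s"
    "\<forall>s\<in>X. cpoly q' s \<noteq> 0" "\<forall>s. cpoly q' s \<noteq> 0 \<longrightarrow> g s = cpoly p' s / cpoly q' s"
    using assms unfolding rat_fun_def by blast
  show ?thesis unfolding rat_fun_def
    by (rule exI[of _ "p * p'"], rule exI[of _ "q * q'"]) (use * in auto)
qed

text \<open>The numerator of \<open>g\<close> is put into the denominator, so that \<open>h\<close> is only constrained where
  \<open>g\<close> does not vanish.\<close>

lemma rat_fun_divide:
  assumes "rat_fun X f" "rat_fun X g" and g: "\<And>s. s \<in> X \<Longrightarrow> g s \<noteq> 0"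
    and h: "\<And>s. g s \<noteq> 0 \<Longrightarrow> h s = f s / g s"
  shows "rat_fun X h"
proof -
  obtain p q p' q' where *: "\<forall>s\<in>X. cpoly q s \<noteq> 0" "\<forall>s. cpoly q s \<noteq> 0 \<longrightarrow> f s = cpoly p s / cpoly q s"
    "\<forall>s\<in>X. cpoly q' s \<noteq> 0" "\<forall>s. cpoly q' s \<noteq> 0 \<longrightarrow> g s = cpoly p' s / cpoly q' s"
    using assms(1,2) unfolding rat_fun_def by blast
  have "cpoly p' s \<noteq> 0" if "s \<in> X" for s using g[OF that] * that by auto
  thus ?thesis unfolding rat_fun_def
    by (intro exI[of _ "p * q' * q'"] exI[of _ "q * p' * q'"]) (use * h in auto)
qed

lemma rat_fun_neg:
  assumes "rat_fun X f" and X: "\<And>s. s \<in> X \<Longrightarrow> - s \<in> X"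
  shows "rat_fun X (\<lambda>s. f (- s))"
proof -
  obtain p q where *: "\<forall>s\<in>X. cpoly q s \<noteq> 0" "\<forall>s. cpoly q s \<noteq> 0 \<longrightarrow> f s = cpoly p s / cpoly q s"
    using assms unfolding rat_fun_def by blast
  show ?thesis unfolding rat_fun_def
    by (intro exI[of _ "pcompose p [:0, -1:]"] exI[of _ "pcompose q [:0, -1:]"])
       (use * X in \<open>auto simp: cpoly_neg\<close>)
qed

lemma rat_fun_sum:
  "finite I \<Longrightarrow> (\<And>i. i \<in> I \<Longrightarrow> rat_fun X (f i)) \<Longrightarrow> rat_fun X (\<lambda>s. \<Sum>i\<in>I. f i s)"
  by (induction I rule: finite_induct) (use rat_fun_const[of X 0] in \<open>auto intro: rat_fun_add\<close>)

lemma rat_fun_prod: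
  "finite I \<Longrightarrow> (\<And>i. i \<in> I \<Longrightarrow> rat_fun X (f i)) \<Longrightarrow> rat_fun X (\<lambda>s. \<Prod>i\<in>I. f i s)"
  by (induction I rule: finite_induct) (use rat_fun_const[of X 1] in \<open>auto intro: rat_fun_mult\<close>)

lemma rat_fun_cnj:
  assumes "rat_fun X f" "s \<in> X" "cnj s \<in> X"
  shows "f (cnj s) = cnj (f s)"
  using assms unfolding rat_fun_def by (auto simp: cpoly_cnj)

lemma rat_fun_lap_rep:
  assumes f: "rat_fun (lap_region C) f" and b: "\<And>\<omega>. \<omega> \<ge> K \<Longrightarrow> norm (f (jw \<omega>)) \<le> B"
  shows "lap_rep C f"
proof -
  obtain p q where *: "\<forall>s\<in>lap_region C. cpoly q s \<noteq> 0" "\<forall>s. cpoly q s \<noteq> 0 \<longrightarrow> f s = cpoly p s / cpoly q s"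
    using f unfolding rat_fun_def by blast
  have "lap_rep C (\<lambda>s. poly (map_poly complex_of_real p) s / poly (map_poly complex_of_real q) s)"
  proof (rule lap_rep_bounded_rational[where K = K and B = B])
    show "poly (map_poly complex_of_real q) s \<noteq> 0" if "s \<in> lap_region C" for s
      using * that by (simp add: cpoly_def)
    show "norm (poly (map_poly complex_of_real p) (jw \<omega>) / poly (map_poly complex_of_real q) (jw \<omega>)) \<le> B"
      if "\<omega> \<ge> K" for \<omega>
    proof -
      have "jw \<omega> \<in> lap_region C" by (simp add: lap_region_def)
      thus ?thesis using b[OF that] * by (simp add: cpoly_def)
    qed
  qed
  thus ?thesis by (rule lap_rep_cong) (use * in \<open>auto simp: cpoly_def\<close>)
qed

lemma cnj_lap_region: "s \<in> lap_region C \<Longrightarrow> cnj s \<in> lap_region C"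
  by (simp add: lap_region_def)

lemma imaginary_lap_region [simp]: "jw \<omega> \<in> lap_region C"
  by (simp add: lap_region_def)

text \<open>The scalar representations have complex kernels. Conjugate symmetry of \<open>G\<close>
  means that averaging a kernel with its conjugate does not change the transform, so real parts
  serve as a real response.\<close>

lemma impulse_response_exists:
  fixes G :: "complex \<Rightarrow> complex^'m^'n"
  assumes r: "\<And>i j. lap_rep C (\<lambda>s. G s $ i $ j)"
    and sym: "\<And>i j s. s \<in> lap_region C \<Longrightarrow> G (cnj s) $ i $ j = cnj (G s $ i $ j)"
  shows "\<exists>D h. impulse_response G D h \<and> (\<forall>i j. (\<lambda>t. complex_of_real (h t $ i $ j)) \<in> lap_class C) \<and>
     (\<forall>i j. \<forall>s\<in>lap_region C. G s $ i $ j = complex_of_real (D $ i $ j) + lap (\<lambda>t. complex_of_real (h t $ i $ j)) s)"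
proof -
  obtain c h where h: "\<And>i j. h i j \<in> lap_class C"
     and G: "\<And>i j s. s \<in> lap_region C \<Longrightarrow> G s $ i $ j = c i j + lap (h i j) s"
    using r unfolding lap_rep_def by metis
  define D where "D = (\<chi> i j. Re (c i j))"
  define k where "k t = (\<chi> i j. Re (h i j t))" for t
  have kc: "complex_of_real (k t $ i $ j) = (1/2) * h i j t + (1/2) * cnj (h i j t)" for i j t
    by (simp add: k_def complex_eq_iff)
  have hc: "(\<lambda>t. cnj (h i j t)) \<in> lap_class C" for i j using h[of i j] by (simp add: lap_class_def)
  have kl: "(\<lambda>t. complex_of_real (k t $ i $ j)) \<in> lap_class C" for i j
    unfolding kc by (rule lap_class_lin(1)[OF h hc])
  have ki: "integrable lborel k"
  proof -
    have "integrable lborel (\<lambda>t. k t $ i $ j)" for i j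
      using kl[of i j] integrable_Re[of lborel "\<lambda>t. complex_of_real (k t $ i $ j)"] by (simp add: lap_class_def)
    thus ?thesis by (simp add: integrable_vec_iff)
  qed
  have eq: "G s $ i $ j = complex_of_real (D $ i $ j) + lap (\<lambda>t. complex_of_real (k t $ i $ j)) s"
    if s: "s \<in> lap_region C" for i j s
  proof -
    note s' = cnj_lap_region[OF s]
    have e: "lap (\<lambda>t. cnj (h i j t)) s = cnj (lap (h i j) (cnj s))"
      unfolding lap_def by (subst Bochner_Integration.integral_cnj[symmetric])
        (simp add: exp_cnj del: Bochner_Integration.integral_cnj)
    have "lap (\<lambda>t. complex_of_real (k t $ i $ j)) s = (1/2) * lap (h i j) s + (1/2) * cnj (lap (h i j) (cnj s))"
      unfolding kc e[symmetric] by (rule lap_class_lin(2)[OF h hc s])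
    moreover have "complex_of_real (D $ i $ j) = (1/2) * c i j + (1/2) * cnj (c i j)"
      by (simp add: D_def complex_eq_iff)
    moreover have "G s $ i $ j = (1/2) * (c i j + lap (h i j) s) + (1/2) * cnj (c i j + lap (h i j) (cnj s))"
      unfolding G[OF s, symmetric] G[OF s', symmetric] sym[OF s] complex_cnj_cnj by simp
    ultimately show ?thesis by (simp add: algebra_simps)
  qed
  have "impulse_response G D k" using ki eq[OF imaginary_lap_region]
    by (auto simp: impulse_response_def vec_eq_iff cmat_def fourier_nth)
  thus ?thesis using kl eq by blast
qed

section \<open>Stable transfer matrices\<close>

definition rat_mat :: "complex set \<Rightarrow> (complex \<Rightarrow> complex^'m^'n) \<Rightarrow> bool" where
  "rat_mat X G \<longleftrightarrow> (\<forall>i j. rat_fun X (\<lambda>s. G s $ i $ j))"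

lemma matrix_inv_det:
  fixes M :: "'a::field^'n^'n"
  assumes "det M \<noteq> 0"
  shows "M ** matrix_inv M = mat 1" "matrix_inv M ** M = mat 1"
proof -
  have "invertible M" using assms by (simp add: invertible_det_nz)
  hence "\<exists>N. M ** N = mat 1 \<and> N ** M = mat 1" unfolding invertible_def .
  from someI_ex[OF this] show "M ** matrix_inv M = mat 1" "matrix_inv M ** M = mat 1"
    unfolding matrix_inv_def by blast+
qed

lemma matrix_vector_axis: "((A :: 'a::semiring_1^'n^'m) *v axis j 1) $ i = A $ i $ j"
  by (simp add: matrix_vector_mult_def axis_def if_distrib cong: if_cong)

lemma mat_vector: "mat s *v v = (s :: 'a::semiring_1) *s v"
proof -
  have "(mat s *v v) $ i = (\<Sum>j\<in>UNIV. if i = j then s * v $ j else 0)" for i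
    unfolding matrix_vector_mult_def mat_def vec_lambda_beta by (intro sum.cong refl) simp
  thus ?thesis by (simp add: vec_eq_iff)
qed

lemma rat_mat_const: "rat_mat X (\<lambda>s. cmat M)"
  by (simp add: rat_mat_def cmat_def rat_fun_const)

lemma rat_fun_0: "rat_fun X (\<lambda>s. 0)"
  using rat_fun_const[of X 0] by simp

lemma rat_fun_1: "rat_fun X (\<lambda>s. 1)"
  using rat_fun_const[of X 1] by simp

lemma rat_mat_mat: assumes "rat_fun X f" shows "rat_mat X (\<lambda>s. mat (f s))"
  unfolding rat_mat_def
proof (intro allI)
  fix i j
  show "rat_fun X (\<lambda>s. mat (f s) $ i $ j)" using assms
    by (cases "i = j") (auto simp: mat_def rat_fun_0)
qed

lemma rat_mat_mult: "rat_mat X G \<Longrightarrow> rat_mat X H \<Longrightarrow> rat_mat X (\<lambda>s. G s ** H s)"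
  by (auto simp: rat_mat_def matrix_matrix_mult_def intro!: rat_fun_sum rat_fun_mult)

lemma rat_mat_add: "rat_mat X G \<Longrightarrow> rat_mat X H \<Longrightarrow> rat_mat X (\<lambda>s. G s + H s)"
  by (auto simp: rat_mat_def intro!: rat_fun_add)

lemma rat_mat_diff: "rat_mat X G \<Longrightarrow> rat_mat X H \<Longrightarrow> rat_mat X (\<lambda>s. G s - H s)"
  using rat_fun_add[of X _ "\<lambda>s. complex_of_real (-1) * _ s"] rat_fun_mult[OF rat_fun_const[of X "-1"]]
  by (fastforce simp: rat_mat_def)

lemma rat_mat_para_adj:
  assumes "rat_mat X G" "\<And>s. s \<in> X \<Longrightarrow> - s \<in> X"
  shows "rat_mat X (para_adj G)"
  using assms unfolding rat_mat_def para_adj_def transpose_def by (auto intro!: rat_fun_neg)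

lemma rat_fun_det:
  assumes "rat_mat X G" shows "rat_fun X (\<lambda>s. det (G s))"
proof -
  have "rat_fun X (\<lambda>s. complex_of_real (real_of_int (sign p)) * (\<Prod>i\<in>UNIV. G s $ i $ p i))" for p
    using assms by (intro rat_fun_mult rat_fun_const rat_fun_prod) (auto simp: rat_mat_def)
  thus ?thesis unfolding det_def by (intro rat_fun_sum) (auto simp: finite_permutations)
qed

text \<open>Cramer's rule applied to the columns of the inverse. It exhibits the entries as
  quotients of determinants, which keeps matrix inversion within the rational functions.\<close>

lemma matrix_inv_nth:
  fixes M :: "'a::field^'n^'n"
  assumes "det M \<noteq> 0"
  shows "matrix_inv M $ i $ j = det (\<chi> k l. if l = i then axis j 1 $ k else M $ k $ l) / det M"
proof -
  have "M ** matrix_inv M = mat 1" using assms by (rule matrix_inv_det)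
  hence "M *v (matrix_inv M *v axis j 1) = axis j 1" by (simp add: matrix_vector_mul_assoc)
  hence "matrix_inv M *v axis j 1 = (\<chi> k. det (\<chi> i l. if l = k then axis j 1 $ i else M $ i $ l) / det M)"
    using cramer[OF assms] by blast
  hence "(matrix_inv M *v axis j 1) $ i = det (\<chi> k l. if l = i then axis j 1 $ k else M $ k $ l) / det M"
    by simp
  thus ?thesis by (simp only: matrix_vector_axis)
qed

lemma rat_mat_inv:
  assumes G: "rat_mat X G" and d: "\<And>s. s \<in> X \<Longrightarrow> det (G s) \<noteq> 0"
  shows "rat_mat X (\<lambda>s. matrix_inv (G s))"
  unfolding rat_mat_def
proof (intro allI)
  fix i j
  have "rat_mat X (\<lambda>s. \<chi> k l. if l = i then axis j 1 $ k else G s $ k $ l)"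
    unfolding rat_mat_def
  proof (intro allI)
    fix k l
    show "rat_fun X (\<lambda>s. (\<chi> k l. if l = i then axis j 1 $ k else G s $ k $ l) $ k $ l)"
      using G by (cases "l = i"; cases "k = j") (auto simp: rat_mat_def axis_def rat_fun_0 rat_fun_1)
  qed
  from rat_fun_det[OF this] show "rat_fun X (\<lambda>s. matrix_inv (G s) $ i $ j)"
    by (rule rat_fun_divide[OF _ rat_fun_det[OF G]]) (use d matrix_inv_nth in blast)+
qed

lemma norm_vec_smult: "norm (c *s (x :: complex^'n)) = norm c * norm x"
  by (simp add: norm_vec_def L2_set_right_distrib norm_mult)

lemma det_resolvent_nz:
  assumes A: "stable_matrix A" and s: "Re s \<ge> 0"
  shows "det (mat s - cmat A) \<noteq> 0"
proof
  assume "det (mat s - cmat A) = 0"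
  hence "\<not> invertible (mat s - cmat A)" by (simp add: invertible_det_nz)
  then obtain v where v: "(mat s - cmat A) *v v = 0" "v \<noteq> 0"
    unfolding invertible_left_inverse matrix_left_invertible_ker by blast
  have "cmat A *v v = s *s v" using v by (simp add: matrix_vector_mult_diff_rdistrib mat_vector)
  hence "is_eigenvalue (cmat A) s" using v unfolding is_eigenvalue_def by blast
  thus False using A s unfolding stable_matrix_def by force
qed

text \<open>Properness is shown by an estimate: if \<open>x\<close> is a column of the resolvent,
  then \<open>norm s * norm x\<close> is at most \<open>1 + K * norm x\<close>, whence
  \<open>norm x\<close> is at most 1 as soon as \<open>norm s\<close> reaches
  \<open>K + 1\<close>.\<close>

lemma resolvent_lap_rep:
  fixes A :: "real^'n^'n"
  assumes A: "stable_matrix A"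
  shows "rat_mat (lap_region C) (\<lambda>s. matrix_inv (mat s - cmat A))"
    and "lap_rep C (\<lambda>s. matrix_inv (mat s - cmat A) $ i $ j)"
proof -
  have reg: "Re s \<ge> 0" if "s \<in> lap_region C" for s using that by (auto simp: lap_region_def)
  show r: "rat_mat (lap_region C) (\<lambda>s. matrix_inv (mat s - cmat A))"
    by (intro rat_mat_inv rat_mat_diff rat_mat_mat rat_mat_const rat_fun_id det_resolvent_nz A reg)
  obtain K where K: "K > 0" "\<And>x. norm (cmat A *v x) \<le> norm x * K"
    using bounded_linear.pos_bounded[OF matrix_vector_mul_bounded_linear[of "cmat A"]] by blast
  show "lap_rep C (\<lambda>s. matrix_inv (mat s - cmat A) $ i $ j)"
  proof (rule rat_fun_lap_rep[where K = "K + 1" and B = 1])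
    show "rat_fun (lap_region C) (\<lambda>s. matrix_inv (mat s - cmat A) $ i $ j)"
      using r by (simp add: rat_mat_def)
    fix \<omega> assume \<omega>: "\<omega> \<ge> K + 1"
    define s where "s = jw \<omega>"
    have ns: "norm s \<ge> K + 1" using \<omega> K by (simp add: s_def norm_mult)
    have "det (mat s - cmat A) \<noteq> 0" by (rule det_resolvent_nz[OF A]) (simp add: s_def)
    hence inv: "(mat s - cmat A) ** matrix_inv (mat s - cmat A) = mat 1"
      by (rule matrix_inv_det)
    define x where "x = matrix_inv (mat s - cmat A) *v axis j 1"
    have "(mat s - cmat A) *v x = axis j 1" unfolding x_def by (simp add: matrix_vector_mul_assoc inv)
    hence "s *s x = axis j 1 + cmat A *v x" by (simp add: matrix_vector_mult_diff_rdistrib mat_vector algebra_simps)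
    hence "norm s * norm x \<le> 1 + norm x * K"
      using norm_triangle_ineq[of "axis j (1::complex)" "cmat A *v x"] K(2)[of x] norm_vec_smult[of s x] by simp
    moreover have "(K + 1) * norm x \<le> norm s * norm x" by (intro mult_right_mono ns) auto
    ultimately have "norm x \<le> 1" by (simp add: algebra_simps)
    moreover have "x $ i = matrix_inv (mat s - cmat A) $ i $ j"
      by (simp only: x_def matrix_vector_axis)
    ultimately show "norm (matrix_inv (mat (jw \<omega>) - cmat A) $ i $ j) \<le> 1"
      using Finite_Cartesian_Product.norm_nth_le[of x i] unfolding s_def by simp
  qed
qed

section \<open>Impulse responses of stable systems\<close>

lemma lap_rep_sum:
  "finite I \<Longrightarrow> (\<And>i. i \<in> I \<Longrightarrow> lap_rep C (f i)) \<Longrightarrow> lap_rep C (\<lambda>s. \<Sum>i\<in>I. f i s)"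
  by (induction I rule: finite_induct) (auto intro: lap_rep_const lap_rep_add)

lemma transfer_matrix_rat:
  assumes A: "stable_matrix A"
  shows "rat_mat (lap_region C) (transfer_matrix A B E D)"
  unfolding transfer_matrix_def[abs_def]
  by (intro rat_mat_add rat_mat_mult rat_mat_const resolvent_lap_rep A)

lemma transfer_matrix_lap_rep:
  assumes A: "stable_matrix A"
  shows "lap_rep C (\<lambda>s. transfer_matrix A B E D s $ i $ j)"
  unfolding transfer_matrix_def matrix_matrix_mult_def
  by (simp, intro lap_rep_add lap_rep_sum lap_rep_mult lap_rep_const resolvent_lap_rep A) auto

lemma transfer_matrix_impulse_response:
  assumes A: "stable_matrix A"
  obtains D' h where "impulse_response (transfer_matrix A B E D) D' h"
    "\<And>i j. (\<lambda>t. complex_of_real (h t $ i $ j)) \<in> lap_class True"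
    "\<And>i j s. s \<in> lap_region True \<Longrightarrow> transfer_matrix A B E D s $ i $ j =
       complex_of_real (D' $ i $ j) + lap (\<lambda>t. complex_of_real (h t $ i $ j)) s"
proof -
  have "transfer_matrix A B E D (cnj s) $ i $ j = cnj (transfer_matrix A B E D s $ i $ j)"
    if "s \<in> lap_region True" for s i j
    using transfer_matrix_rat[OF A, of True B E D, unfolded rat_mat_def]
    by (intro rat_fun_cnj[OF _ that cnj_lap_region[OF that], of "\<lambda>s. transfer_matrix A B E D s $ i $ j"]) blast
  from impulse_response_exists[OF transfer_matrix_lap_rep[OF A] this] that show ?thesis by blast
qed

text \<open>The difference of two responses has a vanishing constant plus transform in each entry,
  so \<open>fourier_const_unique\<close> separates feedthrough from kernel.\<close>

lemma impulse_response_unique: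
  assumes "impulse_response G D h" "impulse_response G D' h'"
  shows "D = D'" "AE t in lborel. h t = h' t"
proof -
  have hi: "integrable lborel (\<lambda>t. complex_of_real (h t $ i $ j))"
    "integrable lborel (\<lambda>t. complex_of_real (h' t $ i $ j))" for i j
    using assms by (simp_all add: impulse_response_def integrable_vec_iff)
  have I: "integrable lborel (\<lambda>t. 1 * complex_of_real (h t $ i $ j) + (-1) * complex_of_real (h' t $ i $ j))" for i j
    using hi by (intro Bochner_Integration.integrable_add integrable_mult_right)
  have z: "complex_of_real (D $ i $ j - D' $ i $ j) +
      lap (\<lambda>t. 1 * complex_of_real (h t $ i $ j) + (-1) * complex_of_real (h' t $ i $ j)) (jw \<omega>) = 0" for i j \<omega>
  proof -
    have "cmat D + fourier h \<omega> = cmat D' + fourier h' \<omega>" using assms by (metis impulse_response_def)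
    hence "(cmat D + fourier h \<omega>) $ i $ j = (cmat D' + fourier h' \<omega>) $ i $ j" by simp
    thus ?thesis unfolding lap_lin[OF hi] by (simp add: cmat_def fourier_nth algebra_simps)
  qed
  show "D = D'" using fourier_const_unique(1)[OF I z] by (auto simp: vec_eq_iff)
  have "AE t in lborel. h t $ i $ j = h' t $ i $ j" for i j
    using fourier_const_unique(2)[OF I z] by eventually_elim (simp flip: of_real_diff)
  hence "AE t in lborel. \<forall>i\<in>UNIV. \<forall>j\<in>UNIV. h t $ i $ j = h' t $ i $ j"
    by (intro AE_finite_allI) auto
  thus "AE t in lborel. h t = h' t" by (auto simp: vec_eq_iff elim!: eventually_mono)
qed

text \<open>Frees \<open>lti_map\<close> from the choice operator: two kernels differ on a null set,
  which reflection and translation preserve and the integral ignores.\<close>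

lemma lti_map_eq:
  assumes ir: "impulse_response G D h" and u: "bounded_signal u"
  shows "lti_map G u t = (if t < 0 then 0 else D *v u t + (LINT \<sigma>|lborel. h (t - \<sigma>) *v u \<sigma>))"
proof -
  from ir obtain D' h' where ir': "impulse_response G D' h'"
    and l: "\<And>u t. lti_map G u t = (if t < 0 then 0 else D' *v u t + (LINT \<sigma>|lborel. h' (t - \<sigma>) *v u \<sigma>))"
    using lti_map_impulse_response[of G] by blast
  note un = impulse_response_unique[OF ir' ir]
  have h: "integrable lborel h" "integrable lborel h'" using ir ir' by (auto simp: impulse_response_def)
  have "AE \<sigma> in distr lborel borel (\<lambda>x. t + (-1) * x). h' \<sigma> = h \<sigma>"
  proof -
    have d: "distr lborel borel (\<lambda>x. t + (-1) * x) = lborel"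
      using lborel_real_affine[of "-1" t] by (simp add: density_1)
    show ?thesis unfolding d by (rule un(2))
  qed
  hence "AE \<sigma> in lborel. h' (t - \<sigma>) = h (t - \<sigma>)"
    by (subst (asm) AE_distr_iff) (use h in \<open>auto intro!: measurable_compose[of _ borel]\<close>)
  hence "(LINT \<sigma>|lborel. h' (t - \<sigma>) *v u \<sigma>) = (LINT \<sigma>|lborel. h (t - \<sigma>) *v u \<sigma>)"
    using integrable_kernel_mv(1)[OF h(1) u, of t] integrable_kernel_mv(1)[OF h(2) u, of t]
    by (intro integral_cong_AE) (auto elim: eventually_mono)
  thus ?thesis unfolding l un(1) by simp
qed

lemma lti_map_coord:
  assumes ir: "impulse_response G D h" and u: "bounded_signal u" and t: "t \<ge> 0"
  shows "coord (lti_map G u) i t = (\<Sum>k\<in>UNIV. complex_of_real (D $ i $ k) * coord u k t +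
      conv (\<lambda>t. complex_of_real (h t $ i $ k)) (coord u k) t)"
proof -
  have h: "integrable lborel h" using ir by (simp add: impulse_response_def)
  show ?thesis
    unfolding lti_map_eq[OF ir u] using t integrable_kernel_mv(2)[OF h u, of t i]
    by (simp add: matrix_vector_mult_def sum.distrib)
qed

section \<open>State equations\<close>

lemma matrix_vector_nth: "(M *v x) $ i = (\<Sum>j\<in>UNIV. M $ i $ j * x $ j)"
  by (simp add: matrix_vector_mult_def)

lemma lti_map_neg: "t < 0 \<Longrightarrow> lti_map G u t = 0"
  unfolding lti_map_def by (simp add: Let_def case_prod_unfold)

lemma bounded_signal_stable:
  assumes "stable_matrix M" "bounded_signal u"
  shows "bounded_signal (lti_map (transfer_matrix M B E D) u)"
  using lti_map_filter(1)[OF _ assms(2)] transfer_matrix_impulse_response[OF assms(1)] by metis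

lemma cmat_1 [simp]: "cmat (mat 1) = mat 1"
  by (simp add: cmat_def mat_def vec_eq_iff)

lemma cmat_0 [simp]: "cmat 0 = 0"
  by (simp add: cmat_def vec_eq_iff)

lemma transfer_matrix_output:
  "transfer_matrix M B E D s = cmat E ** transfer_matrix M B (mat 1) 0 s + cmat D"
  unfolding transfer_matrix_def by (simp add: matrix_mul_assoc)

text \<open>Reduces a general stable transfer matrix to the one from input to state, for which a
  state equation can be proved. The output equation acts directly on the impulse response.\<close>

lemma lti_map_output:
  fixes M :: "real^'n^'n" and B :: "real^'m^'n" and E :: "real^'n^'p" and D :: "real^'m^'p"
  assumes M: "stable_matrix M" and u: "bounded_signal u"
  shows "lti_map (transfer_matrix M B E D) u t = E *v lti_map (transfer_matrix M B (mat 1) 0) u t + D *v u t"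
proof (cases "t < 0")
  case True
  thus ?thesis using u by (simp add: lti_map_neg bounded_signal_def)
next
  case False
  obtain D0 h where ir: "impulse_response (transfer_matrix M B (mat 1) 0) D0 h"
    using transfer_matrix_impulse_response[OF M] by metis
  have h: "integrable lborel h" using ir by (simp add: impulse_response_def)
  have hij: "integrable lborel (\<lambda>t. h t $ i $ j)" for i j using h by (simp add: integrable_vec_iff)
  have ir': "impulse_response (transfer_matrix M B E D) (E ** D0 + D) (\<lambda>t. E ** h t)"
    unfolding impulse_response_def
  proof
    show "integrable lborel (\<lambda>t. E ** h t)"
      unfolding integrable_vec_iff matrix_matrix_mult_def using hij by auto
    show "\<forall>\<omega>. transfer_matrix M B E D (jw \<omega>) = cmat (E ** D0 + D) + fourier (\<lambda>t. E ** h t) \<omega>"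
    proof
      fix \<omega>
      have I: "integrable lborel (\<lambda>t. exp (- \<i> * complex_of_real (\<omega> * t)) * complex_of_real (h t $ k $ j))" for k j
        using integrable_exp_imaginary[of "\<lambda>t. complex_of_real (h t $ k $ j)" \<omega>] hij by (simp add: mult_ac)
      have "fourier (\<lambda>t. E ** h t) \<omega> $ i $ j = (cmat E ** fourier h \<omega>) $ i $ j" for i j
      proof -
        have "fourier (\<lambda>t. E ** h t) \<omega> $ i $ j = (LINT t|lborel. (\<Sum>k\<in>UNIV. complex_of_real (E $ i $ k) *
           (exp (- \<i> * complex_of_real (\<omega> * t)) * complex_of_real (h t $ k $ j))))"
          by (simp add: fourier_def matrix_matrix_mult_def sum_distrib_left mult_ac)
        also have "\<dots> = (\<Sum>k\<in>UNIV. complex_of_real (E $ i $ k) *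
           (LINT t|lborel. exp (- \<i> * complex_of_real (\<omega> * t)) * complex_of_real (h t $ k $ j)))"
          using I by (subst Bochner_Integration.integral_sum) auto
        finally show ?thesis by (simp add: fourier_def matrix_matrix_mult_def cmat_def)
      qed
      hence "fourier (\<lambda>t. E ** h t) \<omega> = cmat E ** fourier h \<omega>" by (simp add: vec_eq_iff)
      moreover have "cmat (E ** D0 + D) = cmat E ** cmat D0 + cmat D"
        by (simp add: cmat_def matrix_matrix_mult_def vec_eq_iff)
      moreover have "transfer_matrix M B (mat 1) 0 (jw \<omega>) = cmat D0 + fourier h \<omega>"
        using ir by (simp add: impulse_response_def)
      ultimately show "transfer_matrix M B E D (jw \<omega>) = cmat (E ** D0 + D) + fourier (\<lambda>t. E ** h t) \<omega>"
        unfolding transfer_matrix_output[of M B E D] by (simp add: matrix_add_ldistrib)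
    qed
  qed
  have "(LINT \<sigma>|lborel. (E ** h (t - \<sigma>)) *v u \<sigma>) = E *v (LINT \<sigma>|lborel. h (t - \<sigma>) *v u \<sigma>)"
    unfolding matrix_vector_mul_assoc[symmetric]
    by (rule integral_bounded_linear[OF matrix_vector_mul_bounded_linear integrable_kernel_mv(1)[OF h u]])
  thus ?thesis unfolding lti_map_eq[OF ir u] lti_map_eq[OF ir' u] using False
    by (simp add: matrix_vector_right_distrib matrix_vector_mult_add_rdistrib matrix_vector_mul_assoc)
qed

section \<open>Laplace transforms of filtered signals\<close>

lemma integrable_exp_bsig:
  assumes u: "bsig a" and n: "\<And>t. t < 0 \<Longrightarrow> a t = 0" and s: "Re s > 0"
  shows "integrable lborel (\<lambda>t. exp (- s * complex_of_real t) * a t)"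
proof -
  obtain A where A: "A \<ge> 0" "\<And>t. norm (a t) \<le> A" using u by (meson bsigE)
  have [measurable]: "a \<in> borel_measurable borel" using u by auto
  \<comment> \<open>The second summand dominates at the single time 0, which the open half-line
    leaves out.\<close>
  have "integrable lborel (\<lambda>t. A * (indicat_real {0<..} t * exp (- (t * Re s))) + norm (indicat_real {0..0} t *\<^sub>R a t))"
    using integrable_I0i_exp_mscale[OF s] integrable_bsig_interval[OF u, of 0 0]
    by (intro Bochner_Integration.integrable_add integrable_mult_right integrable_norm) (simp_all add: set_integrable_def)
  thus ?thesis
  proof (rule Bochner_Integration.integrable_bound)
    have "norm (exp (- s * complex_of_real t) * a t) \<le> norm (A * (indicat_real {0<..} t * exp (- (t * Re s))) + norm (indicat_real {0..0} t *\<^sub>R a t))" for t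
    proof -
      consider "t < 0" | "t = 0" | "t > 0" by linarith
      thus ?thesis
      proof cases
        case 3
        have "exp (- (Re s * t)) * norm (a t) \<le> exp (- (Re s * t)) * A" using A by (intro mult_left_mono) auto
        thus ?thesis using 3 A(1) by (simp add: norm_mult norm_exp_eq_Re mult.commute)
      qed (use n in auto)
    qed
    thus "AE t in lborel. norm (exp (- s * complex_of_real t) * a t) \<le> norm (A * (indicat_real {0<..} t * exp (- (t * Re s))) + norm (indicat_real {0..0} t *\<^sub>R a t))"
      by simp
  qed measurable
qed

lemma integrable_exp_signal:
  assumes u: "bounded_signal u" and s: "Re s > 0"
  shows "integrable lborel (\<lambda>t. exp (- s * complex_of_real t) * coord u k t)"
  by (rule integrable_exp_bsig[OF bsig_coord[OF u] _ s]) (use u in \<open>simp add: bounded_signal_def\<close>)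

lemma laplace_eq_lap:
  assumes u: "bounded_signal u"
  shows "laplace u s $ k = lap (coord u k) s"
proof -
  have "indicat_real {0..} t *\<^sub>R (exp (- s * complex_of_real t) * coord u k t) = exp (- s * complex_of_real t) * coord u k t" for t
    using u by (cases "t < 0") (auto simp: bounded_signal_def)
  thus ?thesis unfolding laplace_def lap_def set_lebesgue_integral_def by simp
qed

text \<open>Kernel and input are both causal, so the cut at time 0 changes nothing. The output is a
  convolution on the whole line, and the convolution theorem applies.\<close>

lemma laplace_lti_map:
  assumes M: "stable_matrix M" and u: "bounded_signal u" and s: "Re s > 0"
  shows "laplace (lti_map (transfer_matrix M B E D) u) s = transfer_matrix M B E D s *v laplace u s"
proof -
  define G where "G = transfer_matrix M B E D"
  obtain D0 h where ir: "impulse_response G D0 h"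
    and hl: "\<And>i j. (\<lambda>t. complex_of_real (h t $ i $ j)) \<in> lap_class True"
    and Gs: "\<And>i j s. s \<in> lap_region True \<Longrightarrow> G s $ i $ j = complex_of_real (D0 $ i $ j) + lap (\<lambda>t. complex_of_real (h t $ i $ j)) s"
    unfolding G_def using transfer_matrix_impulse_response[OF M] by metis
  have sr: "s \<in> lap_region True" using s by (simp add: lap_region_def)
  have by1: "bounded_signal (lti_map G u)" unfolding G_def by (rule bounded_signal_stable[OF M u])
  define H where "H i k t = complex_of_real (h t $ i $ k)" for i k t
  have uI: "integrable lborel (\<lambda>t. exp (- s * complex_of_real t) * coord u k t)" for k
    by (rule integrable_exp_signal[OF u s])
  have HI: "integrable lborel (\<lambda>t. exp (- s * complex_of_real t) * H i k t)" for i k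
    unfolding H_def by (rule lap_class_integrable[OF hl sr])
  have c: "coord (lti_map G u) i t = (\<Sum>k\<in>UNIV. complex_of_real (D0 $ i $ k) * coord u k t + conv (H i k) (coord u k) t)" for i t
  proof (cases "t < 0")
    case True
    hence "conv (H i k) (coord u k) t = 0" for k
      using u hl[of i k] by (intro conv_causal) (auto simp: lap_class_def bounded_signal_def H_def)
    thus ?thesis using True u by (simp add: lti_map_neg bounded_signal_def)
  next
    case False
    thus ?thesis using lti_map_coord[OF ir u, of t i] by (simp add: H_def[abs_def])
  qed
  have "laplace (lti_map G u) s $ i = (G s *v laplace u s) $ i" for i
  proof -
    have "laplace (lti_map G u) s $ i = (LINT t|lborel. (\<Sum>k\<in>UNIV. complex_of_real (D0 $ i $ k) * (exp (- s * complex_of_real t) * coord u k t)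
        + exp (- s * complex_of_real t) * conv (H i k) (coord u k) t))"
      unfolding laplace_eq_lap[OF by1] lap_def c by (simp add: sum_distrib_left algebra_simps)
    also have "\<dots> = (\<Sum>k\<in>UNIV. complex_of_real (D0 $ i $ k) * lap (coord u k) s + lap (conv (H i k) (coord u k)) s)"
      unfolding lap_def using uI lap_conv(1)[OF HI uI]
      by (subst Bochner_Integration.integral_sum) auto
    also have "\<dots> = (\<Sum>k\<in>UNIV. G s $ i $ k * lap (coord u k) s)"
      unfolding lap_conv(2)[OF HI uI] Gs[OF sr] by (simp add: H_def[abs_def] algebra_simps)
    finally show ?thesis by (simp add: matrix_vector_nth laplace_eq_lap[OF u])
  qed
  thus ?thesis by (simp add: vec_eq_iff G_def)
qed

section \<open>Convolution with kernels that are not integrable\<close>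

lemma conv_assoc:
  assumes f: "integrable lborel f" and g: "integrable lborel g" and a: "bsig a"
  shows "conv (conv f g) a t = conv f (conv g a) t"
proof -
  obtain A where A: "A \<ge> 0" "\<And>t. norm (a t) \<le> A" using a by (meson bsigE)
  have [measurable]: "a \<in> borel_measurable borel" "f \<in> borel_measurable borel" "g \<in> borel_measurable borel"
    using assms by auto
  have K: "integrable (lborel \<Otimes>\<^sub>M lborel) (\<lambda>(s, c). f s * g (c - s) * a (t - c))"
  proof (rule Bochner_Integration.integrable_bound[OF integrable_mult_left[OF integrable_norm[OF integrable_conv_kernel[OF f g]], of A]])
    show "AE x in lborel \<Otimes>\<^sub>M lborel. norm (case x of (s, c) \<Rightarrow> f s * g (c - s) * a (t - c)) \<le>
      norm (norm (case x of (s, t) \<Rightarrow> f s * g (t - s)) * A)"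
      using A by (auto simp: norm_mult intro!: AE_I2 mult_left_mono)
  qed measurable
  have "conv (conv f g) a t = (LINT c|lborel. LINT s|lborel. f s * g (c - s) * a (t - c))"
    unfolding conv_def by (simp flip: integral_mult_left_zero)
  also have "\<dots> = (LINT s|lborel. LINT c|lborel. f s * g (c - s) * a (t - c))"
    using K by (rule lborel_pair.Fubini_integral)
  also have "\<dots> = (LINT s|lborel. f s * (LINT b|lborel. g b * a (t - s - b)))"
  proof (rule Bochner_Integration.integral_cong[OF refl])
    fix s
    have "(LINT c|lborel. f s * g (c - s) * a (t - c)) = (LINT b|lborel. f s * (g b * a (t - s - b)))"
      using integral_shift(1)[of "\<lambda>c. f s * g (c - s) * a (t - c)" s, symmetric]
      by (simp add: mult.assoc diff_diff_eq add.commute[of s])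
    thus "(LINT c|lborel. f s * g (c - s) * a (t - c)) = f s * (LINT b|lborel. g b * a (t - s - b))" by simp
  qed
  finally show ?thesis unfolding conv_def .
qed

text \<open>Convolution with this function is integration from time 0, so an integral equation
  becomes an equation between convolutions.\<close>

definition step :: "real \<Rightarrow> complex" where "step t = complex_of_real (indicat_real {0<..} t)"

lemma lap_step: assumes "Re s > 0"
  shows "integrable lborel (\<lambda>t. exp (- s * complex_of_real t) * step t)" "lap step s = 1 / s"
proof -
  have "exp (- s * complex_of_real t) * step t = indicat_real {0<..} t *\<^sub>R exp (- s * complex_of_real t)" for t
    by (simp add: step_def indicator_def)
  thus "integrable lborel (\<lambda>t. exp (- s * complex_of_real t) * step t)" "lap step s = 1 / s"
    using exp_halfline[OF assms] by (simp_all add: lap_def)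
qed

lemma conv_step:
  assumes "\<And>t. t < 0 \<Longrightarrow> y t = 0"
  shows "conv step y t = (LINT s:{0..t}|lborel. y s)"
proof -
  have "conv step y t = (LINT s|lborel. step (t - s) * y s)"
    unfolding conv_def using integral_shift(3)[of "\<lambda>s. step s * y (t - s)" t] by simp
  also have "\<dots> = (LINT s|lborel. indicat_real {0..t} s *\<^sub>R y s)"
  \<comment> \<open>The step is 0 at 0 while the interval is closed, so the integrands differ at the
    endpoint \<open>t\<close> only.\<close>
  proof (rule integral_discrete_difference[of "{t}"])
    fix s :: real assume "s \<notin> {t}"
    thus "step (t - s) * y s = indicat_real {0..t} s *\<^sub>R y s"
      using assms[of s] by (auto simp: step_def indicator_def)
  qed auto
  finally show ?thesis by (simp add: set_lebesgue_integral_def)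
qed

text \<open>Weighting with \<open>e\<^sup>-\<^sup>t\<close> makes the step function integrable and leaves the bounded causal signals bounded.\<close>

definition wexp :: "(real \<Rightarrow> complex) \<Rightarrow> real \<Rightarrow> complex" where
  "wexp f t = exp (- 1 * complex_of_real t) * f t"

lemma wexp_conv: "wexp (conv f g) t = conv (wexp f) (wexp g) t"
  using exp_conv[of 1 t f g] by (simp add: wexp_def[abs_def])

lemma wexp_cancel: "wexp f t = wexp g t \<longleftrightarrow> f t = g t"
  by (simp add: wexp_def)

lemma lap_wexp: "lap (wexp f) s = lap f (1 + s)"
  unfolding lap_def wexp_def by (simp add: algebra_simps exp_add exp_diff exp_minus field_simps)

lemma bsig_wexp:
  assumes a: "bsig a" and n: "\<And>t. t < 0 \<Longrightarrow> a t = 0" shows "bsig (wexp a)"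
proof -
  obtain A where A: "A \<ge> 0" "\<And>t. norm (a t) \<le> A" using a by (meson bsigE)
  have "norm (wexp a t) \<le> A" for t
  proof (cases "t < 0")
    case True thus ?thesis using n A by (simp add: wexp_def)
  next
    case False
    hence "exp (- t) * norm (a t) \<le> 1 * A" using A by (intro mult_mono) auto
    thus ?thesis by (simp add: wexp_def norm_mult norm_exp_eq_Re)
  qed
  moreover have "wexp a \<in> borel_measurable borel" unfolding wexp_def using a by measurable
  ultimately show ?thesis by (rule bsigI[rotated])
qed

text \<open>The weight distributes over convolution and can be cancelled at each time, so the case
  of integrable kernels carries over.\<close>

lemma conv_assoc_causal:
  assumes "integrable lborel (wexp f)" "integrable lborel (wexp g)" "bsig a" "\<And>t. t < 0 \<Longrightarrow> a t = 0"
  shows "conv (conv f g) a t = conv f (conv g a) t"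
proof -
  have e: "wexp (conv f' g') = conv (wexp f') (wexp g')" for f' g' by (rule ext) (rule wexp_conv)
  have "wexp (conv (conv f g) a) t = wexp (conv f (conv g a)) t"
    unfolding e using conv_assoc[OF assms(1,2) bsig_wexp[OF assms(3,4)]] by simp
  thus ?thesis by (simp only: wexp_cancel)
qed

text \<open>The weights at \<open>s\<close> and at \<open>t - s\<close> multiply to the weight at
  \<open>t\<close>. For fixed \<open>t\<close> the integrand is thus a constant multiple of a
  weighted one.\<close>

lemma integrable_causal_kernel:
  assumes f: "integrable lborel (wexp f)" and a: "bsig a" "\<And>t. t < 0 \<Longrightarrow> a t = 0"
  shows "integrable lborel (\<lambda>s. f s * a (t - s))"
proof -
  obtain A where A: "\<And>t. norm (wexp a t) \<le> A" using bsig_wexp[OF a] by (meson bsigE)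
  have "integrable lborel (\<lambda>s. exp (1 * complex_of_real t) * (wexp f s * wexp a (t - s)))"
    by (intro integrable_mult_right norm_conv_le(1)[OF f bsig_wexp[OF a] A])
  moreover have "exp (1 * complex_of_real t) * (wexp f s * wexp a (t - s)) = f s * a (t - s)" for s
  proof -
    have "exp (complex_of_real t) * exp (- complex_of_real s) * exp (- complex_of_real (t - s)) = 1"
      unfolding exp_add[symmetric] by simp
    thus ?thesis unfolding wexp_def by (simp add: algebra_simps)
  qed
  ultimately show ?thesis by simp
qed

section \<open>From the resolvent equation to the state equation\<close>

lemma matrix_sub_rdistrib: "((A :: 'a::ring_1^'n^'m) - B) ** C = A ** C - B ** C"
  by (simp add: vec_eq_iff matrix_matrix_mult_def algebra_simps sum_subtractf)

lemma matrix_sub_ldistrib: "(C :: 'a::ring_1^'n^'m) ** (A - B) = C ** A - C ** B"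
  by (simp add: vec_eq_iff matrix_matrix_mult_def algebra_simps sum_subtractf)

lemma resolvent_equation:
  assumes M: "stable_matrix M" and s: "Re s \<ge> 0"
  shows "s * transfer_matrix M B (mat 1) 0 s $ i $ k =
    (\<Sum>j\<in>UNIV. complex_of_real (M $ i $ j) * transfer_matrix M B (mat 1) 0 s $ j $ k) + complex_of_real (B $ i $ k)"
proof -
  define G where "G = transfer_matrix M B (mat 1) 0 s"
  have G: "G = matrix_inv (mat s - cmat M) ** cmat B"
    unfolding G_def transfer_matrix_def by simp
  have "(mat s - cmat M) ** G = cmat B"
    unfolding G matrix_mul_assoc matrix_inv_det(1)[OF det_resolvent_nz[OF M s]] by simp
  hence "mat s ** G = cmat M ** G + cmat B" by (simp add: matrix_sub_rdistrib algebra_simps)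
  hence "(mat s ** G) $ i $ k = (cmat M ** G + cmat B) $ i $ k" by simp
  moreover have "(mat s ** G) $ i $ k = (\<Sum>j\<in>UNIV. if i = j then s * G $ j $ k else 0)"
    unfolding matrix_matrix_mult_def mat_def vec_lambda_beta by (intro sum.cong refl) simp
  ultimately show ?thesis by (simp add: G_def[symmetric] matrix_matrix_mult_def cmat_def)
qed

text \<open>Dividing the resolvent equation \<open>s G = M G + B\<close> by \<open>s\<close>
  suggests that, in the time domain, \<open>h\<close> equals \<open>B\<close> times the step plus
  \<open>M\<close> times the integral of \<open>h\<close>. Both sides have the same transform for
  \<open>Re s > 0\<close>, and Fourier uniqueness after weighting yields the equation together with
  \<open>D0 = 0\<close>.\<close>

lemma kernel_equation:
  assumes M: "stable_matrix M" and ir: "impulse_response (transfer_matrix M B (mat 1) 0) D0 h"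
    and hl: "\<And>i j. (\<lambda>t. complex_of_real (h t $ i $ j)) \<in> lap_class True"
    and Gs: "\<forall>i j. \<forall>s\<in>lap_region True. transfer_matrix M B (mat 1) 0 s $ i $ j =
       complex_of_real (D0 $ i $ j) + lap (\<lambda>t. complex_of_real (h t $ i $ j)) s"
  shows "D0 = 0"
    and "AE t in lborel. complex_of_real (h t $ i $ k) = complex_of_real (B $ i $ k) * step t +
      (\<Sum>j\<in>UNIV. complex_of_real (M $ i $ j) * conv step (\<lambda>t. complex_of_real (h t $ j $ k)) t)"
proof -
  define H where "H i k t = complex_of_real (h t $ i $ k)" for i k t
  \<comment> \<open>\<open>D0\<close> is not yet known to vanish, so its contribution through
    \<open>M\<close> is carried along with \<open>B\<close>.\<close>
  define b where "b i k = complex_of_real (B $ i $ k) + (\<Sum>j\<in>UNIV. complex_of_real (M $ i $ j) * complex_of_real (D0 $ j $ k))" for i k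
  define F where "F i k t = H i k t - (b i k * step t + (\<Sum>j\<in>UNIV. complex_of_real (M $ i $ j) * conv step (H j k) t))" for i k t
  have reg: "s \<in> lap_region True" if "Re s > 0" for s using that by (simp add: lap_region_def)
  have HI: "integrable lborel (\<lambda>t. exp (- s * complex_of_real t) * H i k t)" if "Re s > 0" for i k s
    unfolding H_def by (rule lap_class_integrable[OF hl reg[OF that]])
  note SI = lap_step and CI = lap_conv[OF lap_step(1) HI]
  have FI: "integrable lborel (\<lambda>t. exp (- s * complex_of_real t) * F i k t)"
   and Fl: "lap (F i k) s = lap (H i k) s - (b i k / s + (\<Sum>j\<in>UNIV. complex_of_real (M $ i $ j) * (1 / s * lap (H j k) s)))"
     if s: "Re s > 0" for s i k
  proof -
    have e: "exp (- s * complex_of_real t) * F i k t = exp (- s * complex_of_real t) * H i k t -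
       (b i k * (exp (- s * complex_of_real t) * step t) +
       (\<Sum>j\<in>UNIV. complex_of_real (M $ i $ j) * (exp (- s * complex_of_real t) * conv step (H j k) t)))" for t
      unfolding F_def by (simp add: algebra_simps sum_distrib_left)
    note I = HI[OF s] SI(1)[OF s] CI(1)[OF s s]
    have I1: "integrable lborel (\<lambda>t. \<Sum>j\<in>UNIV. complex_of_real (M $ i $ j) * (exp (- s * complex_of_real t) * conv step (H j k) t))"
      by (intro Bochner_Integration.integrable_sum integrable_mult_right I)
    have I2: "integrable lborel (\<lambda>t. b i k * (exp (- s * complex_of_real t) * step t))"
      by (intro integrable_mult_right I)
    have I3: "integrable lborel (\<lambda>t. b i k * (exp (- s * complex_of_real t) * step t) +
       (\<Sum>j\<in>UNIV. complex_of_real (M $ i $ j) * (exp (- s * complex_of_real t) * conv step (H j k) t)))"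
      by (intro Bochner_Integration.integrable_add I1 I2)
    show "integrable lborel (\<lambda>t. exp (- s * complex_of_real t) * F i k t)"
      unfolding e by (intro Bochner_Integration.integrable_diff I(1) I3)
    have "lap (F i k) s = lap (H i k) s - (b i k * lap step s + (\<Sum>j\<in>UNIV. complex_of_real (M $ i $ j) * lap (conv step (H j k)) s))"
      unfolding lap_def e Bochner_Integration.integral_diff[OF I(1) I3] Bochner_Integration.integral_add[OF I2 I1]
      by (subst Bochner_Integration.integral_sum) (use I in auto)
    thus "lap (F i k) s = lap (H i k) s - (b i k / s + (\<Sum>j\<in>UNIV. complex_of_real (M $ i $ j) * (1 / s * lap (H j k) s)))"
      by (simp only: CI(2)[OF s s] SI(2)[OF s]) simp
  qed
  have z: "complex_of_real (D0 $ i $ k) + lap (F i k) s = 0" if s: "Re s > 0" for s i k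
  proof -
    have s0: "s \<noteq> 0" using s by auto
    define G where "G j = complex_of_real (D0 $ j $ k) + lap (H j k) s" for j
    have G: "transfer_matrix M B (mat 1) 0 s $ j $ k = G j" for j
      using Gs reg[OF s] unfolding G_def H_def[abs_def] by blast
    have "s * G i = (\<Sum>j\<in>UNIV. complex_of_real (M $ i $ j) * G j) + complex_of_real (B $ i $ k)"
      using resolvent_equation[OF M, of s B i k] s unfolding G by simp
    hence "G i = ((\<Sum>j\<in>UNIV. complex_of_real (M $ i $ j) * G j) + complex_of_real (B $ i $ k)) / s"
      using s0 by (simp add: field_simps)
    moreover have "(\<Sum>j\<in>UNIV. complex_of_real (M $ i $ j) * G j) = (\<Sum>j\<in>UNIV. complex_of_real (M $ i $ j) * complex_of_real (D0 $ j $ k))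
       + (\<Sum>j\<in>UNIV. complex_of_real (M $ i $ j) * lap (H j k) s)"
      by (simp add: G_def distrib_left sum.distrib)
    ultimately have "G i = b i k / s + (\<Sum>j\<in>UNIV. complex_of_real (M $ i $ j) * (1 / s * lap (H j k) s))"
      by (simp add: b_def add_divide_distrib sum_divide_distrib)
    thus ?thesis unfolding Fl[OF s] G_def by (simp add: algebra_simps)
  qed
  \<comment> \<open>The weighting moves the identity from the line \<open>Re s = 1\<close> to the
    imaginary axis, where uniqueness is available.\<close>
  have z': "complex_of_real (D0 $ i $ k) + lap (wexp (F i k)) (jw \<omega>) = 0" for i k \<omega>
    unfolding lap_wexp by (rule z) simp
  have wI: "integrable lborel (wexp (F i k))" for i k
    unfolding wexp_def[abs_def] by (rule FI) simp
  have D0: "D0 $ i $ k = 0" for i k using fourier_const_unique(1)[OF wI z', of i k] by simp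
  thus "D0 = 0" by (simp add: vec_eq_iff)
  show "AE t in lborel. complex_of_real (h t $ i $ k) = complex_of_real (B $ i $ k) * step t +
      (\<Sum>j\<in>UNIV. complex_of_real (M $ i $ j) * conv step (\<lambda>t. complex_of_real (h t $ j $ k)) t)"
    using fourier_const_unique(2)[OF wI z', of i k]
    by eventually_elim (simp add: wexp_def F_def H_def[abs_def] b_def D0)
qed

text \<open>The kernel equation is convolved with \<open>u\<close>. By associativity the integral of
  the kernel applied to \<open>u\<close> becomes the integral of the state, which is the integrated
  state equation.\<close>

lemma state_of_lti_map:
  fixes M :: "real^'n^'n" and B :: "real^'m^'n"
  assumes M: "stable_matrix M" and u: "bounded_signal u"
  shows "state_of (\<lambda>t. M *v lti_map (transfer_matrix M B (mat 1) 0) u t + B *v u t)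
     (lti_map (transfer_matrix M B (mat 1) 0) u)"
proof -
  define x where "x = lti_map (transfer_matrix M B (mat 1) 0) u"
  obtain D0 h where ir: "impulse_response (transfer_matrix M B (mat 1) 0) D0 h"
    and hl: "\<And>i j. (\<lambda>t. complex_of_real (h t $ i $ j)) \<in> lap_class True"
    and Gs: "\<And>i j s. s \<in> lap_region True \<Longrightarrow> transfer_matrix M B (mat 1) 0 s $ i $ j = complex_of_real (D0 $ i $ j) + lap (\<lambda>t. complex_of_real (h t $ i $ j)) s"
    using transfer_matrix_impulse_response[OF M] by metis
  have "\<forall>i j. \<forall>s\<in>lap_region True. transfer_matrix M B (mat 1) 0 s $ i $ j =
      complex_of_real (D0 $ i $ j) + lap (\<lambda>t. complex_of_real (h t $ i $ j)) s"
    using Gs by blast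
  note ke = kernel_equation[OF M ir hl this]
  have bx: "bounded_signal x" unfolding x_def by (rule bounded_signal_stable[OF M u])
  define H where "H i k t = complex_of_real (h t $ i $ k)" for i k t
  have Hi: "integrable lborel (H i k)" for i k using hl[of i k] by (simp add: lap_class_def H_def[abs_def])
  have [measurable]: "H i k \<in> borel_measurable borel" for i k using Hi[of i k] by auto
  have [measurable]: "step \<in> borel_measurable borel" unfolding step_def by measurable
  have [measurable]: "coord u k \<in> borel_measurable borel" for k using bsig_coord[OF u] by auto
  have un: "coord u k t = 0" if "t < 0" for k t using u that by (simp add: bounded_signal_def)
  have one: "1 \<in> lap_region True" by (simp add: lap_region_def)
  have wH: "integrable lborel (wexp (H i k))" for i k
    unfolding wexp_def H_def by (rule lap_class_integrable[OF hl one])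
  have wS: "integrable lborel (wexp step)"
    unfolding wexp_def by (rule lap_step(1)) simp
  have wC: "integrable lborel (wexp (conv step (H j k)))" for j k
    using integrable_conv[OF wS wH[of j k]] unfolding wexp_conv[symmetric] by simp
  define y where "y i t = (\<Sum>k\<in>UNIV. conv (H i k) (coord u k) t)" for i t
  have cn: "conv (H i k) (coord u k) t = 0" if "t < 0" for i k t
    using un that hl[of i k] by (intro conv_causal) (auto simp: lap_class_def H_def)
  have yn: "y i t = 0" if "t < 0" for i t
    using cn[OF that] by (simp add: y_def)
  have xy: "coord x i t = y i t" for i t
  proof (cases "t < 0")
    case True thus ?thesis using yn by (simp add: x_def lti_map_neg)
  next
    case False
    thus ?thesis unfolding x_def using lti_map_coord[OF ir u, of t i] ke(1) by (simp add: y_def H_def[abs_def])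
  qed
  have yb: "bsig (y i)" for i
    unfolding y_def[abs_def] by (intro bsig_sum bsig_conv Hi bsig_coord u) auto
  have eq: "y i t = (\<Sum>k\<in>UNIV. complex_of_real (B $ i $ k) * conv step (coord u k) t) +
      (\<Sum>j\<in>UNIV. complex_of_real (M $ i $ j) * conv step (y j) t)" for i t
  proof -
    have c: "conv (H i k) (coord u k) t = complex_of_real (B $ i $ k) * conv step (coord u k) t +
        (\<Sum>j\<in>UNIV. complex_of_real (M $ i $ j) * conv step (conv (H j k) (coord u k)) t)" for k
    proof -
      have "conv (H i k) (coord u k) t = (LINT s|lborel. complex_of_real (B $ i $ k) * (step s * coord u k (t - s)) +
          (\<Sum>j\<in>UNIV. complex_of_real (M $ i $ j) * (conv step (H j k) s * coord u k (t - s))))"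
        unfolding conv_def[of "H i k"]
      proof (rule integral_cong_AE)
        show "AE s in lborel. H i k s * coord u k (t - s) = complex_of_real (B $ i $ k) * (step s * coord u k (t - s)) +
          (\<Sum>j\<in>UNIV. complex_of_real (M $ i $ j) * (conv step (H j k) s * coord u k (t - s)))"
          using ke(2)[of i k] unfolding H_def[symmetric, abs_def]
          by eventually_elim (simp add: H_def[abs_def] algebra_simps sum_distrib_left sum_distrib_right)
      qed measurable
      also have "\<dots> = complex_of_real (B $ i $ k) * conv step (coord u k) t +
          (\<Sum>j\<in>UNIV. complex_of_real (M $ i $ j) * conv (conv step (H j k)) (coord u k) t)"
        using integrable_causal_kernel[OF wS bsig_coord[OF u, of k] un]
          integrable_causal_kernel[OF wC bsig_coord[OF u, of k] un]
        unfolding conv_def[of _ "coord u k"]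
        by (subst Bochner_Integration.integral_add)
           (auto simp: Bochner_Integration.integral_sum intro!: Bochner_Integration.integrable_sum)
      finally show ?thesis
        by (simp only: conv_assoc_causal[OF wS wH bsig_coord[OF u] un])
    qed
    have s: "conv step (y j) t = (\<Sum>k\<in>UNIV. conv step (conv (H j k) (coord u k)) t)" for j
    proof -
      have I: "integrable lborel (\<lambda>s. step s * conv (H j k) (coord u k) (t - s))" for k
        by (rule integrable_causal_kernel[OF wS bsig_conv[OF Hi bsig_coord[OF u]] cn])
      show ?thesis unfolding conv_def[of step] y_def sum_distrib_left
        by (rule Bochner_Integration.integral_sum) (rule I)
    qed
    show ?thesis
      unfolding s unfolding y_def c sum.distrib sum_distrib_left
      by (intro arg_cong2[where f = "(+)"] refl sum.swap)
  qed
  define g where "g t = M *v x t + B *v u t" for t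
  have bu: "bsig (coord g i)" for i
  proof -
    have "coord g i = (\<lambda>t. (\<Sum>j\<in>UNIV. complex_of_real (M $ i $ j) * coord x j t) + (\<Sum>k\<in>UNIV. complex_of_real (B $ i $ k) * coord u k t))"
      by (rule ext) (simp add: g_def matrix_vector_nth)
    thus ?thesis by (simp only:) (intro bsig_add bsig_sum bsig_cmult bsig_coord bx u finite)
  qed
  have gI: "set_integrable lborel {0..t} g" for t
    unfolding set_integrable_def integrable_vec_iff
    using integrable_Re[OF integrable_bsig_interval[OF bu]] by auto
  have "complex_of_real ((LINT s:{0..t}|lborel. g s) $ i) = coord x i t" for i t
  proof -
    have gn: "coord g i s = 0" if "s < 0" for s
      using that u bx by (simp add: g_def bounded_signal_def)
    have "(LINT s:{0..t}|lborel. g s) $ i = (LINT s|lborel. indicat_real {0..t} s * g s $ i)"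
      using integral_vec_nth'[OF gI[of t, unfolded set_integrable_def], of i]
      unfolding set_lebesgue_integral_def by simp
    hence "complex_of_real ((LINT s:{0..t}|lborel. g s) $ i) =
        complex_of_real (LINT s|lborel. indicat_real {0..t} s * g s $ i)" by simp
    also have "\<dots> = (LINT s|lborel. complex_of_real (indicat_real {0..t} s * g s $ i))"
      by (rule integral_complex_of_real[symmetric])
    also have "\<dots> = (LINT s:{0..t}|lborel. coord g i s)"
      unfolding set_lebesgue_integral_def
      by (intro Bochner_Integration.integral_cong refl) (simp add: scaleR_conv_of_real)
    also have "\<dots> = conv step (coord g i) t" by (rule conv_step[symmetric]) (rule gn)
    also have "\<dots> = y i t"
    proof -
      have I1: "integrable lborel (\<lambda>s. step s * coord u k (t - s))" for k
        by (rule integrable_causal_kernel[OF wS bsig_coord[OF u] un])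
      have I2: "integrable lborel (\<lambda>s. step s * y j (t - s))" for j
        by (rule integrable_causal_kernel[OF wS yb yn])
      have "conv step (coord g i) t = (LINT s|lborel. (\<Sum>k\<in>UNIV. complex_of_real (B $ i $ k) * (step s * coord u k (t - s))) +
         (\<Sum>j\<in>UNIV. complex_of_real (M $ i $ j) * (step s * y j (t - s))))"
        unfolding conv_def xy[symmetric]
        by (simp add: g_def matrix_vector_nth sum_distrib_left algebra_simps)
      also have "\<dots> = (\<Sum>k\<in>UNIV. complex_of_real (B $ i $ k) * conv step (coord u k) t) +
         (\<Sum>j\<in>UNIV. complex_of_real (M $ i $ j) * conv step (y j) t)"
        unfolding conv_def[of step] using I1 I2
        by (subst Bochner_Integration.integral_add)
           (auto simp: Bochner_Integration.integral_sum intro!: Bochner_Integration.integrable_sum)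
      finally show ?thesis unfolding eq[of i t] .
    qed
    finally show ?thesis by (simp only: xy)
  qed
  hence "x t = (LINT s:{0..t}|lborel. g s)" for t by (simp add: vec_eq_iff)
  hence "(g has_integral x t) {0..t}" for t
    using set_borel_integral_eq_integral[OF gI[of t]] by (simp add: has_integral_integrable_integral)
  moreover have "\<forall>t<0. x t = 0" using bx by (simp add: bounded_signal_def)
  ultimately show ?thesis unfolding state_of_def g_def x_def by blast
qed

section \<open>Uniqueness of states\<close>

lemma state_of_diff:
  assumes "state_of f x" "state_of g y" shows "state_of (\<lambda>t. f t - g t) (\<lambda>t. x t - y t)"
  using assms by (auto simp: state_of_def intro!: has_integral_diff)

lemma state_of_add:
  assumes "state_of f x" "state_of g y" shows "state_of (\<lambda>t. f t + g t) (\<lambda>t. x t + y t)"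
  using assms by (auto simp: state_of_def intro!: has_integral_add)

text \<open>A Gronwall argument: since \<open>y \<bullet> (M *v y)\<close> is at most
  \<open>K * (y \<bullet> y)\<close>, the function \<open>\<phi>\<close>, which is
  \<open>y \<bullet> y\<close> damped by \<open>exp (- 2 * K * s)\<close>, is nonincreasing, and it
  starts at 0.\<close>

lemma state_of_homogeneous:
  fixes M :: "real^'n^'n"
  assumes y: "state_of (\<lambda>t. M *v y t) y"
  shows "y t = 0"
proof (cases "t < 0")
  case True thus ?thesis using y by (simp add: state_of_def)
next
  case False
  hence t: "t \<ge> 0" by simp
  obtain K where K: "K > 0" "\<And>x. norm (M *v x) \<le> norm x * K"
    using bounded_linear.pos_bounded[OF matrix_vector_mul_bounded_linear[of M]] by blast
  have hi: "((\<lambda>t. M *v y t) has_integral y s) {0..s}" if "s \<ge> 0" for s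
    using y that by (simp add: state_of_def)
  have yi: "y s = integral {0..s} (\<lambda>t. M *v y t)" if "s \<ge> 0" for s
    using hi[OF that] by (simp add: integral_unique)
  \<comment> \<open>States are given by an integral equation. Continuity of the state comes from the
    integral, and only then is the integrand continuous and the state differentiable.\<close>
  have cy: "continuous_on {0..t} y"
  proof -
    have "continuous_on {0..t} (\<lambda>s. integral {0..s} (\<lambda>t. M *v y t))"
      using hi[OF t] by (intro indefinite_integral_continuous_1) (auto simp: integrable_on_def)
    thus ?thesis by (rule continuous_on_eq) (use yi in auto)
  qed
  have cM: "continuous_on {0..t} (\<lambda>s. M *v y s)"
    using matrix_vector_mul_bounded_linear[of M] by (rule bounded_linear.continuous_on) (rule cy)
  have dy: "(y has_vector_derivative M *v y s) (at s within {0..t})" if "s \<in> {0..t}" for s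
  proof -
    have "((\<lambda>s. integral {0..s} (\<lambda>t. M *v y t)) has_vector_derivative M *v y s) (at s within {0..t})"
      using integral_has_vector_derivative[OF cM that] .
    thus ?thesis by (rule has_vector_derivative_transform[OF that, rotated]) (use yi in auto)
  qed
  define \<phi> where "\<phi> s = exp (- 2 * K * s) * (y s \<bullet> y s)" for s
  have d: "(\<phi> has_real_derivative exp (- 2 * K * s) * (2 * (y s \<bullet> (M *v y s)) - 2 * K * (y s \<bullet> y s))) (at s)"
    if "0 < s" "s < t" for s
  proof -
    have "(y has_vector_derivative M *v y s) (at s)"
      using dy[of s] that by (simp add: at_within_Icc_at)
    hence "((\<lambda>s. y s \<bullet> y s) has_real_derivative 2 * (y s \<bullet> (M *v y s))) (at s)"
      unfolding has_vector_derivative_def has_field_derivative_def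
      by (auto intro!: derivative_eq_intros simp: inner_commute algebra_simps fun_eq_iff)
    thus ?thesis unfolding \<phi>_def by (auto intro!: derivative_eq_intros simp: algebra_simps)
  qed
  have "\<phi> t \<le> \<phi> 0"
  proof (cases "t = 0")
    case False
    hence "0 < t" using t by simp
    thus ?thesis
    proof (rule DERIV_nonpos_imp_decreasing_open[OF less_imp_le])
      show "\<exists>y. (\<phi> has_real_derivative y) (at x) \<and> y \<le> 0" if "0 < x" "x < t" for x
      proof (intro exI conjI, rule d[OF that])
        have "y x \<bullet> (M *v y x) \<le> norm (y x) * (norm (y x) * K)"
          by (rule order_trans[OF norm_cauchy_schwarz]) (intro mult_left_mono K norm_ge_zero)
        also have "\<dots> = K * (y x \<bullet> y x)" by (simp add: dot_square_norm power2_eq_square)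
        finally show "exp (- 2 * K * x) * (2 * (y x \<bullet> (M *v y x)) - 2 * K * (y x \<bullet> y x)) \<le> 0"
          by (intro mult_nonneg_nonpos) auto
      qed
      show "continuous_on {0..t} \<phi>" unfolding \<phi>_def by (intro continuous_intros cy)
    qed
  qed simp
  moreover have "y 0 = 0" using yi[of 0] by simp
  ultimately have "exp (- 2 * K * t) * (y t \<bullet> y t) \<le> 0" by (simp add: \<phi>_def)
  hence "y t \<bullet> y t \<le> 0" by (simp add: mult_le_0_iff not_le)
  thus ?thesis by (metis inner_gt_zero_iff not_le)
qed

text \<open>Links the unspecified states of the closed loop to convolutions: any state differs from
  the convolution state by a solution of the homogeneous equation.\<close>

lemma stable_system:
  fixes M :: "real^'n^'n" and B :: "real^'m^'n"
  assumes M: "stable_matrix M" and u: "bounded_signal u" and x: "state_of (\<lambda>t. M *v x t + B *v u t) x"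
  shows "lti_map (transfer_matrix M B E D) u t = E *v x t + D *v u t"
proof -
  define x' where "x' = lti_map (transfer_matrix M B (mat 1) 0) u"
  have "state_of (\<lambda>t. M *v x t + B *v u t - (M *v x' t + B *v u t)) (\<lambda>t. x t - x' t)"
    by (rule state_of_diff[OF x]) (unfold x'_def, rule state_of_lti_map[OF M u])
  hence "state_of (\<lambda>t. M *v (x t - x' t)) (\<lambda>t. x t - x' t)"
    by (simp add: matrix_vector_mult_diff_distrib)
  from state_of_homogeneous[OF this, of t] have "x t = x' t" by simp
  thus ?thesis unfolding lti_map_output[OF M u, of B E D] by (simp add: x'_def)
qed

section \<open>Decomposition of the closed loop\<close>

definition bvec :: "'a^'m \<Rightarrow> 'a^'n \<Rightarrow> 'a^('m::finite + 'n::finite)" where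
  "bvec a b = (\<chi> k. case k of Inl i \<Rightarrow> a $ i | Inr j \<Rightarrow> b $ j)"

definition lpart :: "'a^('m::finite + 'n::finite) \<Rightarrow> 'a^'m" where "lpart v = (\<chi> i. v $ Inl i)"
definition rpart :: "'a^('m::finite + 'n::finite) \<Rightarrow> 'a^'n" where "rpart v = (\<chi> i. v $ Inr i)"

lemma part_bvec [simp]: "lpart (bvec a b) = a" "rpart (bvec a b) = b" "bvec (lpart v) (rpart v) = v"
  by (auto simp: lpart_def rpart_def bvec_def vec_eq_iff split: sum.split)

lemma block_row_vector: "block_row M N *v bvec a b = M *v a + N *v b"
  by (simp add: vec_eq_iff matrix_vector_mult_def block_row_def bvec_def UNIV_sum_type)

lemma block_col_vector: "block_col M N *v x = bvec (M *v x) (N *v x)"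
  by (simp add: vec_eq_iff matrix_vector_mult_def block_col_def bvec_def split: sum.split)

lemma block_mat_vector:
  "block_mat M11 M12 M21 M22 *v bvec a b = bvec (M11 *v a + M12 *v b) (M21 *v a + M22 *v b)"
  by (simp add: block_mat_def block_col_vector block_row_vector)

lemma bvec_add: "bvec a b + bvec c d = bvec (a + c) (b + d)"
  by (simp add: vec_eq_iff bvec_def split: sum.split)

lemma bounded_linear_lpart: "bounded_linear (lpart :: real^('m::finite + 'n::finite) \<Rightarrow> real^'m)"
  and bounded_linear_rpart: "bounded_linear (rpart :: real^('m::finite + 'n::finite) \<Rightarrow> real^'n)"
  by (auto intro!: linear_conv_bounded_linear[THEN iffD1] linearI simp: lpart_def rpart_def vec_eq_iff)

lemma bounded_linear_bvec:
  "bounded_linear (\<lambda>a. bvec a 0 :: real^('m::finite + 'n::finite))" "bounded_linear (\<lambda>b. bvec 0 b :: real^('m::finite + 'n::finite))"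
  by (auto intro!: linear_conv_bounded_linear[THEN iffD1] linearI simp: bvec_def vec_eq_iff split: sum.split)

lemma state_of_linear:
  assumes f: "bounded_linear f" and s: "state_of g x"
  shows "state_of (\<lambda>t. f (g t)) (\<lambda>t. f (x t))"
proof -
  interpret f: bounded_linear f by fact
  have "((\<lambda>t. f (g t)) has_integral f (x t)) {0..t}" if "(g has_integral x t) {0..t}" for t
    using has_integral_linear[OF that f] by (simp add: o_def)
  thus ?thesis using s by (simp add: state_of_def f.zero)
qed

lemma state_of_parts:
  assumes "state_of g x"
  shows "state_of (\<lambda>t. lpart (g t)) (\<lambda>t. lpart (x t))" "state_of (\<lambda>t. rpart (g t)) (\<lambda>t. rpart (x t))"
  using state_of_linear[OF bounded_linear_lpart assms] state_of_linear[OF bounded_linear_rpart assms] by auto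

lemma state_of_bvec:
  assumes "state_of f x" "state_of g y"
  shows "state_of (\<lambda>t. bvec (f t) (g t)) (\<lambda>t. bvec (x t) (y t))"
  using state_of_add[OF state_of_linear[OF bounded_linear_bvec(1) assms(1)] state_of_linear[OF bounded_linear_bvec(2) assms(2)]]
  by (simp add: bvec_add)

lemma state_of_cong: "state_of f x \<Longrightarrow> (\<And>t. f t = g t) \<Longrightarrow> (\<And>t. x t = y t) \<Longrightarrow> state_of g y"
proof -
  assume s: "state_of f x" and e: "\<And>t. f t = g t" "\<And>t. x t = y t"
  have "f = g" "x = y" using e by (auto intro: ext)
  thus "state_of g y" using s by simp
qed

lemma matrix_vector_minus: "(- M) *v x = - (M *v (x :: real^'n))" "M *v (- x) = - (M *v (x :: real^'n))"
  by (simp_all add: vec_eq_iff matrix_vector_mult_def sum_negf)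

lemmas mv_simps = matrix_vector_right_distrib matrix_vector_mult_diff_distrib matrix_vector_mult_add_rdistrib
  matrix_vector_mult_diff_rdistrib matrix_vector_mul_assoc[symmetric] matrix_vector_minus

text \<open>With \<open>e\<close> the observer error and \<open>xq = (q1, q2, q3)\<close>, the pair \<open>(q2 - e, q3)\<close> is the state of
  the loop of \<open>K\<close> driven by \<open>w\<close>, and \<open>(x - q2 + e, xc - q1)\<close> is the state of the loop of \<open>C\<close> driven
  by \<open>r\<close>.\<close>

lemma closed_loop_decomposition:
  fixes A :: "real^'n^'n" and B1 :: "real^'w^'n" and B2 :: "real^'u^'n"
    and C1 :: "real^'y^'z" and C2 :: "real^'n^'y" and D12 :: "real^'u^'z" and D21 :: "real^'w^'y"
    and Ac :: "real^'c^'c" and Bc :: "real^'y^'c" and Cc :: "real^'c^'u" and Dc :: "real^'y^'u"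
    and Ak :: "real^'k^'k" and Bk :: "real^'y^'k" and Ck :: "real^'k^'u" and Dk :: "real^'y^'u"
    and L :: "real^'y^'n" and Lc :: "real^'u^'c"
  assumes cl: "closed_loop A B1 B2 C1 C2 D12 D21 Ac Bc Cc Dc Ak Bk Ck Dk L Lc w r z"
  obtains xw xr where
    "state_of (\<lambda>t. block_mat (A + B2 ** Dk ** C2) (B2 ** Ck) (Bk ** C2) Ak *v xw t
       + block_col (B1 + B2 ** Dk ** D21) (Bk ** D21) *v w t) xw"
    "state_of (\<lambda>t. block_mat (A + B2 ** Dc ** C2) (B2 ** Cc) (Bc ** C2) Ac *v xr t
       + block_col (- (B2 ** Dc)) (- Bc) *v r t) xr"
    "\<And>t. z t = (block_row ((C1 + D12 ** Dk) ** C2) (D12 ** Ck) *v xw t + (D12 ** Dk ** D21) *v w t)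
       + (block_row ((C1 + D12 ** Dc) ** C2) (D12 ** Cc) *v xr t + (- (C1 + D12 ** Dc)) *v r t)"
proof -
  from cl obtain x xc xh xq u uc uq y f where
    x: "state_of (\<lambda>t. A *v x t + B1 *v w t + B2 *v u t) x"
    and z: "\<And>t. z t = C1 *v (C2 *v x t - r t) + D12 *v u t"
    and y: "\<And>t. y t = C2 *v x t + D21 *v w t"
    and xc: "state_of (\<lambda>t. (Ac + Lc ** Cc) *v xc t - Lc *v u t + (Bc + Lc ** Dc) *v (y t - r t)) xc"
    and uc: "\<And>t. uc t = Cc *v xc t + Dc *v (y t - r t)"
    and xh: "state_of (\<lambda>t. A *v xh t + B2 *v u t + L *v f t) xh"
    and f: "\<And>t. f t = C2 *v xh t - y t"
    and xq: "state_of (\<lambda>t. block_mat (Ac + Lc ** Cc)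
               (block_row ((Bc + Lc ** (Dc - Dk)) ** C2) (- (Lc ** Ck)))
               0
               (block_mat (A + B2 ** Dk ** C2) (B2 ** Ck) (Bk ** C2) Ak) *v xq t
             + block_col (- Bc - Lc ** (Dc - Dk)) (block_col (L - B2 ** Dk) (- Bk)) *v f t) xq"
    and uq: "\<And>t. uq t = block_row (- Cc) (block_row (- ((Dc - Dk) ** C2)) Ck) *v xq t + (Dc - Dk) *v f t"
    and u: "\<And>t. u t = uc t + uq t"
    unfolding closed_loop_def Let_def by blast
  define q1 q2 q3 where "q1 t = lpart (xq t)" and "q2 t = lpart (rpart (xq t))" and "q3 t = rpart (rpart (xq t))" for t
  have xq_eq: "xq t = bvec (q1 t) (bvec (q2 t) (q3 t))" for t
    by (simp add: q1_def q2_def q3_def)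
  note xq' = xq[unfolded xq_eq block_mat_vector block_row_vector block_col_vector bvec_add]
  have q1: "state_of (\<lambda>t. (Ac + Lc ** Cc) *v q1 t + (((Bc + Lc ** (Dc - Dk)) ** C2) *v q2 t + (- (Lc ** Ck)) *v q3 t)
      + (- Bc - Lc ** (Dc - Dk)) *v f t) q1"
    using state_of_parts(1)[OF xq'] by (simp add: bvec_add q1_def[symmetric] o_def)
  have q23: "state_of (\<lambda>t. bvec ((A + B2 ** Dk ** C2) *v q2 t + (B2 ** Ck) *v q3 t + (L - B2 ** Dk) *v f t)
      ((Bk ** C2) *v q2 t + Ak *v q3 t + (- Bk) *v f t)) (\<lambda>t. bvec (q2 t) (q3 t))"
    using state_of_parts(2)[OF xq'] by (simp add: bvec_add)
  have q2: "state_of (\<lambda>t. (A + B2 ** Dk ** C2) *v q2 t + (B2 ** Ck) *v q3 t + (L - B2 ** Dk) *v f t) q2"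
    and q3: "state_of (\<lambda>t. (Bk ** C2) *v q2 t + Ak *v q3 t + (- Bk) *v f t) q3"
    using state_of_parts[OF q23] by simp_all
  have ueq: "u t = Cc *v xc t + Dc *v (y t - r t) + (- (Cc *v q1 t) + (- ((Dc - Dk) *v (C2 *v q2 t)) + Ck *v q3 t)) + (Dc - Dk) *v f t" for t
    unfolding u uc uq xq_eq block_row_vector by (simp add: mv_simps)
  define e where "e t = xh t - x t" for t
  define p where "p t = q2 t - e t" for t
  define v where "v t = x t - p t" for t
  define d where "d t = xc t - q1 t" for t
  \<comment> \<open>The plant state enters the innovation only through the observer error, so
    neither \<open>u\<close> nor \<open>r\<close> drives the error.\<close>
  have feq: "f t = C2 *v e t - D21 *v w t" for t unfolding f y e_def by (simp add: mv_simps)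
  have e: "state_of (\<lambda>t. A *v e t + L *v f t - B1 *v w t) e"
    by (rule state_of_cong[OF state_of_diff[OF xh x]]) (simp_all add: e_def mv_simps)
  \<comment> \<open>The injection \<open>L *v f\<close> cancels between \<open>q2\<close> and
    \<open>e\<close>, and the remaining part of \<open>f\<close> turns \<open>q2\<close> into
    \<open>p\<close>.\<close>
  have p: "state_of (\<lambda>t. (A + B2 ** Dk ** C2) *v p t + (B2 ** Ck) *v q3 t + (B1 + B2 ** Dk ** D21) *v w t) p"
    by (rule state_of_cong[OF state_of_diff[OF q2 e]]) (simp_all add: p_def mv_simps feq algebra_simps)
  have q3': "state_of (\<lambda>t. (Bk ** C2) *v p t + Ak *v q3 t + (Bk ** D21) *v w t) q3"
    by (rule state_of_cong[OF q3]) (simp_all add: p_def mv_simps feq algebra_simps)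
  \<comment> \<open>The control splits into the law of \<open>K\<close> acting on the loop driven by
    \<open>w\<close> and the law of \<open>C\<close> acting on the loop driven by \<open>r\<close>.
    This is what decouples the two loops, and its first part produces the feedthrough from
    \<open>w\<close> to \<open>z\<close>.\<close>
  have vd: "u t = (Dk *v (C2 *v p t + D21 *v w t) + Ck *v q3 t) + (Cc *v d t + Dc *v (C2 *v v t - r t))" for t
    unfolding ueq feq y d_def v_def p_def by (simp add: mv_simps algebra_simps)
  have v: "state_of (\<lambda>t. (A + B2 ** Dc ** C2) *v v t + (B2 ** Cc) *v d t + (- (B2 ** Dc)) *v r t) v"
  proof (rule state_of_cong[OF state_of_diff[OF x p]])
    fix t
    show "A *v x t + B1 *v w t + B2 *v u t - ((A + B2 ** Dk ** C2) *v p t + (B2 ** Ck) *v q3 t + (B1 + B2 ** Dk ** D21) *v w t) =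
      (A + B2 ** Dc ** C2) *v v t + (B2 ** Cc) *v d t + (- (B2 ** Dc)) *v r t"
      unfolding vd v_def by (simp add: mv_simps algebra_simps)
  qed (simp add: v_def)
  \<comment> \<open>All terms with \<open>Lc\<close> cancel once \<open>u\<close> is expanded by
    \<open>ueq\<close>.\<close>
  have d: "state_of (\<lambda>t. (Bc ** C2) *v v t + Ac *v d t + (- Bc) *v r t) d"
  proof (rule state_of_cong[OF state_of_diff[OF xc q1]])
    fix t
    show "(Ac + Lc ** Cc) *v xc t - Lc *v u t + (Bc + Lc ** Dc) *v (y t - r t) -
      ((Ac + Lc ** Cc) *v q1 t + (((Bc + Lc ** (Dc - Dk)) ** C2) *v q2 t + (- (Lc ** Ck)) *v q3 t)
      + (- Bc - Lc ** (Dc - Dk)) *v f t) = (Bc ** C2) *v v t + Ac *v d t + (- Bc) *v r t"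
      unfolding ueq feq y d_def v_def p_def by (simp add: mv_simps algebra_simps)
  qed (simp add: d_def)
  show ?thesis
  proof (rule that)
    show "state_of (\<lambda>t. block_mat (A + B2 ** Dk ** C2) (B2 ** Ck) (Bk ** C2) Ak *v bvec (p t) (q3 t)
       + block_col (B1 + B2 ** Dk ** D21) (Bk ** D21) *v w t) (\<lambda>t. bvec (p t) (q3 t))"
      unfolding block_mat_vector block_col_vector bvec_add by (rule state_of_bvec[OF p q3'])
    show "state_of (\<lambda>t. block_mat (A + B2 ** Dc ** C2) (B2 ** Cc) (Bc ** C2) Ac *v bvec (v t) (d t)
       + block_col (- (B2 ** Dc)) (- Bc) *v r t) (\<lambda>t. bvec (v t) (d t))"
      unfolding block_mat_vector block_col_vector bvec_add by (rule state_of_bvec[OF v d])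
    show "z t = (block_row ((C1 + D12 ** Dk) ** C2) (D12 ** Ck) *v bvec (p t) (q3 t) + (D12 ** Dk ** D21) *v w t)
       + (block_row ((C1 + D12 ** Dc) ** C2) (D12 ** Cc) *v bvec (v t) (d t) + (- (C1 + D12 ** Dc)) *v r t)" for t
      unfolding z vd block_row_vector v_def by (simp add: mv_simps algebra_simps)
  qed
qed

section \<open>Existence of closed-loop trajectories\<close>

lemma bounded_signal_matrix: "bounded_signal u \<Longrightarrow> bounded_signal (\<lambda>t. M *v u t)"
  unfolding bounded_signal_iff
proof (safe, goal_cases)
  case (2 i)
  have "coord (\<lambda>t. M *v u t) i = (\<lambda>t. \<Sum>j\<in>UNIV. complex_of_real (M $ i $ j) * coord u j t)"
    by (rule ext) (simp add: matrix_vector_nth)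
  thus ?case using 2 by (simp only:) (intro bsig_sum bsig_cmult, auto)
qed auto

lemma bounded_signal_parts:
  "bounded_signal u \<Longrightarrow> bounded_signal (\<lambda>t. lpart (u t))" "bounded_signal u \<Longrightarrow> bounded_signal (\<lambda>t. rpart (u t))"
  by (auto simp: bounded_signal_iff lpart_def rpart_def vec_eq_iff)

lemma stable_state_exists:
  fixes M :: "real^'n^'n"
  assumes M: "stable_matrix M" and g: "bounded_signal g"
  obtains x where "bounded_signal x" "state_of (\<lambda>t. M *v x t + g t) x"
  using state_of_lti_map[OF M g, of "mat 1"]
  by (intro that[OF bounded_signal_stable[OF M g, of "mat 1" "mat 1" 0]]) simp

text \<open>Needed for attainment of the supremum, where the worst disturbance must belong to an
  actual trajectory. The decomposition is inverted: the loops of \<open>K\<close> and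
  \<open>C\<close>, the observer error and \<open>q1\<close> satisfy stable equations that can be
  solved successively, and all other states are assembled from them.\<close>

lemma closed_loop_exists:
  fixes A :: "real^'n^'n" and B1 :: "real^'w^'n" and B2 :: "real^'u^'n"
    and C1 :: "real^'y^'z" and C2 :: "real^'n^'y" and D12 :: "real^'u^'z" and D21 :: "real^'w^'y"
    and Ac :: "real^'c^'c" and Bc :: "real^'y^'c" and Cc :: "real^'c^'u" and Dc :: "real^'y^'u"
    and Ak :: "real^'k^'k" and Bk :: "real^'y^'k" and Ck :: "real^'k^'u" and Dk :: "real^'y^'u"
    and L :: "real^'y^'n" and Lc :: "real^'u^'c"
  assumes Cs: "stable_matrix (block_mat (A + B2 ** Dc ** C2) (B2 ** Cc) (Bc ** C2) Ac)"
    and Ks: "stable_matrix (block_mat (A + B2 ** Dk ** C2) (B2 ** Ck) (Bk ** C2) Ak)"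
    and L: "stable_matrix (A + L ** C2)" and Lc: "stable_matrix (Ac + Lc ** Cc)"
    and w: "bounded_signal w" and r: "bounded_signal r"
  shows "\<exists>z. closed_loop A B1 B2 C1 C2 D12 D21 Ac Bc Cc Dc Ak Bk Ck Dk L Lc w r z"
proof -
  obtain xw where xw: "bounded_signal xw"
    "state_of (\<lambda>t. block_mat (A + B2 ** Dk ** C2) (B2 ** Ck) (Bk ** C2) Ak *v xw t
       + block_col (B1 + B2 ** Dk ** D21) (Bk ** D21) *v w t) xw"
    using stable_state_exists[OF Ks bounded_signal_matrix[OF w]] .
  obtain xr where xr: "bounded_signal xr"
    "state_of (\<lambda>t. block_mat (A + B2 ** Dc ** C2) (B2 ** Cc) (Bc ** C2) Ac *v xr t
       + block_col (- (B2 ** Dc)) (- Bc) *v r t) xr"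
    using stable_state_exists[OF Cs bounded_signal_matrix[OF r]] .
  \<comment> \<open>The error equation with the innovation already eliminated; \<open>feq\<close>
    below shows that it is the intended one.\<close>
  obtain e where e: "bounded_signal e" "state_of (\<lambda>t. (A + L ** C2) *v e t + (- (L ** D21 + B1)) *v w t) e"
    using stable_state_exists[OF L bounded_signal_matrix[OF w]] .
  define p q3 v d where "p t = lpart (xw t)" and "q3 t = rpart (xw t)" and "v t = lpart (xr t)" and "d t = rpart (xr t)" for t
  have eqs: "xw t = bvec (p t) (q3 t)" "xr t = bvec (v t) (d t)" for t
    by (simp_all add: p_def q3_def v_def d_def)
  have b: "bounded_signal p" "bounded_signal q3"
    unfolding p_def[abs_def] q3_def[abs_def] by (intro bounded_signal_parts xw)+
  have xw': "state_of (\<lambda>t. bvec ((A + B2 ** Dk ** C2) *v p t + (B2 ** Ck) *v q3 t + (B1 + B2 ** Dk ** D21) *v w t)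
     ((Bk ** C2) *v p t + Ak *v q3 t + (Bk ** D21) *v w t)) (\<lambda>t. bvec (p t) (q3 t))"
    using xw(2) unfolding eqs block_mat_vector block_col_vector bvec_add by simp
  have xr': "state_of (\<lambda>t. bvec ((A + B2 ** Dc ** C2) *v v t + (B2 ** Cc) *v d t + (- (B2 ** Dc)) *v r t)
     ((Bc ** C2) *v v t + Ac *v d t + (- Bc) *v r t)) (\<lambda>t. bvec (v t) (d t))"
    using xr(2) unfolding eqs block_mat_vector block_col_vector bvec_add by simp
  note P = state_of_parts[OF xw', simplified] and R = state_of_parts[OF xr', simplified]
  obtain q1 where q1: "bounded_signal q1" "state_of (\<lambda>t. (Ac + Lc ** Cc) *v q1 t +
      (((Bc + Lc ** (Dc - Dk)) ** C2) *v p t + (((Bc + Lc ** (Dc - Dk)) ** D21) *v w t + (- (Lc ** Ck)) *v q3 t))) q1"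
    using stable_state_exists[OF Lc bounded_signal_add[OF bounded_signal_matrix[OF b(1)]
      bounded_signal_add[OF bounded_signal_matrix[OF w] bounded_signal_matrix[OF b(2)]]]] .
  define x where "x t = p t + v t" for t
  define xh where "xh t = x t + e t" for t
  define q2 where "q2 t = p t + e t" for t
  define xc where "xc t = d t + q1 t" for t
  define y where "y t = C2 *v x t + D21 *v w t" for t
  define f where "f t = C2 *v xh t - y t" for t
  define xq where "xq t = bvec (q1 t) (bvec (q2 t) (q3 t))" for t
  define uc where "uc t = Cc *v xc t + Dc *v (y t - r t)" for t
  define uq where "uq t = block_row (- Cc) (block_row (- ((Dc - Dk) ** C2)) Ck) *v xq t + (Dc - Dk) *v f t" for t
  define u where "u t = uc t + uq t" for t
  define z where "z t = C1 *v (C2 *v x t - r t) + D12 *v u t" for t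
  have feq: "f t = C2 *v e t - D21 *v w t" for t unfolding f_def y_def xh_def by (simp add: mv_simps)
  have ueq: "u t = (Dk *v (C2 *v p t + D21 *v w t) + Ck *v q3 t) + (Cc *v d t + Dc *v (C2 *v v t - r t))" for t
    unfolding u_def uc_def uq_def xq_def block_row_vector feq y_def xc_def x_def q2_def
    by (simp add: mv_simps algebra_simps)
  have sx: "state_of (\<lambda>t. A *v x t + B1 *v w t + B2 *v u t) x"
    by (rule state_of_cong[OF state_of_add[OF P(1) R(1)]]) (simp_all add: x_def ueq mv_simps algebra_simps)
  have sh: "state_of (\<lambda>t. A *v xh t + B2 *v u t + L *v f t) xh"
    by (rule state_of_cong[OF state_of_add[OF sx e(2)]]) (simp_all add: xh_def feq mv_simps algebra_simps)
  have sc: "state_of (\<lambda>t. (Ac + Lc ** Cc) *v xc t - Lc *v u t + (Bc + Lc ** Dc) *v (y t - r t)) xc"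
    by (rule state_of_cong[OF state_of_add[OF R(2) q1(2)]])
       (simp_all add: xc_def ueq y_def x_def mv_simps algebra_simps)
  have s2: "state_of (\<lambda>t. (A + B2 ** Dk ** C2) *v q2 t + (B2 ** Ck) *v q3 t + (L - B2 ** Dk) *v f t) q2"
    by (rule state_of_cong[OF state_of_add[OF P(1) e(2)]]) (simp_all add: q2_def feq mv_simps algebra_simps)
  have s3: "state_of (\<lambda>t. (Bk ** C2) *v q2 t + Ak *v q3 t + (- Bk) *v f t) q3"
    by (rule state_of_cong[OF P(2)]) (simp_all add: q2_def feq mv_simps algebra_simps)
  have s1: "state_of (\<lambda>t. (Ac + Lc ** Cc) *v q1 t + (((Bc + Lc ** (Dc - Dk)) ** C2) *v q2 t + (- (Lc ** Ck)) *v q3 t)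
      + (- Bc - Lc ** (Dc - Dk)) *v f t) q1"
    by (rule state_of_cong[OF q1(2)]) (simp_all add: q2_def feq mv_simps algebra_simps)
  have sq: "state_of (\<lambda>t. block_mat (Ac + Lc ** Cc)
               (block_row ((Bc + Lc ** (Dc - Dk)) ** C2) (- (Lc ** Ck)))
               0
               (block_mat (A + B2 ** Dk ** C2) (B2 ** Ck) (Bk ** C2) Ak) *v xq t
             + block_col (- Bc - Lc ** (Dc - Dk)) (block_col (L - B2 ** Dk) (- Bk)) *v f t) xq"
    unfolding xq_def block_mat_vector block_row_vector block_col_vector bvec_add
    by (rule state_of_cong[OF state_of_bvec[OF s1 state_of_bvec[OF s2 s3]]]) (simp_all add: bvec_add)
  show ?thesis
    unfolding closed_loop_def Let_def
    by (rule exI[of _ z], rule exI[of _ x], rule exI[of _ xc], rule exI[of _ xh], rule exI[of _ xq],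
        rule exI[of _ u], rule exI[of _ uc], rule exI[of _ uq], rule exI[of _ y], rule exI[of _ f])
       (use sx sc sh sq in \<open>auto simp: z_def y_def uc_def uq_def f_def u_def\<close>)
qed

section \<open>Singular values and positive semidefinite matrices\<close>

definition hdot :: "complex^'n \<Rightarrow> complex^'n \<Rightarrow> complex" where
  "hdot x y = (\<Sum>i\<in>UNIV. x $ i * cnj (y $ i))"

lemma hdot_self: "hdot x x = complex_of_real ((norm x)\<^sup>2)"
  by (simp add: hdot_def power2_norm_eq_inner inner_vec_def complex_mult_cnj cmod_power2[symmetric])

lemma hdot_add: "hdot (x + y) z = hdot x z + hdot y z" "hdot z (x + y) = hdot z x + hdot z y"
  by (simp_all add: hdot_def algebra_simps sum.distrib)

lemma hdot_diff: "hdot (x - y) z = hdot x z - hdot y z" "hdot z (x - y) = hdot z x - hdot z y"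
  by (simp_all add: hdot_def algebra_simps sum_subtractf)

lemma hdot_smult: "hdot (c *s x) z = c * hdot x z" "hdot z (c *s x) = cnj c * hdot z x"
  by (simp_all add: hdot_def sum_distrib_left mult_ac)

lemma hdot_adjoint: "hdot (M *v x) y = hdot x (conj_transpose M *v y)"
proof -
  have "hdot (M *v x) y = (\<Sum>i\<in>UNIV. \<Sum>j\<in>UNIV. M $ i $ j * x $ j * cnj (y $ i))"
    by (simp add: hdot_def matrix_vector_mult_def sum_distrib_right)
  also have "\<dots> = (\<Sum>j\<in>UNIV. \<Sum>i\<in>UNIV. M $ i $ j * x $ j * cnj (y $ i))" by (rule sum.swap)
  also have "\<dots> = hdot x (conj_transpose M *v y)"
    by (simp add: hdot_def matrix_vector_mult_def conj_transpose_def sum_distrib_left mult_ac)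
  finally show ?thesis .
qed

lemma hdot_commute: "hdot y x = cnj (hdot x y)"
  by (simp add: hdot_def mult.commute)

lemma norm_hdot_le: "norm (hdot x y) \<le> norm x * norm y"
proof -
  have "norm (hdot x y) \<le> (\<Sum>i\<in>UNIV. \<bar>norm (x $ i)\<bar> * \<bar>norm (y $ i)\<bar>)"
    unfolding hdot_def by (rule order_trans[OF norm_sum]) (simp add: norm_mult)
  also have "\<dots> \<le> norm x * norm y" unfolding norm_vec_def by (rule L2_set_mult_ineq)
  finally show ?thesis .
qed

lemma conj_transpose_involution [simp]: "conj_transpose (conj_transpose M) = M"
  by (simp add: conj_transpose_def vec_eq_iff)

lemma conj_transpose_mult: "conj_transpose (A ** B) = conj_transpose B ** conj_transpose A"
  by (simp add: conj_transpose_def matrix_matrix_mult_def vec_eq_iff mult.commute)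

lemma conj_transpose_add: "conj_transpose (A + B) = conj_transpose A + conj_transpose B"
  by (simp add: conj_transpose_def vec_eq_iff)

lemma conj_transpose_diff: "conj_transpose (A - B) = conj_transpose A - conj_transpose B"
  by (simp add: conj_transpose_def vec_eq_iff)

text \<open>A maximizer of \<open>|M x|\<close> on the unit sphere is an eigenvector of \<open>M\<^sup>* M\<close>.\<close>

lemma largest_singular_value_exists:
  fixes M :: "complex^'m^'n"
  obtains \<sigma> where "\<sigma> \<ge> 0" "is_eigenvalue (conj_transpose M ** M) (complex_of_real (\<sigma>\<^sup>2))"
    "\<And>x. norm (M *v x) \<le> \<sigma> * norm x"
proof -
  have "norm (axis undefined 1 :: complex^'m) = 1" by simp
  hence ne: "sphere (0 :: complex^'m) 1 \<noteq> {}" by (metis dist_0_norm empty_iff mem_sphere)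
  have "continuous_on (sphere 0 1) (\<lambda>x. norm (M *v x))"
    by (intro continuous_on_norm bounded_linear.continuous_on[OF matrix_vector_mul_bounded_linear] continuous_on_id)
  from continuous_attains_sup[OF compact_sphere ne this]
  obtain v where v: "norm v = 1" and mx: "\<And>x. norm x = 1 \<Longrightarrow> norm (M *v x) \<le> norm (M *v v)"
    by auto
  define \<sigma> where "\<sigma> = norm (M *v v)"
  have s0: "\<sigma> \<ge> 0" by (simp add: \<sigma>_def)
  have le: "norm (M *v x) \<le> \<sigma> * norm x" for x
  proof (cases "x = 0")
    case False
    define c where "c = complex_of_real (1 / norm x)"
    have "norm (c *s x) = 1" using False by (simp add: norm_vec_smult c_def norm_divide)
    from mx[OF this] have "norm (c *s (M *v x)) \<le> \<sigma>" by (simp add: \<sigma>_def matrix_vector_mult_scaleR vector_scalar_commute)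
    thus ?thesis using False by (simp add: norm_vec_smult c_def norm_divide field_simps)
  qed simp
  \<comment> \<open>A nonnegative quadratic form that vanishes at \<open>v\<close>, so its first
    variation there vanishes; \<open>w\<close> below is half its gradient at
    \<open>v\<close>.\<close>
  define q where "q x = \<sigma>\<^sup>2 * (norm x)\<^sup>2 - (norm (M *v x))\<^sup>2" for x
  have q0: "q x \<ge> 0" for x
    using power_mono[OF le[of x] norm_ge_zero, of 2] by (simp add: q_def power_mult_distrib)
  define w where "w = complex_of_real (\<sigma>\<^sup>2) *s v - (conj_transpose M ** M) *v v"
  \<comment> \<open>A step against the gradient, short enough that the linear term outweighs the
    quadratic one: \<open>2 + t * \<sigma>\<^sup>2\<close> stays positive. The summand 1 covers
    \<open>\<sigma> = 0\<close>.\<close>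
  define t where "t = - 1 / (\<sigma>\<^sup>2 + 1)"
  have qe: "complex_of_real (q x) = complex_of_real (\<sigma>\<^sup>2) * hdot x x - hdot (M *v x) (M *v x)" for x
    by (simp add: q_def hdot_self)
  have hw: "complex_of_real (\<sigma>\<^sup>2) * hdot v y - hdot (M *v v) (M *v y) = hdot w y" for y
  proof -
    have "hdot (M *v v) (M *v y) = hdot ((conj_transpose M ** M) *v v) y"
      using hdot_adjoint[of "conj_transpose M" "M *v v" y] by (simp add: matrix_vector_mul_assoc[symmetric])
    thus ?thesis by (simp add: w_def hdot_diff hdot_smult)
  qed
  have "complex_of_real (q (v + complex_of_real t *s w)) =
     complex_of_real (q v) + complex_of_real (2 * t * (norm w)\<^sup>2) + complex_of_real (t\<^sup>2 * q w)"
  proof -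
    have M: "M *v (v + complex_of_real t *s w) = M *v v + complex_of_real t *s (M *v w)"
      by (simp add: matrix_vector_right_distrib vector_scalar_commute)
    have h1: "complex_of_real (\<sigma>\<^sup>2) * hdot w v - hdot (M *v w) (M *v v) = complex_of_real ((norm w)\<^sup>2)"
      using arg_cong[OF hw[of w], of cnj] by (simp add: hdot_commute[symmetric] hdot_self)
    have h2: "complex_of_real (\<sigma>\<^sup>2) * hdot v w - hdot (M *v v) (M *v w) = complex_of_real ((norm w)\<^sup>2)"
      using hw[of w] by (simp add: hdot_self)
    have "complex_of_real (q (v + complex_of_real t *s w)) = complex_of_real (q v)
      + complex_of_real t * (complex_of_real (\<sigma>\<^sup>2) * hdot w v - hdot (M *v w) (M *v v))
      + complex_of_real t * (complex_of_real (\<sigma>\<^sup>2) * hdot v w - hdot (M *v v) (M *v w))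
      + complex_of_real (t\<^sup>2) * complex_of_real (q w)"
      unfolding qe M hdot_add hdot_smult by (simp add: algebra_simps power2_eq_square)
    thus ?thesis unfolding h1 h2 by simp
  qed
  hence "q (v + complex_of_real t *s w) = q v + 2 * t * (norm w)\<^sup>2 + t\<^sup>2 * q w"
    unfolding of_real_add[symmetric] of_real_eq_iff .
  moreover have "q v = 0" using v by (simp add: q_def \<sigma>_def)
  ultimately have "0 \<le> 2 * t * (norm w)\<^sup>2 + t\<^sup>2 * q w" using q0[of "v + complex_of_real t *s w"] by simp
  also have "\<dots> \<le> 2 * t * (norm w)\<^sup>2 + t\<^sup>2 * (\<sigma>\<^sup>2 * (norm w)\<^sup>2)"
    by (intro add_left_mono mult_left_mono) (auto simp: q_def)
  also have "\<dots> = t * (norm w)\<^sup>2 * (2 + t * \<sigma>\<^sup>2)" by (simp add: algebra_simps power2_eq_square)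
  finally have ge: "0 \<le> t * (norm w)\<^sup>2 * (2 + t * \<sigma>\<^sup>2)" .
  have "\<sigma>\<^sup>2 + 1 > 0" by (simp add: add_nonneg_pos)
  hence "t < 0" "2 + t * \<sigma>\<^sup>2 > 0" by (auto simp: t_def field_simps add_nonneg_pos)
  hence "(norm w)\<^sup>2 \<le> 0" using ge by (simp add: zero_le_mult_iff mult_le_0_iff not_le)
  hence "w = 0" by simp
  hence "(conj_transpose M ** M) *v v = complex_of_real (\<sigma>\<^sup>2) *s v" by (simp add: w_def)
  moreover have "v \<noteq> 0" using v by auto
  ultimately have "is_eigenvalue (conj_transpose M ** M) (complex_of_real (\<sigma>\<^sup>2))"
    unfolding is_eigenvalue_def by blast
  thus ?thesis using that s0 le by blast
qed

lemma singular_value_le: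
  assumes e: "is_eigenvalue (conj_transpose M ** M) (complex_of_real (\<sigma>\<^sup>2))" and K: "\<And>x. norm (M *v x) \<le> K * norm x"
    and s: "\<sigma> \<ge> 0" "K \<ge> 0"
  shows "\<sigma> \<le> K"
proof -
  obtain v where v: "v \<noteq> 0" "(conj_transpose M ** M) *v v = complex_of_real (\<sigma>\<^sup>2) *s v"
    using e unfolding is_eigenvalue_def by blast
  have "hdot (M *v v) (M *v v) = hdot ((conj_transpose M ** M) *v v) v"
    using hdot_adjoint[of "conj_transpose M" "M *v v" v] by (simp add: matrix_vector_mul_assoc[symmetric])
  hence "complex_of_real ((norm (M *v v))\<^sup>2) = complex_of_real (\<sigma>\<^sup>2 * (norm v)\<^sup>2)"
    unfolding v(2) hdot_smult hdot_self by simp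
  hence "(norm (M *v v))\<^sup>2 = (\<sigma> * norm v)\<^sup>2" unfolding of_real_eq_iff by (simp add: power_mult_distrib)
  hence "norm (M *v v) = \<sigma> * norm v" using s by (simp add: power2_eq_iff_nonneg)
  with K[of v] v show ?thesis by simp
qed

text \<open>The set in the definition has a largest element, namely the operator norm: that value is
  attained, and any operator bound limits every other member.\<close>

lemma max_singular_value_bounds:
  fixes M :: "complex^'m^'n"
  shows "norm (M *v x) \<le> max_singular_value M * norm x"
    and "K \<ge> 0 \<Longrightarrow> (\<And>x. norm (M *v x) \<le> K * norm x) \<Longrightarrow> max_singular_value M \<le> K"
    and "max_singular_value M \<ge> 0"
proof -
  obtain \<sigma> where \<sigma>: "\<sigma> \<ge> 0" "is_eigenvalue (conj_transpose M ** M) (complex_of_real (\<sigma>\<^sup>2))"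
    "\<And>x. norm (M *v x) \<le> \<sigma> * norm x"
    using largest_singular_value_exists[of M] by blast
  have "max_singular_value M = \<sigma>"
    unfolding max_singular_value_def
    by (rule cSup_eq_maximum) (use \<sigma> singular_value_le[OF _ \<sigma>(3) _ \<sigma>(1)] in auto)
  thus "norm (M *v x) \<le> max_singular_value M * norm x" "max_singular_value M \<ge> 0"
    "K \<ge> 0 \<Longrightarrow> (\<And>x. norm (M *v x) \<le> K * norm x) \<Longrightarrow> max_singular_value M \<le> K"
    using \<sigma> singular_value_le[OF \<sigma>(2)] by auto
qed

lemma norm_nth_le_max_singular_value: "norm (M $ i $ j) \<le> max_singular_value M"
proof -
  have "norm (M $ i $ j) = norm ((M *v axis j 1) $ i)" by (simp only: matrix_vector_axis)
  also have "\<dots> \<le> norm (M *v axis j 1)" by (rule Finite_Cartesian_Product.norm_nth_le)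
  also have "\<dots> \<le> max_singular_value M * norm (axis j (1::complex))" by (rule max_singular_value_bounds)
  finally show ?thesis by simp
qed

lemma norm_matrix_vector_le:
  fixes M :: "complex^'m^'n"
  assumes "\<And>i j. norm (M $ i $ j) \<le> B"
  shows "norm (M *v x) \<le> (real CARD('n) * real CARD('m) * B) * norm x"
proof -
  have "norm ((M *v x) $ i) \<le> real CARD('m) * B * norm x" for i
  proof -
    have "norm ((M *v x) $ i) \<le> (\<Sum>j\<in>UNIV. norm (M $ i $ j) * norm (x $ j))"
      unfolding matrix_vector_mult_def by (simp add: order_trans[OF norm_sum] norm_mult)
    also have "\<dots> \<le> (\<Sum>j\<in>(UNIV :: 'm set). B * norm x)"
      by (intro sum_mono mult_mono assms Finite_Cartesian_Product.norm_nth_le norm_ge_zero order_trans[OF norm_ge_zero assms])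
    finally show ?thesis by simp
  qed
  hence "(\<Sum>i\<in>UNIV. norm ((M *v x) $ i)) \<le> (\<Sum>i\<in>(UNIV :: 'n set). real CARD('m) * B * norm x)"
    by (intro sum_mono) auto
  moreover have "norm (M *v x) \<le> (\<Sum>i\<in>UNIV. norm ((M *v x) $ i))"
    unfolding norm_vec_def by (rule L2_set_le_sum) auto
  ultimately show ?thesis by simp
qed

section \<open>Positive semidefinite matrices and traces\<close>

definition psd :: "complex^'n^'n \<Rightarrow> bool" where
  "psd P \<longleftrightarrow> conj_transpose P = P \<and> (\<forall>x. Re (hdot (P *v x) x) \<ge> 0)"

lemma psd_congruence: "psd P \<Longrightarrow> psd (E ** P ** conj_transpose E)"
  unfolding psd_def
  by (auto simp: conj_transpose_mult matrix_mul_assoc matrix_vector_mul_assoc[symmetric] hdot_adjoint[of E])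

lemma psd_entry: assumes "psd P" shows "P $ j $ i = cnj (P $ i $ j)"
proof -
  have "P $ j $ i = conj_transpose P $ j $ i" using assms by (simp add: psd_def)
  thus ?thesis by (simp add: conj_transpose_def)
qed

lemma matrix_add_rdistrib: "((A :: 'a::semiring_1^'n^'m) + B) ** C = A ** C + B ** C"
  by (simp add: vec_eq_iff matrix_matrix_mult_def algebra_simps sum.distrib)

lemma psd_diag: assumes "psd P" shows "Im (P $ k $ k) = 0" "Re (P $ k $ k) \<ge> 0"
proof -
  have "P $ k $ k = cnj (P $ k $ k)" by (rule psd_entry[OF assms])
  thus "Im (P $ k $ k) = 0" by (simp add: complex_eq_iff)
  have "hdot (P *v axis k 1) (axis k 1) = (P *v axis k 1) $ k"
    by (simp add: hdot_def axis_def if_distrib[of cnj] if_distrib[of "\<lambda>x. _ * x"] cong: if_cong)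
  hence "hdot (P *v axis k 1) (axis k 1) = P $ k $ k" by (simp only: matrix_vector_axis)
  thus "Re (P $ k $ k) \<ge> 0" using assms unfolding psd_def by metis
qed

definition rank_one :: "complex^'n \<Rightarrow> complex^'n^'n" where
  "rank_one p = (\<chi> i j. p $ i * cnj (p $ j))"

lemma rank_one_congruence: "T ** rank_one p ** conj_transpose T = rank_one (T *v p)"
proof -
  have 1: "(T ** rank_one p) $ i $ k = (T *v p) $ i * cnj (p $ k)" for i k
    by (simp add: matrix_matrix_mult_def rank_one_def matrix_vector_mult_def sum_distrib_right mult.assoc)
  have "(T ** rank_one p ** conj_transpose T) $ i $ k = (T *v p) $ i * cnj ((T *v p) $ k)" for i k
  proof -
    have "(T ** rank_one p ** conj_transpose T) $ i $ k = (\<Sum>l\<in>UNIV. (T *v p) $ i * (cnj (p $ l) * cnj (T $ k $ l)))"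
      unfolding matrix_matrix_mult_def[of "T ** rank_one p"] vec_lambda_beta 1 by (simp add: conj_transpose_def mult.assoc)
    thus ?thesis unfolding sum_distrib_left[symmetric] by (simp add: matrix_vector_mult_def mult.commute)
  qed
  thus ?thesis by (simp add: vec_eq_iff rank_one_def)
qed

lemma trace_rank_one: "trace (rank_one p) = complex_of_real ((norm p)\<^sup>2)"
  unfolding hdot_self[symmetric] by (simp add: trace_def rank_one_def hdot_def)

lemma rank_one_vector: "rank_one p *v x = hdot x p *s p"
  by (simp add: vec_eq_iff matrix_vector_mult_def rank_one_def hdot_def sum_distrib_left sum_distrib_right mult_ac)

text \<open>One Cholesky step, subtracting the normalised \<open>k\<close>-th column. The form of
  the remainder at \<open>x\<close> equals that of \<open>P\<close> at \<open>y\<close>, the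
  translate of \<open>x\<close> along axis \<open>k\<close> for which entry \<open>k\<close> of
  \<open>P *v y\<close> vanishes, hence it is nonnegative.\<close>

lemma psd_deflate:
  fixes P :: "complex^'n^'n"
  assumes P: "psd P" and k: "P $ k $ k \<noteq> 0"
  defines "d \<equiv> Re (P $ k $ k)"
  defines "p \<equiv> complex_of_real (1 / sqrt d) *s (\<chi> i. P $ i $ k)"
  shows "psd (P - rank_one p)" "(P - rank_one p) $ k $ k = 0"
proof -
  have Pk: "P $ k $ k = complex_of_real d" using psd_diag[OF P] by (simp add: d_def complex_eq_iff)
  have d: "d > 0" using k psd_diag(2)[OF P, of k, folded d_def] Pk by (cases "d = 0") auto
  have sd: "complex_of_real (1 / sqrt d) * complex_of_real (1 / sqrt d) = complex_of_real (1 / d)"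
    unfolding of_real_mult[symmetric] of_real_eq_iff using d by (simp add: field_simps)
  have h: "P $ j $ i = cnj (P $ i $ j)" for i j
    by (rule psd_entry[OF P])
  define c where "c = (\<chi> i. P $ i $ k)"
  have c: "P *v axis k 1 = c" by (simp add: vec_eq_iff c_def matrix_vector_axis)
  have cx: "hdot x c = (P *v x) $ k" for x
    by (simp add: hdot_def c_def matrix_vector_mult_def h[of _ k] mult.commute)
  have r1: "rank_one p = (\<chi> i j. complex_of_real (1 / d) * (c $ i * cnj (c $ j)))"
    unfolding sd[symmetric] by (simp add: rank_one_def p_def c_def vec_eq_iff mult_ac)
  show "(P - rank_one p) $ k $ k = 0" using d by (simp add: r1 c_def Pk)
  have herm: "conj_transpose (P - rank_one p) = P - rank_one p"
    using P by (simp add: conj_transpose_diff psd_def) (simp add: conj_transpose_def rank_one_def vec_eq_iff mult.commute)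
  have "Re (hdot ((P - rank_one p) *v x) x) \<ge> 0" for x
  proof -
    define a where "a = (P *v x) $ k"
    define y where "y = x - (a / complex_of_real d) *s axis k 1"
    have rx: "hdot (rank_one p *v x) x = a * cnj a / complex_of_real d"
    proof -
      have "rank_one p *v x = (complex_of_real (1 / sqrt d) * complex_of_real (1 / sqrt d) * a) *s c"
        unfolding rank_one_vector p_def c_def[symmetric] hdot_smult cx
        by (simp add: vec_eq_iff a_def)
      hence "rank_one p *v x = (complex_of_real (1 / d) * a) *s c" unfolding sd .
      moreover have "hdot c x = cnj a" using cx[of x] by (simp add: hdot_commute[of c] a_def)
      ultimately show ?thesis by (simp add: hdot_smult)
    qed
    have hk: "hdot z (axis k 1) = z $ k" for z :: "complex^'n"
      by (simp add: hdot_def axis_def if_distrib[of cnj] if_distrib[of "\<lambda>x. _ * x"] cong: if_cong)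
    define b where "b = a / complex_of_real d"
    have Py: "P *v y = P *v x - b *s c"
      unfolding y_def b_def[symmetric] matrix_vector_mult_diff_distrib
      by (simp add: vector_scalar_commute flip: c)
    have hy: "hdot z y = hdot z x - cnj b * z $ k" for z
      by (simp add: y_def b_def[symmetric] hdot_diff hdot_smult hk)
    have "hdot (P *v y) y = hdot (P *v x) x - cnj (a / complex_of_real d) * a - (a / complex_of_real d) * hdot c x
        + (a / complex_of_real d) * cnj (a / complex_of_real d) * c $ k"
      unfolding Py hy hdot_diff hdot_smult b_def[symmetric] by (simp add: a_def[symmetric] algebra_simps)
    also have "\<dots> = hdot (P *v x) x - a * cnj a / complex_of_real d"
    proof -
      have "hdot c x = cnj a" using cx[of x] by (simp add: hdot_commute[of c] a_def)
      moreover have "c $ k = complex_of_real d" by (simp add: c_def Pk)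
      ultimately show ?thesis using d by (simp add: field_simps)
    qed
    also have "\<dots> = hdot ((P - rank_one p) *v x) x"
      by (simp add: matrix_vector_mult_diff_rdistrib hdot_diff rx)
    finally have e: "hdot (P *v y) y = hdot ((P - rank_one p) *v x) x" .
    have "Re (hdot (P *v y) y) \<ge> 0" using P by (simp add: psd_def)
    thus ?thesis by (simp only: e)
  qed
  thus "psd (P - rank_one p)" using herm by (simp add: psd_def)
qed

text \<open>Induction on the number of nonzero diagonal entries, each step splitting off a rank-one matrix.\<close>

lemma trace_contraction:
  fixes T :: "complex^'n^'m"
  assumes P: "psd P" and T: "\<And>x. norm (T *v x) \<le> \<gamma> * norm x"
  shows "Re (trace (T ** P ** conj_transpose T)) \<le> \<gamma>\<^sup>2 * Re (trace P)"
  using P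
proof (induction "card {k. P $ k $ k \<noteq> 0}" arbitrary: P rule: less_induct)
  case less
  show ?case
  proof (cases "\<exists>k. P $ k $ k \<noteq> 0")
    case True
    then obtain k where k: "P $ k $ k \<noteq> 0" by blast
    define p where "p = complex_of_real (1 / sqrt (Re (P $ k $ k))) *s (\<chi> i. P $ i $ k)"
    define P' where "P' = P - rank_one p"
    have P': "psd P'" "P' $ k $ k = 0"
      using psd_deflate[OF less(2) k] by (simp_all add: P'_def p_def)
    \<comment> \<open>A zero diagonal entry can only decrease, and semidefiniteness of
      \<open>P'\<close> forbids negative values; so no new nonzero entry appears while entry
      \<open>k\<close> disappears.\<close>
    have "{j. P' $ j $ j \<noteq> 0} \<subset> {j. P $ j $ j \<noteq> 0}"
    proof
      show "{j. P' $ j $ j \<noteq> 0} \<subseteq> {j. P $ j $ j \<noteq> 0}"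
      proof safe
        fix j assume j: "P' $ j $ j \<noteq> 0" "P $ j $ j = 0"
        have "P' $ j $ j = - complex_of_real ((norm (p $ j))\<^sup>2)"
          using j(2) unfolding complex_norm_square by (simp add: P'_def rank_one_def)
        hence "Re (P' $ j $ j) \<le> 0" "Im (P' $ j $ j) = 0" by (simp_all del: of_real_power)
        thus False using psd_diag(2)[OF P'(1), of j] j(1) by (simp add: complex_eq_iff)
      qed
      show "{j. P' $ j $ j \<noteq> 0} \<noteq> {j. P $ j $ j \<noteq> 0}" using k P'(2) by blast
    qed
    hence "card {j. P' $ j $ j \<noteq> 0} < card {j. P $ j $ j \<noteq> 0}" by (intro psubset_card_mono) auto
    from less(1)[OF this P'(1)]
    have IH: "Re (trace (T ** P' ** conj_transpose T)) \<le> \<gamma>\<^sup>2 * Re (trace P')" .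
    have PP: "P = P' + rank_one p" by (simp add: P'_def)
    have "T ** P ** conj_transpose T = T ** P' ** conj_transpose T + rank_one (T *v p)"
      unfolding rank_one_congruence[symmetric] by (subst PP) (simp add: matrix_add_ldistrib matrix_add_rdistrib)
    hence "Re (trace (T ** P ** conj_transpose T)) = Re (trace (T ** P' ** conj_transpose T)) + (norm (T *v p))\<^sup>2"
      by (simp add: trace_add trace_rank_one del: of_real_power)
    moreover have "Re (trace P) = Re (trace P') + (norm p)\<^sup>2"
      by (subst PP) (simp add: trace_add trace_rank_one del: of_real_power)
    moreover have "(norm (T *v p))\<^sup>2 \<le> \<gamma>\<^sup>2 * (norm p)\<^sup>2"
      using power_mono[OF T norm_ge_zero, of p 2] by (simp add: power_mult_distrib)
    ultimately show ?thesis using IH by (simp add: algebra_simps)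
  next
    case False
    \<comment> \<open>With a zero diagonal, the bound on off-diagonal entries annihilates the whole
      matrix.\<close>
    have "P $ i $ j = 0" for i j
    proof (cases "i = j")
      case ij: False
      have "2 * norm (P $ i $ j) \<le> Re (P $ i $ i) + Re (P $ j $ j)"
      proof (rule norm_offdiag_le[OF ij, of "\<lambda>i j. P $ i $ j"])
        show "P $ j $ i = cnj (P $ i $ j)"
          by (rule psd_entry[OF less(2)])
        fix v :: "'n \<Rightarrow> complex"
        have "hdot (P *v (\<chi> i. cnj (v i))) (\<chi> i. cnj (v i)) = (\<Sum>i\<in>UNIV. \<Sum>j\<in>UNIV. v i * cnj (v j) * P $ i $ j)"
          by (simp add: hdot_def matrix_vector_mult_def sum_distrib_left sum_distrib_right mult_ac)
        also have "\<dots> = (\<Sum>j\<in>UNIV. \<Sum>i\<in>UNIV. v i * cnj (v j) * P $ i $ j)" by (rule sum.swap)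
        finally show "0 \<le> Re (\<Sum>j\<in>UNIV. \<Sum>i\<in>UNIV. v i * cnj (v j) * P $ i $ j)"
          using less(2) unfolding psd_def by metis
      qed
      thus ?thesis using False by simp
    qed (use False in auto)
    hence "P = 0" by (simp add: vec_eq_iff)
    hence "T ** P ** conj_transpose T = 0" by (simp add: vec_eq_iff matrix_matrix_mult_def)
    thus ?thesis using \<open>P = 0\<close> by (simp add: trace_def)
  qed
qed

lemma psd_spec:
  fixes u :: "real \<Rightarrow> real^'n"
  assumes u: "u \<in> power_signals"
  shows "psd (spec u u \<omega>)"
proof -
  note U = power_signalsD[OF u]
  note h = has_corr_of_corr[OF U(1) U(1) U(2)]
  have "conj_transpose (spec u u \<omega>) = spec u u \<omega>"
    using cspec_spec(2)[OF U(1,1) cspec_flip[OF U(1,1) U(3)]] by metis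
  moreover have "Re (hdot (spec u u \<omega> *v x) x) \<ge> 0" for x
  proof -
    have "hdot (spec u u \<omega> *v x) x = (\<Sum>i\<in>UNIV. \<Sum>j\<in>UNIV. cnj (x $ i) * x $ j * spec u u \<omega> $ i $ j)"
      by (simp add: hdot_def matrix_vector_mult_def sum_distrib_left sum_distrib_right mult_ac)
    also have "\<dots> = (\<Sum>j\<in>UNIV. \<Sum>i\<in>UNIV. cnj (x $ i) * cnj (cnj (x $ j)) * spec u u \<omega> $ i $ j)"
      by (subst sum.swap) simp
    finally show ?thesis
      using spec_psd[OF bsig_coord[OF U(1)] h(1,2), where v = "\<lambda>i. cnj (x $ i)" and \<omega> = \<omega>] unfolding h(3) by simp
  qed
  ultimately show ?thesis by (simp add: psd_def)
qed

section \<open>Completion of squares\<close>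

lemma matrix_scaleR: "(c *\<^sub>R A) ** B = c *\<^sub>R (A ** B)" "A ** (c *\<^sub>R B) = c *\<^sub>R (A ** (B :: complex^'n^'m))"
  by (simp_all add: vec_eq_iff matrix_matrix_mult_def scaleR_sum_right)

lemma mat_scaleR: "(mat (complex_of_real c) :: complex^'n^'n) = c *\<^sub>R mat 1"
  by (simp add: vec_eq_iff mat_def complex_eq_iff)

lemma trace_scaleR: "trace (c *\<^sub>R (A :: complex^'n^'n)) = complex_of_real c * trace A"
  by (simp add: trace_def scaleR_conv_of_real[where 'a = complex] sum_distrib_left)

lemma conj_transpose_scaleR: "conj_transpose (c *\<^sub>R A) = c *\<^sub>R conj_transpose A"
  by (simp add: conj_transpose_def vec_eq_iff complex_eq_iff)

lemma conj_transpose_1 [simp]: "conj_transpose (mat 1) = mat 1"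
  by (simp add: conj_transpose_def vec_eq_iff mat_def)

lemmas cmat_algebra = matrix_add_ldistrib matrix_add_rdistrib matrix_sub_ldistrib matrix_sub_rdistrib
  matrix_scaleR matrix_mul_assoc[symmetric] conj_transpose_mult conj_transpose_add conj_transpose_diff
  conj_transpose_scaleR

lemma matrix_inv_unique:
  fixes A :: "'a::field^'n^'n"
  assumes "A ** B = mat 1" shows "det A \<noteq> 0" "matrix_inv A = B"
proof -
  show d: "det A \<noteq> 0"
    using assms invertible_right_inverse invertible_det_nz by blast
  have "matrix_inv A = matrix_inv A ** (A ** B)" by (simp add: assms)
  also have "\<dots> = B" by (simp add: matrix_mul_assoc matrix_inv_det[OF d])
  finally show "matrix_inv A = B" .
qed

text \<open>The matrix \<open>N\<close> of the overview at a single frequency.\<close>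

definition gap :: "real \<Rightarrow> complex^'w^'z \<Rightarrow> complex^'w^'w" where
  "gap \<gamma> T = mat (complex_of_real (\<gamma>\<^sup>2)) - conj_transpose T ** T"

text \<open>Cauchy-Schwarz applied to the form of the gap at \<open>x\<close>, which is
  \<open>\<gamma>\<^sup>2\<close> times the squared norm of \<open>x\<close> minus that of
  \<open>T *v x\<close>. When \<open>m\<^sup>2 < \<gamma>\<^sup>2\<close> this gives both
  invertibility and a bound on the inverse that is uniform in frequency.\<close>

lemma gap_coercive:
  assumes T: "\<And>x. norm (T *v x) \<le> m * norm x"
  shows "(\<gamma>\<^sup>2 - m\<^sup>2) * norm x \<le> norm (gap \<gamma> T *v x)"
proof (cases "x = 0")
  case False
  have "hdot (gap \<gamma> T *v x) x = complex_of_real (\<gamma>\<^sup>2) * hdot x x - hdot (T *v x) (T *v x)"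
    unfolding gap_def matrix_vector_mult_diff_rdistrib mat_vector hdot_diff hdot_smult
    using hdot_adjoint[of "conj_transpose T" "T *v x" x] by (simp add: matrix_vector_mul_assoc[symmetric])
  hence "hdot (gap \<gamma> T *v x) x = complex_of_real (\<gamma>\<^sup>2 * (norm x)\<^sup>2 - (norm (T *v x))\<^sup>2)"
    by (simp add: hdot_self)
  hence "\<gamma>\<^sup>2 * (norm x)\<^sup>2 - (norm (T *v x))\<^sup>2 \<le> norm (hdot (gap \<gamma> T *v x) x)"
    by (simp only: norm_of_real)
  also have "\<dots> \<le> norm (gap \<gamma> T *v x) * norm x" by (rule norm_hdot_le)
  finally have "\<gamma>\<^sup>2 * (norm x)\<^sup>2 - (norm (T *v x))\<^sup>2 \<le> norm (gap \<gamma> T *v x) * norm x" .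
  moreover have "(norm (T *v x))\<^sup>2 \<le> m\<^sup>2 * (norm x)\<^sup>2"
    using power_mono[OF T norm_ge_zero, of x 2] by (simp add: power_mult_distrib)
  ultimately have "((\<gamma>\<^sup>2 - m\<^sup>2) * norm x) * norm x \<le> norm (gap \<gamma> T *v x) * norm x"
    by (simp add: algebra_simps power2_eq_square)
  thus ?thesis using False by simp
qed simp

lemma gap_invertible:
  assumes T: "\<And>x. norm (T *v x) \<le> m * norm x" and m: "m\<^sup>2 < \<gamma>\<^sup>2"
  shows "det (gap \<gamma> T) \<noteq> 0" "norm (matrix_inv (gap \<gamma> T) *v y) \<le> norm y / (\<gamma>\<^sup>2 - m\<^sup>2)"
proof -
  show d: "det (gap \<gamma> T) \<noteq> 0"
  proof
    assume "det (gap \<gamma> T) = 0"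
    hence "\<not> invertible (gap \<gamma> T)" by (simp add: invertible_det_nz)
    then obtain v where v: "gap \<gamma> T *v v = 0" "v \<noteq> 0"
      unfolding invertible_left_inverse matrix_left_invertible_ker by blast
    thus False using gap_coercive[OF T, of \<gamma> v] m by (simp add: mult_le_0_iff)
  qed
  have "gap \<gamma> T *v (matrix_inv (gap \<gamma> T) *v y) = y"
    by (simp add: matrix_vector_mul_assoc matrix_inv_det[OF d])
  thus "norm (matrix_inv (gap \<gamma> T) *v y) \<le> norm y / (\<gamma>\<^sup>2 - m\<^sup>2)"
    using gap_coercive[OF T, of \<gamma> "matrix_inv (gap \<gamma> T) *v y"] m by (simp add: field_simps)
qed

lemma gap_hermitian: "conj_transpose (gap \<gamma> T) = gap \<gamma> T"
  unfolding gap_def mat_scaleR by (simp add: cmat_algebra)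

lemma matrix_inv_hermitian:
  assumes "det N \<noteq> 0" "conj_transpose N = N"
  shows "conj_transpose (matrix_inv N) = matrix_inv N"
proof -
  have "conj_transpose (matrix_inv N ** N) = mat 1" by (simp add: matrix_inv_det[OF assms(1)])
  hence "N ** conj_transpose (matrix_inv N) = mat 1" by (simp add: conj_transpose_mult assms(2))
  from matrix_inv_unique(2)[OF this] show ?thesis by simp
qed

text \<open>Reconciles the inverse in the stated integrand, of the size of \<open>z\<close>, with
  the inverse in the worst weighting, of the size of \<open>w\<close>. The check rests on
  \<open>TI\<close>, which expresses the product of the adjoint of \<open>T\<close>,
  \<open>T\<close> and \<open>I\<close> by \<open>I\<close> alone.\<close>

lemma push_through:
  fixes T :: "complex^'w^'z"
  assumes d: "det (gap \<gamma> T) \<noteq> 0" and g: "\<gamma> \<noteq> 0"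
  shows "matrix_inv (mat 1 - (1 / \<gamma>\<^sup>2) *\<^sub>R (T ** conj_transpose T)) =
     mat 1 + T ** matrix_inv (gap \<gamma> T) ** conj_transpose T"
proof (rule matrix_inv_unique(2))
  define I where "I = matrix_inv (gap \<gamma> T)"
  have "gap \<gamma> T ** I = mat 1" by (simp add: I_def matrix_inv_det[OF d])
  hence "\<gamma>\<^sup>2 *\<^sub>R I - conj_transpose T ** (T ** I) = mat 1"
    unfolding gap_def mat_scaleR by (simp add: cmat_algebra)
  hence TI: "conj_transpose T ** (T ** I) = \<gamma>\<^sup>2 *\<^sub>R I - mat 1" by (simp add: algebra_simps)
  have TI': "conj_transpose T ** (T ** (I ** X)) = \<gamma>\<^sup>2 *\<^sub>R (I ** X) - X" for X :: "complex^'z^'w"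
  proof -
    have "conj_transpose T ** (T ** (I ** X)) = (conj_transpose T ** (T ** I)) ** X"
      by (simp add: matrix_mul_assoc)
    thus ?thesis unfolding TI by (simp add: cmat_algebra)
  qed
  show "(mat 1 - (1 / \<gamma>\<^sup>2) *\<^sub>R (T ** conj_transpose T)) ** (mat 1 + T ** matrix_inv (gap \<gamma> T) ** conj_transpose T) = mat 1"
    unfolding I_def[symmetric] using g by (simp add: cmat_algebra TI' scaleR_diff_right)
qed

text \<open>The centre \<open>W\<close> solves \<open>N ** W = conj_transpose T ** R\<close>, so
  expanding the square reproduces every term with \<open>V\<close>. What remains involves
  \<open>R\<close> alone and is identified by \<open>push_through\<close>.\<close>

lemma completion_of_squares:
  fixes T :: "complex^'w^'z" and R :: "complex^'y^'z" and V :: "complex^'y^'w"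
  assumes d: "det (gap \<gamma> T) \<noteq> 0" and g: "\<gamma> \<noteq> 0"
  defines "E \<equiv> V - matrix_inv (gap \<gamma> T) ** conj_transpose T ** R"
  shows "conj_transpose (T ** V + R) ** (T ** V + R) - \<gamma>\<^sup>2 *\<^sub>R (conj_transpose V ** V) =
     conj_transpose R ** matrix_inv (mat 1 - (1 / \<gamma>\<^sup>2) *\<^sub>R (T ** conj_transpose T)) ** R
     - conj_transpose E ** gap \<gamma> T ** E"
proof -
  define N where "N = gap \<gamma> T"
  define I where "I = matrix_inv N"
  have NI: "N ** I = mat 1" "I ** N = mat 1" using matrix_inv_det[OF d] by (simp_all add: N_def I_def)
  have NI'': "N ** (I ** X) = X" for X :: "complex^'y^'w"
    by (simp_all add: matrix_mul_assoc NI)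
  have Is: "conj_transpose I = I"
    unfolding I_def by (rule matrix_inv_hermitian) (use d gap_hermitian in \<open>auto simp: N_def\<close>)
  define W where "W = I ** (conj_transpose T ** R)"
  have E: "E = V - W" by (simp add: E_def W_def I_def N_def matrix_mul_assoc)
  have NW: "N ** W = conj_transpose T ** R" unfolding W_def by (rule NI'')
  have Ws: "conj_transpose W = conj_transpose R ** (T ** I)"
    by (simp add: W_def conj_transpose_mult Is matrix_mul_assoc)
  have WN: "conj_transpose W ** (N ** X) = conj_transpose R ** (T ** X)" for X :: "complex^'y^'w"
  proof -
    have "conj_transpose W ** (N ** X) = conj_transpose R ** (T ** (I ** (N ** X)))"
      by (simp add: Ws matrix_mul_assoc)
    also have "I ** (N ** X) = X" by (simp add: matrix_mul_assoc NI)
    finally show ?thesis .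
  qed
  have NV: "N ** V = \<gamma>\<^sup>2 *\<^sub>R V - conj_transpose T ** (T ** V)"
    unfolding N_def gap_def mat_scaleR by (simp add: cmat_algebra)
  have "conj_transpose E ** gap \<gamma> T ** E = conj_transpose V ** (N ** V) - conj_transpose V ** (N ** W)
     - conj_transpose W ** (N ** V) + conj_transpose W ** (N ** W)"
    unfolding E N_def[symmetric] by (simp add: cmat_algebra algebra_simps)
  also have "\<dots> = \<gamma>\<^sup>2 *\<^sub>R (conj_transpose V ** V) - conj_transpose V ** (conj_transpose T ** (T ** V))
      - conj_transpose V ** (conj_transpose T ** R) - conj_transpose R ** (T ** V) + conj_transpose R ** (T ** W)"
    by (simp only: WN) (simp add: NW NV cmat_algebra)
  finally show ?thesis
    unfolding push_through[OF d g] N_def[symmetric] I_def[symmetric]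
    by (simp add: cmat_algebra W_def algebra_simps)
qed

lemma trace_cyclic3: "trace (X ** S ** conj_transpose X) = trace (S ** (conj_transpose X ** X))"
  by (subst trace_mul_sym) (simp add: matrix_mul_assoc, metis matrix_mul_assoc trace_mul_sym)

text \<open>The deficit is kept in terms of \<open>E ** S ** conj_transpose E\<close>, the form in
  which \<open>trace_contraction\<close> shows it to be nonnegative.\<close>

lemma completion_trace:
  fixes T :: "complex^'w^'z" and R :: "complex^'y^'z" and V :: "complex^'y^'w" and S :: "complex^'y^'y"
  assumes d: "det (gap \<gamma> T) \<noteq> 0" and g: "\<gamma> \<noteq> 0"
  defines "E \<equiv> V - matrix_inv (gap \<gamma> T) ** conj_transpose T ** R"
  shows "trace ((T ** V + R) ** S ** conj_transpose (T ** V + R)) - complex_of_real (\<gamma>\<^sup>2) * trace (V ** S ** conj_transpose V) =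
     trace (S ** conj_transpose R ** matrix_inv (mat 1 - (1 / \<gamma>\<^sup>2) *\<^sub>R (T ** conj_transpose T)) ** R)
     - (complex_of_real (\<gamma>\<^sup>2) * trace (E ** S ** conj_transpose E) - trace (T ** (E ** S ** conj_transpose E) ** conj_transpose T))"
proof -
  have "trace ((T ** V + R) ** S ** conj_transpose (T ** V + R)) - complex_of_real (\<gamma>\<^sup>2) * trace (V ** S ** conj_transpose V) =
     trace (S ** (conj_transpose (T ** V + R) ** (T ** V + R) - \<gamma>\<^sup>2 *\<^sub>R (conj_transpose V ** V)))"
    unfolding trace_cyclic3 trace_scaleR[symmetric] trace_sub[symmetric]
    by (simp add: matrix_sub_ldistrib matrix_scaleR)
  also have "\<dots> = trace (S ** (conj_transpose R ** matrix_inv (mat 1 - (1 / \<gamma>\<^sup>2) *\<^sub>R (T ** conj_transpose T)) ** R))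
     - trace (S ** (conj_transpose E ** gap \<gamma> T ** E))"
    unfolding completion_of_squares[OF d g] E_def[symmetric] by (simp add: matrix_sub_ldistrib trace_sub)
  also have "trace (S ** (conj_transpose E ** gap \<gamma> T ** E)) =
      complex_of_real (\<gamma>\<^sup>2) * trace (E ** S ** conj_transpose E) - trace (T ** (E ** S ** conj_transpose E) ** conj_transpose T)"
  proof -
    have "T ** (E ** S ** conj_transpose E) ** conj_transpose T = (T ** E) ** S ** conj_transpose (T ** E)"
      by (simp add: cmat_algebra)
    hence "trace (T ** (E ** S ** conj_transpose E) ** conj_transpose T) = trace (S ** (conj_transpose (T ** E) ** (T ** E)))"
      by (simp only: trace_cyclic3)
    moreover have "conj_transpose E ** gap \<gamma> T ** E = \<gamma>\<^sup>2 *\<^sub>R (conj_transpose E ** E) - conj_transpose (T ** E) ** (T ** E)"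
      unfolding gap_def mat_scaleR by (simp add: cmat_algebra)
    ultimately show ?thesis
      unfolding trace_cyclic3[of E] by (simp add: matrix_sub_ldistrib trace_sub matrix_scaleR trace_scaleR)
  qed
  finally show ?thesis by (simp add: matrix_mul_assoc)
qed

section \<open>Transfer matrices on the imaginary axis\<close>

text \<open>On the imaginary axis negation is conjugation, and real coefficients carry conjugation
  through.\<close>

lemma para_adj_axis:
  assumes "rat_mat (lap_region False) T"
  shows "para_adj T (jw \<omega>) = conj_transpose (T (jw \<omega>))"
proof -
  have "T (- (jw \<omega>)) $ i $ j = cnj (T (jw \<omega>) $ i $ j)" for i j
  proof -
    have "rat_fun (lap_region False) (\<lambda>s. T s $ i $ j)" using assms by (simp add: rat_mat_def)
    from rat_fun_cnj[OF this imaginary_lap_region[of \<omega>]] show ?thesis by (simp add: lap_region_def)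
  qed
  thus ?thesis by (simp add: para_adj_def transpose_def conj_transpose_def vec_eq_iff)
qed

lemma RL_inf_iff:
  "V \<in> RL_inf \<longleftrightarrow> rat_mat (lap_region False) V \<and>
     bdd_above (range (\<lambda>\<omega>::real. max_singular_value (V (jw \<omega>))))"
proof -
  have "(\<forall>\<omega>::real. P (jw \<omega>)) \<longleftrightarrow> (\<forall>s\<in>lap_region False. P s)" for P
  proof safe
    fix s assume P: "\<forall>\<omega>. P (jw \<omega>)" and s: "s \<in> lap_region False"
    have "s = \<i> * complex_of_real (Im s)" using s by (simp add: lap_region_def complex_eq_iff)
    thus "P s" using P by metis
  qed simp
  note * = this[of "\<lambda>s. poly (map_poly complex_of_real _) s \<noteq> 0"]
  show ?thesis unfolding RL_inf_def rat_mat_def rat_fun_def cpoly_def mem_Collect_eq * ..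
qed

lemma bdd_above_max_singular_value:
  fixes V :: "complex \<Rightarrow> complex^'m^'n"
  assumes "\<And>i j \<omega>. norm (V (jw \<omega>) $ i $ j) \<le> B"
  shows "bdd_above (range (\<lambda>\<omega>::real. max_singular_value (V (jw \<omega>))))"
proof (rule bdd_aboveI2)
  fix \<omega> :: real
  have "B \<ge> 0" using norm_ge_zero assms order_trans by blast
  thus "max_singular_value (V (jw \<omega>)) \<le> real CARD('n) * real CARD('m) * B"
    by (intro max_singular_value_bounds(2) norm_matrix_vector_le assms) auto
qed

lemma RL_inf_bounded_entries:
  assumes "V \<in> RL_inf"
  obtains B where "\<And>i j \<omega>. norm (V (jw \<omega>) $ i $ j) \<le> B"
proof -
  obtain B where "\<And>\<omega>. max_singular_value (V (jw \<omega>)) \<le> B"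
    using assms unfolding RL_inf_iff bdd_above_def by auto
  thus ?thesis using that norm_nth_le_max_singular_value order_trans by metis
qed

text \<open>A weighting may have poles in the right half-plane, so the representation is built in
  the noncausal mode, on the imaginary axis.\<close>

lemma RL_inf_impulse_response:
  assumes V: "V \<in> RL_inf"
  shows "\<exists>D h. impulse_response V D h"
proof -
  obtain B where B: "\<And>i j \<omega>. norm (V (jw \<omega>) $ i $ j) \<le> B"
    using RL_inf_bounded_entries[OF V] by blast
  have r: "rat_fun (lap_region False) (\<lambda>s. V s $ i $ j)" for i j
    using V by (simp add: RL_inf_iff rat_mat_def)
  have "lap_rep False (\<lambda>s. V s $ i $ j)" for i j
    by (rule rat_fun_lap_rep[OF r B])
  moreover have "V (cnj s) $ i $ j = cnj (V s $ i $ j)" if "s \<in> lap_region False" for i j s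
    by (rule rat_fun_cnj[OF r that cnj_lap_region[OF that]])
  ultimately show ?thesis using impulse_response_exists[of False V] by blast
qed

lemma transfer_matrix_RL_inf:
  assumes A: "stable_matrix A"
  shows "transfer_matrix A B E D \<in> RL_inf"
proof -
  have "\<exists>B'. \<forall>\<omega>. norm (transfer_matrix A B E D (jw \<omega>) $ i $ j) \<le> B'" for i j
    by (rule lap_rep_bounded[OF transfer_matrix_lap_rep[OF A, of False B E D i j]]) blast
  then obtain B' where B': "\<And>i j \<omega>. norm (transfer_matrix A B E D (jw \<omega>) $ i $ j) \<le> B' i j" by metis
  have "B' i j \<le> Max (range (\<lambda>(i, j). B' i j))" for i j
    by (rule Max_ge) (auto intro!: image_eqI[of _ _ "(i, j)"])
  hence "norm (transfer_matrix A B E D (jw \<omega>) $ i $ j) \<le> Max (range (\<lambda>(i, j). B' i j))" for i j \<omega>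
    by (rule order_trans[OF B'])
  from bdd_above_max_singular_value[where V = "transfer_matrix A B E D", OF this] show ?thesis
    unfolding RL_inf_iff using transfer_matrix_rat[OF A, of False B E D] by blast
qed

lemma Linf_norm_bound:
  assumes "T \<in> RL_inf"
  shows "norm (T (jw \<omega>) *v x) \<le> Linf_norm T * norm x" "Linf_norm T \<ge> 0"
proof -
  have le: "max_singular_value (T (jw \<omega>)) \<le> Linf_norm T" for \<omega>
    unfolding Linf_norm_def using assms by (intro cSUP_upper) (auto simp: RL_inf_iff)
  thus "norm (T (jw \<omega>) *v x) \<le> Linf_norm T * norm x"
    by (rule order_trans[OF max_singular_value_bounds(1) mult_right_mono]) simp
  show "Linf_norm T \<ge> 0" using le[of 0] max_singular_value_bounds(3) order_trans by blast
qed

text \<open>Rationality follows from Cramer's rule because the gap is nonsingular on the axis.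
  Boundedness follows from the bound on its inverse, where \<open>Linf_norm T\<close> serves as the
  constant \<open>m\<close> at all frequencies at once.\<close>

lemma worst_weighting_RL_inf:
  assumes T: "T \<in> RL_inf" and R: "R \<in> RL_inf" and g: "Linf_norm T < \<gamma>"
  shows "(\<lambda>s. matrix_inv (mat (complex_of_real (\<gamma>\<^sup>2)) - para_adj T s ** T s) ** para_adj T s ** R s) \<in> RL_inf"
    and "det (gap \<gamma> (T (jw \<omega>))) \<noteq> 0"
proof -
  define m where "m = Linf_norm T"
  have m: "m\<^sup>2 < \<gamma>\<^sup>2" using g Linf_norm_bound(2)[OF T] by (simp add: m_def power_strict_mono)
  have rT: "rat_mat (lap_region False) T" and rR: "rat_mat (lap_region False) R"
    using T R by (simp_all add: RL_inf_iff)
  note bT = Linf_norm_bound(1)[OF T, folded m_def]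
  show det: "det (gap \<gamma> (T (jw \<omega>))) \<noteq> 0" for \<omega> by (rule gap_invertible(1)[OF bT m])
  note pa = para_adj_axis[OF rT]
  define W where "W s = matrix_inv (mat (complex_of_real (\<gamma>\<^sup>2)) - para_adj T s ** T s) ** para_adj T s ** R s" for s
  have W: "W (jw \<omega>) = matrix_inv (gap \<gamma> (T (jw \<omega>))) **
      conj_transpose (T (jw \<omega>)) ** R (jw \<omega>)" for \<omega>
    by (simp add: W_def pa gap_def)
  have rp: "rat_mat (lap_region False) (para_adj T)"
    by (rule rat_mat_para_adj[OF rT]) (simp add: lap_region_def)
  have "rat_mat (lap_region False) W"
    unfolding W_def
  proof (intro rat_mat_mult rat_mat_inv rat_mat_diff rat_mat_mat rat_fun_const rT rR rp)
    fix s assume "s \<in> lap_region False"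
    hence s: "s = \<i> * complex_of_real (Im s)" by (simp add: lap_region_def complex_eq_iff)
    show "det (mat (complex_of_real (\<gamma>\<^sup>2)) - para_adj T s ** T s) \<noteq> 0"
      using det[of "Im s"] unfolding s[symmetric] gap_def pa[of "Im s", unfolded s[symmetric]] .
  qed
  moreover
  obtain B1 where B1: "\<And>i j \<omega>. norm (T (jw \<omega>) $ i $ j) \<le> B1" using RL_inf_bounded_entries[OF T] by blast
  define Q where "Q \<omega> = conj_transpose (T (jw \<omega>))" for \<omega>
  have nQ: "norm (Q \<omega> $ i $ j) \<le> B1" for i j \<omega> using B1 by (simp add: conj_transpose_def Q_def)
  define K1 where "K1 = real CARD('b) * real CARD('a) * B1"
  have "bdd_above (range (\<lambda>\<omega>::real. max_singular_value (W (jw \<omega>))))"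
  proof (rule bdd_aboveI2)
    fix \<omega> :: real
    define k where "k = (\<gamma>\<^sup>2 - m\<^sup>2)"
    have k: "k > 0" using m by (simp add: k_def)
    have B10: "B1 \<ge> 0" using B1 norm_ge_zero order_trans by blast
    have "norm (W (jw \<omega>) *v x) \<le> (K1 * Linf_norm R / k) * norm x" for x
    proof -
      have "norm (W (jw \<omega>) *v x) \<le> norm (Q \<omega> *v (R (jw \<omega>) *v x)) / k"
        unfolding W k_def Q_def matrix_vector_mul_assoc[symmetric] by (rule gap_invertible(2)[OF bT m])
      also have "norm (Q \<omega> *v (R (jw \<omega>) *v x)) \<le> K1 * norm (R (jw \<omega>) *v x)"
        using norm_matrix_vector_le[of "Q \<omega>" B1 "R (jw \<omega>) *v x", OF nQ]
        by (simp add: K1_def mult_ac)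
      also have "\<dots> \<le> K1 * (Linf_norm R * norm x)"
        by (intro mult_left_mono Linf_norm_bound R) (simp add: K1_def B10)
      finally show ?thesis using k by (simp add: divide_right_mono mult_ac)
    qed
    thus "max_singular_value (W (jw \<omega>)) \<le> K1 * Linf_norm R / k"
      using k B10 by (intro max_singular_value_bounds(2)) (auto simp: K1_def intro!: divide_nonneg_nonneg mult_nonneg_nonneg Linf_norm_bound R)
  qed
  ultimately show "(\<lambda>s. matrix_inv (mat (complex_of_real (\<gamma>\<^sup>2)) - para_adj T s ** T s) ** para_adj T s ** R s) \<in> RL_inf"
    unfolding RL_inf_iff W_def by blast
qed

section \<open>Power of filtered signals\<close>

lemma conj_transpose_0 [simp]: "conj_transpose 0 = 0"
  by (simp add: conj_transpose_def vec_eq_iff)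

lemma matrix_mult_0 [simp]: "(A :: 'a::semiring_1^'n^'m) ** 0 = 0" "0 ** (B :: 'a^'n^'m) = 0"
  by (simp_all add: matrix_matrix_mult_def vec_eq_iff)

lemma lti_map_add:
  assumes ex: "\<exists>D h. impulse_response G D h" and u: "bounded_signal u" "bounded_signal v"
  shows "lti_map G (\<lambda>t. u t + v t) t = lti_map G u t + lti_map G v t"
proof -
  from ex obtain D h where ir: "impulse_response G D h"
    and l: "\<And>u t. lti_map G u t = (if t < 0 then 0 else D *v u t + (LINT \<sigma>|lborel. h (t - \<sigma>) *v u \<sigma>))"
    using lti_map_impulse_response by blast
  have h: "integrable lborel h" using ir by (simp add: impulse_response_def)
  show ?thesis unfolding l using integrable_kernel_mv(1)[OF h u(1), of t] integrable_kernel_mv(1)[OF h u(2), of t]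
    by (simp add: matrix_vector_right_distrib)
qed

lemma lti_map_zero [simp]: "lti_map G (\<lambda>t. 0) = (\<lambda>t. 0)"
  by (rule ext) (simp add: lti_map_def Let_def case_prod_unfold)

lemma zero_power_signal: "(\<lambda>t. 0 :: real^'n) \<in> power_signals" "pow_norm (\<lambda>t. 0 :: real^'n) = 0"
  and cspec_zero: "cspec (\<lambda>t. 0 :: real^'n) v (\<lambda>\<omega>. 0)"
proof -
  have b: "bounded_signal (\<lambda>t. 0 :: real^'n)" by (simp add: bounded_signal_iff bsig_zero)
  have c: "cspec (\<lambda>t. 0 :: real^'n) v (\<lambda>\<omega>. 0)" for v :: "real \<Rightarrow> real^'m"
    using has_spec_zero by (simp add: cspec_def)
  show "cspec (\<lambda>t. 0 :: real^'n) v (\<lambda>\<omega>. 0)" by (rule c)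
  have c': "cspec (\<lambda>t. 0 :: real^'n) (\<lambda>t. 0 :: real^'n) (\<lambda>\<omega>. 0)"
    using has_spec_zero by (simp add: cspec_def)
  show "(\<lambda>t. 0 :: real^'n) \<in> power_signals" by (rule power_signals_of_cspec(1)[OF b c'])
  have "complex_of_real ((pow_norm (\<lambda>t. 0 :: real^'n))\<^sup>2) = 0"
    unfolding power_signals_of_cspec(4)[OF b c'] by (simp add: trace_def)
  thus "pow_norm (\<lambda>t. 0 :: real^'n) = 0" by simp
qed

lemma cspec_self_hermitian:
  assumes "bounded_signal u" "cspec u u S" shows "conj_transpose (S \<omega>) = S \<omega>"
  using cspec_spec(2)[OF assms(1,1) assms(2)] cspec_spec(2)[OF assms(1,1) cspec_flip[OF assms(1,1,2)]] by metis

text \<open>Filter, flip and filter again. The filter is abstract, so that both a single map and the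
  combined response to \<open>r\<close> are covered.\<close>

lemma cspec_square:
  assumes u: "bounded_signal u" and y: "bounded_signal y" and S: "cspec u u S"
    and filter: "\<And>S'. cspec u u S' \<Longrightarrow> cspec y u (\<lambda>\<omega>. G \<omega> ** S' \<omega>)"
      "\<And>S'. cspec u y S' \<Longrightarrow> cspec y y (\<lambda>\<omega>. G \<omega> ** S' \<omega>)"
  shows "cspec y y (\<lambda>\<omega>. G \<omega> ** S \<omega> ** conj_transpose (G \<omega>))"
proof -
  have "cspec y y (\<lambda>\<omega>. G \<omega> ** conj_transpose (G \<omega> ** S \<omega>))"
    by (rule filter(2)[OF cspec_flip[OF y u filter(1)[OF S]]])
  thus ?thesis
    by (rule cspec_cong) (simp add: conj_transpose_mult cspec_self_hermitian[OF u S] matrix_mul_assoc)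
qed

lemma lti_map_power:
  assumes G: "\<exists>D h. impulse_response G D h" and u: "u \<in> power_signals"
  shows "cspec (lti_map G u) (lti_map G u)
    (\<lambda>\<omega>. G (jw \<omega>) ** spec u u \<omega> ** conj_transpose (G (jw \<omega>)))"
proof -
  note U = power_signalsD[OF u] and b = lti_map_filter(1)[OF G]
  show ?thesis
    by (rule cspec_square[OF U(1) b[OF U(1)] U(3)])
       (rule lti_map_filter(2)[OF G U(1)], use U b in auto)+
qed

lemma orthogonal_power_sum:
  assumes a: "bounded_signal a" and b: "bounded_signal b"
    and Sa: "cspec a a Sa" and Sb: "cspec b b Sb" and ab: "cspec a b (\<lambda>\<omega>. 0)"
  shows "(\<lambda>t. a t + b t) \<in> power_signals"
    "(pow_norm (\<lambda>t. a t + b t))\<^sup>2 = (pow_norm a)\<^sup>2 + (pow_norm b)\<^sup>2"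
proof -
  define s where "s t = a t + b t" for t
  have s: "bounded_signal s" unfolding s_def[abs_def] by (rule bounded_signal_add[OF a b])
  have ba: "cspec b a (\<lambda>\<omega>. 0)" using cspec_flip[OF a b ab] by simp
  have "cspec s a (\<lambda>\<omega>. Sa \<omega> + 0)" unfolding s_def by (rule cspec_add[OF a b a Sa ba])
  from cspec_flip[OF s a this] have as: "cspec a s Sa"
    by (rule cspec_cong) (simp add: cspec_self_hermitian[OF a Sa])
  have "cspec s b (\<lambda>\<omega>. 0 + Sb \<omega>)" unfolding s_def by (rule cspec_add[OF a b b ab Sb])
  from cspec_flip[OF s b this] have bs: "cspec b s Sb"
    by (rule cspec_cong) (simp add: cspec_self_hermitian[OF b Sb])
  have ss: "cspec s s (\<lambda>\<omega>. Sa \<omega> + Sb \<omega>)"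
    using cspec_add[OF a b s as bs] by (simp add: s_def[abs_def])
  note ps = power_signals_of_cspec[OF s ss] and pa = power_signals_of_cspec[OF a Sa] and pb = power_signals_of_cspec[OF b Sb]
  show "(\<lambda>t. a t + b t) \<in> power_signals" using ps(1) by (simp add: s_def[abs_def])
  have "complex_of_real ((pow_norm s)\<^sup>2) = complex_of_real ((pow_norm a)\<^sup>2) + complex_of_real ((pow_norm b)\<^sup>2)"
    unfolding ps(4) pa(4) pb(4) trace_add using pa(3) pb(3) by (simp add: add_divide_distrib)
  hence "(pow_norm s)\<^sup>2 = (pow_norm a)\<^sup>2 + (pow_norm b)\<^sup>2" unfolding of_real_add[symmetric] of_real_eq_iff .
  thus "(pow_norm (\<lambda>t. a t + b t))\<^sup>2 = (pow_norm a)\<^sup>2 + (pow_norm b)\<^sup>2" by (simp add: s_def[abs_def])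
qed

lemma Re_half_pi: "Re (1 / (2 * complex_of_real pi) * x) = Re x / (2 * pi)"
proof -
  have "1 / (2 * complex_of_real pi) * x = x / complex_of_real (2 * pi)" by simp
  thus ?thesis by (simp only: Re_divide_of_real)
qed

text \<open>\<open>trace_contraction\<close> at each frequency, integrated. It makes the supremum
  over the orthogonal part \<open>w1\<close> at most 0 once
  \<open>Linf_norm T < \<gamma>\<close>.\<close>

lemma pow_norm_contraction:
  assumes T: "T \<in> RL_inf" and u: "u \<in> power_signals"
  shows "(pow_norm (lti_map T u))\<^sup>2 \<le> (Linf_norm T)\<^sup>2 * (pow_norm u)\<^sup>2"
proof -
  note ex = RL_inf_impulse_response[OF T] and U = power_signalsD[OF u]
  note p = power_signals_of_cspec[OF lti_map_filter(1)[OF ex U(1)] lti_map_power[OF ex u]]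
    and pu = power_signals_of_cspec[OF U(1,3)]
  define A where "A \<omega> = trace (T (jw \<omega>) ** spec u u \<omega> ** conj_transpose (T (jw \<omega>)))" for \<omega>
  have A: "integrable lborel A" using p(3) by (simp add: A_def[abs_def])
  have "(pow_norm (lti_map T u))\<^sup>2 = Re (LINT \<omega>|lborel. A \<omega>) / (2 * pi)"
    using arg_cong[OF p(4), of Re] unfolding A_def Re_half_pi by (simp only: Re_complex_of_real)
  also have "Re (LINT \<omega>|lborel. A \<omega>) = (LINT \<omega>|lborel. Re (A \<omega>))" using A by (simp add: integral_Re)
  also have "\<dots> \<le> (LINT \<omega>|lborel. (Linf_norm T)\<^sup>2 * Re (trace (spec u u \<omega>)))"
    using A pu(3) unfolding A_def
    by (intro integral_mono integrable_mult_right integrable_Re trace_contraction psd_spec[OF u] Linf_norm_bound T) auto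
  also have "\<dots> = (Linf_norm T)\<^sup>2 * Re (LINT \<omega>|lborel. trace (spec u u \<omega>))"
    using pu(3) by (simp add: integral_Re)
  finally have "(pow_norm (lti_map T u))\<^sup>2 \<le> (Linf_norm T)\<^sup>2 * Re (LINT \<omega>|lborel. trace (spec u u \<omega>)) / (2 * pi)"
    by (simp add: divide_right_mono)
  moreover have "(pow_norm u)\<^sup>2 = Re (LINT \<omega>|lborel. trace (spec u u \<omega>)) / (2 * pi)"
    using arg_cong[OF pu(4), of Re] unfolding Re_half_pi by (simp only: Re_complex_of_real)
  ultimately show ?thesis by simp
qed

text \<open>The response \<open>T V + R\<close> is handled as a cascade plus a direct path, so that
  no impulse response of the composite has to be constructed.\<close>

lemma response_filter:
  assumes T: "\<exists>D h. impulse_response T D h" and R: "\<exists>D h. impulse_response R D h"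
    and V: "\<exists>D h. impulse_response V D h" and r: "bounded_signal r"
  defines "y \<equiv> \<lambda>t. lti_map T (lti_map V r) t + lti_map R r t"
  shows "bounded_signal y"
    "bounded_signal v \<Longrightarrow> cspec r v S \<Longrightarrow> cspec y v (\<lambda>\<omega>. (T (jw \<omega>) ** V (jw \<omega>)
        + R (jw \<omega>)) ** S \<omega>)"
proof -
  note bv = lti_map_filter(1)[OF V r]
  note b = lti_map_filter(1)[OF T bv] lti_map_filter(1)[OF R r]
  show "bounded_signal y" unfolding y_def by (rule bounded_signal_add[OF b])
  assume v: "bounded_signal v" and S: "cspec r v S"
  show "cspec y v (\<lambda>\<omega>. (T (jw \<omega>) ** V (jw \<omega>)
        + R (jw \<omega>)) ** S \<omega>)"
    unfolding y_def matrix_add_rdistrib matrix_mul_assoc[symmetric]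
    by (rule cspec_add[OF b v lti_map_filter(2)[OF T bv v lti_map_filter(2)[OF V r v S]] lti_map_filter(2)[OF R r v S]])
qed

lemma response_power:
  assumes T: "\<exists>D h. impulse_response T D h" and R: "\<exists>D h. impulse_response R D h"
    and V: "\<exists>D h. impulse_response V D h" and r: "r \<in> power_signals"
  defines "y \<equiv> \<lambda>t. lti_map T (lti_map V r) t + lti_map R r t"
    and "G \<equiv> \<lambda>\<omega>. T (jw \<omega>) ** V (jw \<omega>) + R (jw \<omega>)"
  shows "cspec y y (\<lambda>\<omega>. G \<omega> ** spec r r \<omega> ** conj_transpose (G \<omega>))"
proof -
  note U = power_signalsD[OF r]
  note f = response_filter[OF T R V U(1), folded y_def]
  show ?thesis
    by (rule cspec_square[OF U(1) f(1) U(3)]) (unfold G_def, (rule f(2), use U f(1) in auto)+)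
qed

section \<open>The worst dependent weighting\<close>

lemma dependent_gap:
  fixes T :: "complex \<Rightarrow> complex^'w^'z" and R :: "complex \<Rightarrow> complex^'y^'z" and r :: "real \<Rightarrow> real^'y"
  assumes T: "T \<in> RL_inf" and R: "R \<in> RL_inf" and r: "r \<in> power_signals"
    and g: "\<gamma> > 0" "Linf_norm T < \<gamma>"
  defines "J \<equiv> \<lambda>V. (pow_norm (\<lambda>t. lti_map T (lti_map V r) t + lti_map R r t))\<^sup>2 - \<gamma>\<^sup>2 * (pow_norm (lti_map V r))\<^sup>2"
    and "F \<equiv> \<lambda>\<omega>. trace (spec r r \<omega> ** para_adj R (jw \<omega>)
                     ** matrix_inv (mat 1 - (1 / \<gamma>\<^sup>2) *\<^sub>R
                          (T (jw \<omega>) ** para_adj T (jw \<omega>)))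
                     ** R (jw \<omega>))"
    and "Wt \<equiv> \<lambda>s. matrix_inv (mat (complex_of_real (\<gamma>\<^sup>2)) - para_adj T s ** T s) ** para_adj T s ** R s"
  shows "Wt \<in> RL_inf" "integrable lborel F"
    "complex_of_real (J Wt) = 1 / (2 * complex_of_real pi) * (LINT \<omega>|lborel. F \<omega>)"
    "V \<in> RL_inf \<Longrightarrow> J V \<le> J Wt"
proof -
  show Wt: "Wt \<in> RL_inf" unfolding Wt_def by (rule worst_weighting_RL_inf(1)[OF T R g(2)])
  note det = worst_weighting_RL_inf(2)[OF T R g(2)]
  have rT: "rat_mat (lap_region False) T" and rR: "rat_mat (lap_region False) R"
    using T R by (simp_all add: RL_inf_iff)
  note pa = para_adj_axis[OF rT] para_adj_axis[OF rR]
  define E where "E V \<omega> = V (jw \<omega>) - Wt (jw \<omega>)" for V \<omega>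
  define Q where "Q V \<omega> = E V \<omega> ** spec r r \<omega> ** conj_transpose (E V \<omega>)" for V \<omega>
  define D where "D V \<omega> = complex_of_real (\<gamma>\<^sup>2) * trace (Q V \<omega>) - trace (T (jw \<omega>) ** Q V \<omega> ** conj_transpose (T (jw \<omega>)))" for V \<omega>
  define a where "a V \<omega> = trace ((T (jw \<omega>) ** V (jw \<omega>) + R (jw \<omega>)) ** spec r r \<omega> **
     conj_transpose (T (jw \<omega>) ** V (jw \<omega>) + R (jw \<omega>)))" for V \<omega>
  define b where "b V \<omega> = trace ((V :: complex \<Rightarrow> complex^'y^'w) (jw \<omega>) ** spec r r \<omega> ** conj_transpose (V (jw \<omega>)))" for V \<omega>
  have pt: "a V \<omega> - complex_of_real (\<gamma>\<^sup>2) * b V \<omega> = F \<omega> - D V \<omega>" for V \<omega>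
    unfolding a_def b_def F_def D_def Q_def E_def Wt_def pa gap_def[symmetric]
    by (rule completion_trace[OF det]) (use g in simp)
  have I: "integrable lborel (a V)" "integrable lborel (b V)"
    and JV: "complex_of_real (J V) = 1 / (2 * complex_of_real pi) * (LINT \<omega>|lborel. F \<omega> - D V \<omega>)"
    if V: "V \<in> RL_inf" for V
  proof -
    note eT = RL_inf_impulse_response[OF T] and eR = RL_inf_impulse_response[OF R] and eV = RL_inf_impulse_response[OF V]
    note pa = power_signals_of_cspec[OF response_filter(1)[OF eT eR eV power_signalsD(1)[OF r]] response_power[OF eT eR eV r]]
    note pb = power_signals_of_cspec[OF lti_map_filter(1)[OF eV power_signalsD(1)[OF r]] lti_map_power[OF eV r]]
    show Ia: "integrable lborel (a V)" using pa(3) by (simp add: a_def[abs_def])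
    show Ib: "integrable lborel (b V)" using pb(3) by (simp add: b_def[abs_def])
    have "complex_of_real (J V) = 1 / (2 * complex_of_real pi) * (LINT \<omega>|lborel. a V \<omega>)
       - complex_of_real (\<gamma>\<^sup>2) * (1 / (2 * complex_of_real pi) * (LINT \<omega>|lborel. b V \<omega>))"
      unfolding J_def of_real_diff of_real_mult pa(4) pb(4) a_def b_def ..
    also have "\<dots> = 1 / (2 * complex_of_real pi) * ((LINT \<omega>|lborel. a V \<omega>) - (LINT \<omega>|lborel. complex_of_real (\<gamma>\<^sup>2) * b V \<omega>))"
      by (simp add: right_diff_distrib diff_divide_distrib)
    also have "(LINT \<omega>|lborel. a V \<omega>) - (LINT \<omega>|lborel. complex_of_real (\<gamma>\<^sup>2) * b V \<omega>) = (LINT \<omega>|lborel. a V \<omega> - complex_of_real (\<gamma>\<^sup>2) * b V \<omega>)"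
      using Ia Ib by (intro Bochner_Integration.integral_diff[symmetric] integrable_mult_right)
    finally show "complex_of_real (J V) = 1 / (2 * complex_of_real pi) * (LINT \<omega>|lborel. F \<omega> - D V \<omega>)"
      unfolding pt .
  qed
  have D0: "D Wt \<omega> = 0" for \<omega>
    by (simp add: D_def Q_def E_def trace_def)
  \<comment> \<open>With vanishing deficit at \<open>Wt\<close>, the function \<open>F\<close> is
    the integrand of an actual pair of power signals, and its integrability comes from
    there.\<close>
  have "F = (\<lambda>\<omega>. a Wt \<omega> - complex_of_real (\<gamma>\<^sup>2) * b Wt \<omega>)" unfolding pt D0 by simp
  thus F: "integrable lborel F" using I[OF Wt] by simp
  show JW: "complex_of_real (J Wt) = 1 / (2 * complex_of_real pi) * (LINT \<omega>|lborel. F \<omega>)"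
    using JV[OF Wt] unfolding D0 by simp
  assume V: "V \<in> RL_inf"
  have "D V = (\<lambda>\<omega>. F \<omega> - (a V \<omega> - complex_of_real (\<gamma>\<^sup>2) * b V \<omega>))" unfolding pt by simp
  hence DI: "integrable lborel (D V)" using F I[OF V] by simp
  have Dn: "Re (D V \<omega>) \<ge> 0" for \<omega>
  proof -
    have "norm (T (jw \<omega>) *v x) \<le> \<gamma> * norm x" for x
      by (rule order_trans[OF Linf_norm_bound(1)[OF T]]) (use g in \<open>simp add: mult_right_mono\<close>)
    from trace_contraction[OF psd_congruence[OF psd_spec[OF r]] this, of "E V \<omega>" \<omega>]
    show ?thesis by (simp add: D_def Q_def del: of_real_power)
  qed
  have "complex_of_real (J V) = complex_of_real (J Wt) - 1 / (2 * complex_of_real pi) * (LINT \<omega>|lborel. D V \<omega>)"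
    unfolding JV[OF V] JW using F DI by (simp add: diff_divide_distrib)
  from arg_cong[OF this, of Re] have "J V = J Wt - Re (LINT \<omega>|lborel. D V \<omega>) / (2 * pi)"
    by (simp only: minus_complex.simps Re_complex_of_real Re_half_pi)
  moreover have "Re (LINT \<omega>|lborel. D V \<omega>) = (LINT \<omega>|lborel. Re (D V \<omega>))" using DI by (simp add: integral_Re)
  moreover have "\<dots> \<ge> 0" by (intro integral_nonneg_AE AE_I2 Dn)
  ultimately show "J V \<le> J Wt" by (simp add: divide_nonneg_pos)
qed

section \<open>The closed loop as a sum of two filters, and the power identities\<close>

lemma closed_loop_response:
  fixes A :: "real^'n^'n" and B1 :: "real^'w^'n" and B2 :: "real^'u^'n"
    and C1 :: "real^'y^'z" and C2 :: "real^'n^'y" and D12 :: "real^'u^'z" and D21 :: "real^'w^'y"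
    and Ac :: "real^'c^'c" and Bc :: "real^'y^'c" and Cc :: "real^'c^'u" and Dc :: "real^'y^'u"
    and Ak :: "real^'k^'k" and Bk :: "real^'y^'k" and Ck :: "real^'k^'u" and Dk :: "real^'y^'u"
    and L :: "real^'y^'n" and Lc :: "real^'u^'c"
  assumes Cs: "stable_matrix (block_mat (A + B2 ** Dc ** C2) (B2 ** Cc) (Bc ** C2) Ac)"
    and Ks: "stable_matrix (block_mat (A + B2 ** Dk ** C2) (B2 ** Ck) (Bk ** C2) Ak)"
    and w: "bounded_signal w" and r: "bounded_signal r"
    and cl: "closed_loop A B1 B2 C1 C2 D12 D21 Ac Bc Cc Dc Ak Bk Ck Dk L Lc w r z"
  shows "z = (\<lambda>t. lti_map (transfer_matrix
          (block_mat (A + B2 ** Dk ** C2) (B2 ** Ck) (Bk ** C2) Ak)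
          (block_col (B1 + B2 ** Dk ** D21) (Bk ** D21))
          (block_row ((C1 + D12 ** Dk) ** C2) (D12 ** Ck))
          (D12 ** Dk ** D21)) w t + lti_map (transfer_matrix
          (block_mat (A + B2 ** Dc ** C2) (B2 ** Cc) (Bc ** C2) Ac)
          (block_col (- (B2 ** Dc)) (- Bc))
          (block_row ((C1 + D12 ** Dc) ** C2) (D12 ** Cc))
          (- (C1 + D12 ** Dc))) r t)"
proof
  fix t
  obtain xw xr where xw: "state_of (\<lambda>t. block_mat (A + B2 ** Dk ** C2) (B2 ** Ck) (Bk ** C2) Ak *v xw t
       + block_col (B1 + B2 ** Dk ** D21) (Bk ** D21) *v w t) xw"
    and xr: "state_of (\<lambda>t. block_mat (A + B2 ** Dc ** C2) (B2 ** Cc) (Bc ** C2) Ac *v xr t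
       + block_col (- (B2 ** Dc)) (- Bc) *v r t) xr"
    and z: "\<And>t. z t = (block_row ((C1 + D12 ** Dk) ** C2) (D12 ** Ck) *v xw t + (D12 ** Dk ** D21) *v w t)
       + (block_row ((C1 + D12 ** Dc) ** C2) (D12 ** Cc) *v xr t + (- (C1 + D12 ** Dc)) *v r t)"
    using closed_loop_decomposition[OF cl] by blast
  show "z t = lti_map (transfer_matrix
          (block_mat (A + B2 ** Dk ** C2) (B2 ** Ck) (Bk ** C2) Ak)
          (block_col (B1 + B2 ** Dk ** D21) (Bk ** D21))
          (block_row ((C1 + D12 ** Dk) ** C2) (D12 ** Ck))
          (D12 ** Dk ** D21)) w t + lti_map (transfer_matrix
          (block_mat (A + B2 ** Dc ** C2) (B2 ** Cc) (Bc ** C2) Ac)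
          (block_col (- (B2 ** Dc)) (- Bc))
          (block_row ((C1 + D12 ** Dc) ** C2) (D12 ** Cc))
          (- (C1 + D12 ** Dc))) r t"
    unfolding z stable_system[OF Ks w xw] stable_system[OF Cs r xr] ..
qed

lemma laplace_add:
  assumes u: "bounded_signal u" and v: "bounded_signal v" and s: "Re s > 0"
  shows "laplace (\<lambda>t. u t + v t) s = laplace u s + laplace v s"
proof -
  have "lap (coord (\<lambda>t. u t + v t) k) s = lap (coord u k) s + lap (coord v k) s" for k
    unfolding lap_def using integrable_exp_signal[OF u s, of k] integrable_exp_signal[OF v s, of k]
    by (simp add: distrib_left)
  thus ?thesis
    by (simp add: vec_eq_iff laplace_eq_lap[OF bounded_signal_add[OF u v]] laplace_eq_lap[OF u] laplace_eq_lap[OF v])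
qed

text \<open>Orthogonality to \<open>r\<close> passes to every filtered version of \<open>r\<close>,
  hence to \<open>lti_map V r\<close> and \<open>zt\<close>; filtering \<open>w1\<close> on the
  other side preserves it again.\<close>

lemma dependent_weighting_power:
  fixes r :: "real \<Rightarrow> real^'y" and w w1 :: "real \<Rightarrow> real^'w" and T :: "complex \<Rightarrow> complex^'w^'z" and R :: "complex \<Rightarrow> complex^'y^'z"
  assumes T: "T \<in> RL_inf" and R: "R \<in> RL_inf" and r: "r \<in> power_signals" and dep: "dependent_weighting r w V w1"
    and z: "z = (\<lambda>t. lti_map T w t + lti_map R r t)"
  defines "z1 \<equiv> lti_map T w1" and "zt \<equiv> \<lambda>t. lti_map T (lti_map V r) t + lti_map R r t"
  shows "z = (\<lambda>t. z1 t + zt t)" "z \<in> power_signals" "z1 \<in> power_signals" "zt \<in> power_signals"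
    "(pow_norm z)\<^sup>2 = (pow_norm z1)\<^sup>2 + (pow_norm zt)\<^sup>2"
    "(pow_norm w)\<^sup>2 = (pow_norm w1)\<^sup>2 + (pow_norm (lti_map V r))\<^sup>2"
proof -
  have w1: "w1 \<in> power_signals" and V: "V \<in> RL_inf" and w: "w = (\<lambda>t. lti_map V r t + w1 t)"
    and o: "orthogonal_signals w1 r"
    using dep unfolding dependent_weighting_def by blast+
  note eT = RL_inf_impulse_response[OF T] and eR = RL_inf_impulse_response[OF R] and eV = RL_inf_impulse_response[OF V]
  note br = power_signalsD(1)[OF r] and b1 = power_signalsD(1)[OF w1]
  note bv = lti_map_filter(1)[OF eV br] and bz1 = lti_map_filter(1)[OF eT b1, folded z1_def]
  note rf = response_filter[OF eT eR eV br, folded zt_def]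
  \<comment> \<open>A vanishing density is upgraded to a vanishing correlation at lag 0, which the
    sum of powers requires.\<close>
  have c1r: "cspec w1 r (\<lambda>\<omega>. 0)"
    using cspec_of_spec_exists[OF w1 r] o unfolding orthogonal_signals_def by (auto intro: cspec_cong)
  have cr1: "cspec r w1 (\<lambda>\<omega>. 0)" using cspec_flip[OF b1 br c1r] by simp
  have czt1: "cspec zt w1 (\<lambda>\<omega>. 0)" using rf(2)[OF b1 cr1] by simp
  have c1zt: "cspec w1 zt (\<lambda>\<omega>. 0)" using cspec_flip[OF rf(1) b1 czt1] by simp
  have cz: "cspec z1 zt (\<lambda>\<omega>. 0)" using lti_map_filter(2)[OF eT b1 rf(1) c1zt] by (simp add: z1_def)
  have cv: "cspec (lti_map V r) w1 (\<lambda>\<omega>. 0)" using lti_map_filter(2)[OF eV br b1 cr1] by simp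
  note s1 = lti_map_power[OF eT w1, folded z1_def] and s2 = response_power[OF eT eR eV r, folded zt_def]
  show ze: "z = (\<lambda>t. z1 t + zt t)"
    unfolding z w z1_def zt_def by (rule ext) (simp add: lti_map_add[OF eT bv b1])
  show "z1 \<in> power_signals" by (rule power_signals_of_cspec(1)[OF bz1 s1])
  show "zt \<in> power_signals" by (rule power_signals_of_cspec(1)[OF rf(1) s2])
  show "z \<in> power_signals" "(pow_norm z)\<^sup>2 = (pow_norm z1)\<^sup>2 + (pow_norm zt)\<^sup>2"
    unfolding ze using orthogonal_power_sum[OF bz1 rf(1) s1 s2 cz] .
  show "(pow_norm w)\<^sup>2 = (pow_norm w1)\<^sup>2 + (pow_norm (lti_map V r))\<^sup>2"
    unfolding w using orthogonal_power_sum(2)[OF bv b1 lti_map_power[OF eV r] power_signalsD(3)[OF w1] cv] by simp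
qed

section \<open>Transfer matrices, power identities and suprema of the tracking loop\<close>

text \<open>Suprema are formed in the extended reals, where they exist before any bound is known.
  \<open>S\<close> ranges over the disturbances that split relative to the given \<open>r\<close>,
  each with a closed-loop output it produces. The realization of \<open>Tzw\<close> with zero
  feedthrough is tied to \<open>D12 ** Dk ** D21 = 0\<close>.\<close>

theorem theorem2:
  fixes A :: "real^'n^'n" and B1 :: "real^'w^'n" and B2 :: "real^'u^'n"
    and C1 :: "real^'y^'z" and C2 :: "real^'n^'y" and D12 :: "real^'u^'z" and D21 :: "real^'w^'y"
    and Ac :: "real^'c^'c" and Bc :: "real^'y^'c" and Cc :: "real^'c^'u" and Dc :: "real^'y^'u"
    and Ak :: "real^'k^'k" and Bk :: "real^'y^'k" and Ck :: "real^'k^'u" and Dk :: "real^'y^'u"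
    and L :: "real^'y^'n" and Lc :: "real^'u^'c"
    and w w1 :: "real \<Rightarrow> real^'w" and r :: "real \<Rightarrow> real^'y" and z :: "real \<Rightarrow> real^'z"
    and W Wt :: "complex \<Rightarrow> complex^'y^'w"
    and Tzw :: "complex \<Rightarrow> complex^'w^'z" and Tzr :: "complex \<Rightarrow> complex^'y^'z"
    and z1 :: "(real \<Rightarrow> real^'w) \<Rightarrow> real \<Rightarrow> real^'z" and z2 :: "real \<Rightarrow> real^'z"
    and zt2 :: "(complex \<Rightarrow> complex^'y^'w) \<Rightarrow> real \<Rightarrow> real^'z"
    and loop :: "(real \<Rightarrow> real^'w) \<Rightarrow> (real \<Rightarrow> real^'y) \<Rightarrow> (real \<Rightarrow> real^'z) \<Rightarrow> bool"
    and \<gamma> :: real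
  assumes "stabilizable A B2" and "detectable C2 A"
    and "stable_matrix (block_mat (A + B2 ** Dc ** C2) (B2 ** Cc) (Bc ** C2) Ac)"
    and "stable_matrix (block_mat (A + B2 ** Dk ** C2) (B2 ** Ck) (Bk ** C2) Ak)"
    and "stable_matrix (A + L ** C2)" and "stable_matrix (Ac + Lc ** Cc)"
    and loop: "loop = closed_loop A B1 B2 C1 C2 D12 D21 Ac Bc Cc Dc Ak Bk Ck Dk L Lc"
    and Tzw: "Tzw = transfer_matrix
          (block_mat (A + B2 ** Dk ** C2) (B2 ** Ck) (Bk ** C2) Ak)
          (block_col (B1 + B2 ** Dk ** D21) (Bk ** D21))
          (block_row ((C1 + D12 ** Dk) ** C2) (D12 ** Ck))
          (D12 ** Dk ** D21)"
    and Tzr: "Tzr = transfer_matrix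
          (block_mat (A + B2 ** Dc ** C2) (B2 ** Cc) (Bc ** C2) Ac)
          (block_col (- (B2 ** Dc)) (- Bc))
          (block_row ((C1 + D12 ** Dc) ** C2) (D12 ** Cc))
          (- (C1 + D12 ** Dc))"
    and z1: "z1 = lti_map Tzw"
    and z2: "z2 = lti_map Tzr r"
    and zt2: "zt2 = (\<lambda>V t. lti_map Tzw (lti_map V r) t + z2 t)"
    and Wt: "Wt = (\<lambda>s. matrix_inv (mat (complex_of_real (\<gamma>\<^sup>2)) - para_adj Tzw s ** Tzw s)
                       ** para_adj Tzw s ** Tzr s)"
    and "r \<in> power_signals"
    and "dependent_weighting r w W w1"
    and "loop w r z"
  shows
    \<comment> \<open>\<open>Tzw\<close> and \<open>Tzr\<close> form the closed-loop transfer matrix\<close>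
    "(\<forall>w' r' z'. bounded_signal w' \<and> bounded_signal r' \<and> loop w' r' z' \<longrightarrow>
        (\<forall>s. Re s > 0 \<longrightarrow> laplace z' s = Tzw s *v laplace w' s + Tzr s *v laplace r' s))
     \<and> (D12 ** Dk ** D21 = 0 \<longrightarrow>
          Tzw = transfer_matrix
            (block_mat (A + B2 ** Dk ** C2) (B2 ** Ck) (Bk ** C2) Ak)
            (block_col (B1 + B2 ** Dk ** D21) (Bk ** D21))
            (block_row ((C1 + D12 ** Dk) ** C2) (D12 ** Ck))
            0)
     \<and> (\<forall>s. Re s > 0 \<longrightarrow>
          laplace (z1 w1) s = Tzw s *v laplace w1 s \<and>
          laplace z2 s = Tzr s *v laplace r s \<and>
          laplace (zt2 W) s = Tzw s *v laplace (lti_map W r) s + Tzr s *v laplace r s \<and>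
          laplace (zt2 W) s = Tzw s *v laplace (lti_map W r) s + laplace z2 s)
     \<and> z = (\<lambda>t. z1 w1 t + zt2 W t)
     \<comment> \<open>the power seminorms below are those of bounded power signals\<close>
     \<and> z \<in> power_signals \<and> z1 w1 \<in> power_signals \<and> z2 \<in> power_signals
     \<and> zt2 W \<in> power_signals \<and> lti_map W r \<in> power_signals
     \<and> (pow_norm z)\<^sup>2 = (pow_norm (z1 w1))\<^sup>2 + (pow_norm (zt2 W))\<^sup>2
     \<and> (pow_norm z)\<^sup>2 - \<gamma>\<^sup>2 * (pow_norm w)\<^sup>2 =
         (pow_norm (z1 w1))\<^sup>2 - \<gamma>\<^sup>2 * (pow_norm w1)\<^sup>2
         + (pow_norm (zt2 W))\<^sup>2 - \<gamma>\<^sup>2 * (pow_norm (lti_map W r))\<^sup>2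
     \<and> integrable lborel (\<lambda>\<omega>. trace (Tzw (\<i> * complex_of_real \<omega>) ** spec w1 w1 \<omega>
                                       ** para_adj Tzw (\<i> * complex_of_real \<omega>)))
     \<and> complex_of_real ((pow_norm (z1 w1))\<^sup>2) = 1 / (2 * complex_of_real pi) *
         (LINT \<omega>|lborel. trace (Tzw (\<i> * complex_of_real \<omega>) ** spec w1 w1 \<omega>
                                 ** para_adj Tzw (\<i> * complex_of_real \<omega>)))
     \<and> integrable lborel (\<lambda>\<omega>. trace (Tzr (\<i> * complex_of_real \<omega>) ** spec r r \<omega>
                                       ** para_adj Tzr (\<i> * complex_of_real \<omega>)))
     \<and> complex_of_real ((pow_norm z2)\<^sup>2) = 1 / (2 * complex_of_real pi) *
         (LINT \<omega>|lborel. trace (Tzr (\<i> * complex_of_real \<omega>) ** spec r r \<omega>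
                                 ** para_adj Tzr (\<i> * complex_of_real \<omega>)))
     \<and> (\<gamma> > 0 \<and> Linf_norm Tzw < \<gamma> \<longrightarrow>
         (let J = (\<lambda>V. (pow_norm (zt2 V))\<^sup>2 - \<gamma>\<^sup>2 * (pow_norm (lti_map V r))\<^sup>2);
              F = (\<lambda>\<omega>. trace (spec r r \<omega> ** para_adj Tzr (\<i> * complex_of_real \<omega>)
                     ** matrix_inv (mat 1 - (1 / \<gamma>\<^sup>2) *\<^sub>R
                          (Tzw (\<i> * complex_of_real \<omega>) ** para_adj Tzw (\<i> * complex_of_real \<omega>)))
                     ** Tzr (\<i> * complex_of_real \<omega>)));
              I = 1 / (2 * complex_of_real pi) * (LINT \<omega>|lborel. F \<omega>);
              S = (SUP p\<in>{(v, \<zeta>). (\<exists>V v1. dependent_weighting r v V v1) \<and> loop v r \<zeta>}.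
                     ereal ((pow_norm (snd p))\<^sup>2 - \<gamma>\<^sup>2 * (pow_norm (fst p))\<^sup>2))
          in Wt \<in> RL_inf
           \<and> (SUP V\<in>RL_inf. ereal (J V)) = ereal (J Wt)
           \<and> integrable lborel F
           \<and> complex_of_real (J Wt) = I
           \<and> S = (SUP v1\<in>power_signals.
                    ereal ((pow_norm (z1 v1))\<^sup>2 - \<gamma>\<^sup>2 * (pow_norm v1)\<^sup>2))
                 + (SUP V\<in>RL_inf. ereal (J V))
           \<and> S \<le> ereal (Re I)))"
proof -
  note Cs = assms(3) and Ks = assms(4)
  note r = \<open>r \<in> power_signals\<close> and dep = \<open>dependent_weighting r w W w1\<close> and lp = \<open>loop w r z\<close>
  have T: "Tzw \<in> RL_inf" and R: "Tzr \<in> RL_inf"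
    unfolding Tzw Tzr by (rule transfer_matrix_RL_inf[OF Ks], rule transfer_matrix_RL_inf[OF Cs])
  note eT = RL_inf_impulse_response[OF T] and eR = RL_inf_impulse_response[OF R]
  have rT: "rat_mat (lap_region False) Tzw" and rR: "rat_mat (lap_region False) Tzr"
    using T R by (simp_all add: RL_inf_iff)
  note pa = para_adj_axis[OF rT] para_adj_axis[OF rR]
  have resp: "z' = (\<lambda>t. lti_map Tzw w' t + lti_map Tzr r' t)"
    if "bounded_signal w'" "bounded_signal r'" "loop w' r' z'" for w' r' z'
    unfolding Tzw Tzr using that closed_loop_response[OF Cs Ks] unfolding loop by blast
  have lT: "laplace (lti_map Tzw u) s = Tzw s *v laplace u s" if "bounded_signal u" "Re s > 0" for u s
    unfolding Tzw by (rule laplace_lti_map[OF Ks that])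
  have lR: "laplace (lti_map Tzr u) s = Tzr s *v laplace u s" if "bounded_signal u" "Re s > 0" for u s
    unfolding Tzr by (rule laplace_lti_map[OF Cs that])
  note bT = lti_map_filter(1)[OF eT] and bR = lti_map_filter(1)[OF eR]
  note br = power_signalsD(1)[OF r]
  have w: "w \<in> power_signals" and w1: "w1 \<in> power_signals" and W: "W \<in> RL_inf"
    using dep unfolding dependent_weighting_def by blast+
  note eW = RL_inf_impulse_response[OF W]
  note bv = lti_map_filter(1)[OF eW br] and b1 = power_signalsD(1)[OF w1] and bw = power_signalsD(1)[OF w]
  have zt2': "zt2 V = (\<lambda>t. lti_map Tzw (lti_map V r) t + lti_map Tzr r t)" for V
    unfolding zt2 z2 ..
  note main = dependent_weighting_power[OF T R r, folded zt2']
  note mz = main[OF dep resp[OF bw br lp]]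
  note p1 = power_signals_of_cspec[OF bT[OF b1] lti_map_power[OF eT w1]]
    and p2 = power_signals_of_cspec[OF bR[OF br] lti_map_power[OF eR r]]
    and pv = power_signals_of_cspec[OF bv lti_map_power[OF eW r]]
  have lapl: "laplace z' s = Tzw s *v laplace w' s + Tzr s *v laplace r' s"
    if "bounded_signal w'" "bounded_signal r'" "loop w' r' z'" "Re s > 0" for w' r' z' s
    unfolding resp[OF that(1-3)] laplace_add[OF bT[OF that(1)] bR[OF that(2)] that(4)]
    by (simp add: lT lR that)
  have lapzt: "laplace (zt2 W) s = Tzw s *v laplace (lti_map W r) s + Tzr s *v laplace r s" if "Re s > 0" for s
    unfolding zt2' laplace_add[OF bT[OF bv] bR[OF br] that] by (simp add: lT lR bv br that)
  show ?thesis
  proof (intro conjI)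
    show "\<forall>w' r' z'. bounded_signal w' \<and> bounded_signal r' \<and> loop w' r' z' \<longrightarrow>
        (\<forall>s. Re s > 0 \<longrightarrow> laplace z' s = Tzw s *v laplace w' s + Tzr s *v laplace r' s)"
      using lapl by blast
    show "D12 ** Dk ** D21 = 0 \<longrightarrow>
          Tzw = transfer_matrix
            (block_mat (A + B2 ** Dk ** C2) (B2 ** Ck) (Bk ** C2) Ak)
            (block_col (B1 + B2 ** Dk ** D21) (Bk ** D21))
            (block_row ((C1 + D12 ** Dk) ** C2) (D12 ** Ck))
            0"
      unfolding Tzw by simp
    show "\<forall>s. Re s > 0 \<longrightarrow>
          laplace (z1 w1) s = Tzw s *v laplace w1 s \<and>
          laplace z2 s = Tzr s *v laplace r s \<and>
          laplace (zt2 W) s = Tzw s *v laplace (lti_map W r) s + Tzr s *v laplace r s \<and>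
          laplace (zt2 W) s = Tzw s *v laplace (lti_map W r) s + laplace z2 s"
      using lapzt by (simp add: z1 z2 lT lR b1 br)
    show "z = (\<lambda>t. z1 w1 t + zt2 W t)" unfolding z1 zt2' by (rule mz)
    show "z \<in> power_signals" "z1 w1 \<in> power_signals" "zt2 W \<in> power_signals"
      "(pow_norm z)\<^sup>2 = (pow_norm (z1 w1))\<^sup>2 + (pow_norm (zt2 W))\<^sup>2"
      unfolding z1 by (rule mz)+
    show "z2 \<in> power_signals" unfolding z2 by (rule p2)
    show "lti_map W r \<in> power_signals" by (rule pv)
    show "(pow_norm z)\<^sup>2 - \<gamma>\<^sup>2 * (pow_norm w)\<^sup>2 =
         (pow_norm (z1 w1))\<^sup>2 - \<gamma>\<^sup>2 * (pow_norm w1)\<^sup>2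
         + (pow_norm (zt2 W))\<^sup>2 - \<gamma>\<^sup>2 * (pow_norm (lti_map W r))\<^sup>2"
      unfolding mz(5,6) z1 by (simp add: algebra_simps)
    show "integrable lborel (\<lambda>\<omega>. trace (Tzw (jw \<omega>) ** spec w1 w1 \<omega>
                                       ** para_adj Tzw (jw \<omega>)))"
      "complex_of_real ((pow_norm (z1 w1))\<^sup>2) = 1 / (2 * complex_of_real pi) *
         (LINT \<omega>|lborel. trace (Tzw (jw \<omega>) ** spec w1 w1 \<omega>
                                 ** para_adj Tzw (jw \<omega>)))"
      unfolding pa z1 by (rule p1)+
    show "integrable lborel (\<lambda>\<omega>. trace (Tzr (jw \<omega>) ** spec r r \<omega>
                                       ** para_adj Tzr (jw \<omega>)))"
      "complex_of_real ((pow_norm z2)\<^sup>2) = 1 / (2 * complex_of_real pi) *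
         (LINT \<omega>|lborel. trace (Tzr (jw \<omega>) ** spec r r \<omega>
                                 ** para_adj Tzr (jw \<omega>)))"
      unfolding pa z2 by (rule p2)+
  next
    define J where "J V = (pow_norm (zt2 V))\<^sup>2 - \<gamma>\<^sup>2 * (pow_norm (lti_map V r))\<^sup>2" for V
    define K where "K v1 = (pow_norm (z1 v1))\<^sup>2 - \<gamma>\<^sup>2 * (pow_norm v1)\<^sup>2" for v1
    define F where "F \<omega> = trace (spec r r \<omega> ** para_adj Tzr (jw \<omega>)
                     ** matrix_inv (mat 1 - (1 / \<gamma>\<^sup>2) *\<^sub>R
                          (Tzw (jw \<omega>) ** para_adj Tzw (jw \<omega>)))
                     ** Tzr (jw \<omega>))" for \<omega>
    define I where "I = 1 / (2 * complex_of_real pi) * (LINT \<omega>|lborel. F \<omega>)"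
    define P where "P = {(v, \<zeta>). (\<exists>V v1. dependent_weighting r v V v1) \<and> loop v r \<zeta>}"
    define q where "q p = (pow_norm (snd p))\<^sup>2 - \<gamma>\<^sup>2 * (pow_norm (fst p))\<^sup>2" for p :: "(real \<Rightarrow> real^'w) \<times> (real \<Rightarrow> real^'z)"
    have goal: "Wt \<in> RL_inf \<and> (SUP V\<in>RL_inf. ereal (J V)) = ereal (J Wt) \<and> integrable lborel F \<and>
        complex_of_real (J Wt) = I \<and>
        (SUP p\<in>P. ereal (q p)) = (SUP v1\<in>power_signals. ereal (K v1)) + (SUP V\<in>RL_inf. ereal (J V)) \<and>
        (SUP p\<in>P. ereal (q p)) \<le> ereal (Re I)" if g: "\<gamma> > 0" "Linf_norm Tzw < \<gamma>"
    proof -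
      note dg = dependent_gap[OF T R r g, folded zt2' Wt, folded J_def F_def]
      have JW: "complex_of_real (J Wt) = I" using dg(3) by (simp add: I_def F_def[abs_def])
      have supJ: "(SUP V\<in>RL_inf. ereal (J V)) = ereal (J Wt)"
        by (rule antisym) (auto intro!: SUP_least SUP_upper dg)
      have g2: "(Linf_norm Tzw)\<^sup>2 \<le> \<gamma>\<^sup>2"
        using g Linf_norm_bound(2)[OF T] by (intro power_mono) auto
      have K: "K v1 \<le> 0" if "v1 \<in> power_signals" for v1
        using pow_norm_contraction[OF T that] mult_right_mono[OF g2, of "(pow_norm v1)\<^sup>2"]
        by (simp add: K_def z1)
      have K0: "K (\<lambda>t. 0) = 0" by (simp add: K_def z1 zero_power_signal(2))
      have supK: "(SUP v1\<in>power_signals. ereal (K v1)) = 0"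
      proof (rule antisym)
        show "(SUP v1\<in>power_signals. ereal (K v1)) \<le> 0"
          by (intro SUP_least) (use K in \<open>simp add: zero_ereal_def\<close>)
        have "ereal (K (\<lambda>t. 0)) \<le> (SUP v1\<in>power_signals. ereal (K v1))"
          by (intro SUP_upper zero_power_signal)
        thus "0 \<le> (SUP v1\<in>power_signals. ereal (K v1))" by (simp add: K0 zero_ereal_def)
      qed
      \<comment> \<open>The objective separates: \<open>w1\<close> enters only \<open>K\<close> and
        the weighting only \<open>J\<close>, whichever splitting of the disturbance is used.\<close>
      have qK: "q (v, \<zeta>) = K v1 + J V" if d: "dependent_weighting r v V v1" and l: "loop v r \<zeta>" for v \<zeta> V v1
      proof -
        have "v \<in> power_signals" using d unfolding dependent_weighting_def by blast
        note m = main[OF d resp[OF power_signalsD(1)[OF this] br l]]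
        show ?thesis unfolding q_def K_def J_def fst_conv snd_conv m(5,6) z1 by (simp add: algebra_simps)
      qed
      have supq: "(SUP p\<in>P. ereal (q p)) = ereal (J Wt)"
      proof (rule antisym)
        show "(SUP p\<in>P. ereal (q p)) \<le> ereal (J Wt)"
        proof (rule SUP_least)
          fix p assume "p \<in> P"
          then obtain v \<zeta> V v1 where p: "p = (v, \<zeta>)" and d: "dependent_weighting r v V v1" and l: "loop v r \<zeta>"
            unfolding P_def by blast
          have "v1 \<in> power_signals" "V \<in> RL_inf" using d by (simp_all add: dependent_weighting_def)
          thus "ereal (q p) \<le> ereal (J Wt)" unfolding p qK[OF d l] using K dg(4) by fastforce
        qed
        define v where "v = lti_map Wt r"
        note eWt = RL_inf_impulse_response[OF dg(1)]
        have bvt: "bounded_signal v" unfolding v_def by (rule lti_map_filter(1)[OF eWt br])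
        have vP: "v \<in> power_signals"
          unfolding v_def by (rule power_signals_of_cspec(1)[OF lti_map_filter(1)[OF eWt br] lti_map_power[OF eWt r]])
        \<comment> \<open>Stated for an arbitrary dimension, since it is used for \<open>r\<close>
          as well as for \<open>v\<close>.\<close>
        have orth: "orthogonal_signals (\<lambda>t. 0 :: real^'w) u" if "bounded_signal u" for u :: "real \<Rightarrow> real^'b"
        proof -
          have b0: "bounded_signal (\<lambda>t. 0 :: real^'w)" by (rule power_signalsD(1)[OF zero_power_signal(1)])
          have c0: "cspec (\<lambda>t. 0 :: real^'w) u (\<lambda>\<omega>. 0)" by (rule cspec_zero)
          show ?thesis using cspec_spec(1,2)[OF b0 that c0] by (simp add: orthogonal_signals_def)
        qed
        have d: "dependent_weighting r v Wt (\<lambda>t. 0)"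
          unfolding dependent_weighting_def
          using vP zero_power_signal(1) dg(1) orth[OF br] orth[OF bvt] by (simp add: v_def[symmetric])
        \<comment> \<open>The supremum runs over trajectories, so the worst disturbance counts only
          together with an output that realises it.\<close>
        obtain \<zeta> where l: "loop v r \<zeta>"
          using closed_loop_exists[OF Cs Ks assms(5,6) bvt br] unfolding loop by blast
        have "(v, \<zeta>) \<in> P" unfolding P_def using d l by blast
        hence "ereal (q (v, \<zeta>)) \<le> (SUP p\<in>P. ereal (q p))" by (rule SUP_upper)
        thus "ereal (J Wt) \<le> (SUP p\<in>P. ereal (q p))" unfolding qK[OF d l] K0 by simp
      qed
      have "Re I = J Wt" unfolding JW[symmetric] by simp
      thus ?thesis using dg(1,2) supJ JW supK supq by (simp add: F_def[abs_def])
    qed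
    thus "\<gamma> > 0 \<and> Linf_norm Tzw < \<gamma> \<longrightarrow>
         (let J = (\<lambda>V. (pow_norm (zt2 V))\<^sup>2 - \<gamma>\<^sup>2 * (pow_norm (lti_map V r))\<^sup>2);
              F = (\<lambda>\<omega>. trace (spec r r \<omega> ** para_adj Tzr (jw \<omega>)
                     ** matrix_inv (mat 1 - (1 / \<gamma>\<^sup>2) *\<^sub>R
                          (Tzw (jw \<omega>) ** para_adj Tzw (jw \<omega>)))
                     ** Tzr (jw \<omega>)));
              I = 1 / (2 * complex_of_real pi) * (LINT \<omega>|lborel. F \<omega>);
              S = (SUP p\<in>{(v, \<zeta>). (\<exists>V v1. dependent_weighting r v V v1) \<and> loop v r \<zeta>}.
                     ereal ((pow_norm (snd p))\<^sup>2 - \<gamma>\<^sup>2 * (pow_norm (fst p))\<^sup>2))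
          in Wt \<in> RL_inf
           \<and> (SUP V\<in>RL_inf. ereal (J V)) = ereal (J Wt)
           \<and> integrable lborel F
           \<and> complex_of_real (J Wt) = I
           \<and> S = (SUP v1\<in>power_signals.
                    ereal ((pow_norm (z1 v1))\<^sup>2 - \<gamma>\<^sup>2 * (pow_norm v1)\<^sup>2))
                 + (SUP V\<in>RL_inf. ereal (J V))
           \<and> S \<le> ereal (Re I))"
      unfolding Let_def I_def J_def[abs_def] K_def[abs_def] F_def[abs_def] P_def q_def[abs_def] by blast
  qed
qed

end
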